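(* Consider a Type $\mathscr B_1$ rank $2$ Bäcklund transformation with $\mathcal B$ Pfaffian, its $G$-structure $\mathcal G$ of $1$-adapted coframings, and the $G$-action on the $20$ torsion functions whose infinitesimal form is (V) in the context. This $G$-action has all its orbits being at most $2$-dimensional if and only if, in the structure equations of $\mathcal G$, both $\omega^1$ and $\omega^3$ are integrable (i.e. $\mathrm d\omega^1\equiv0\bmod\omega^1$ and $\mathrm d\omega^3\equiv0\bmod\omega^3$).
   Context: EDS $(M,\mathcal I)$: $\mathcal I\subset\Omega^*(M)$ an ideal closed under $\mathrm d$; $[\![\cdots]\!]$ = bundle spanned; $I^1$ = bundle spanned by the degree 1 part of $\mathcal I$. A rank $k$ integrable extension is a submersion $\pi:(N,\mathcal J)\to(M,\mathcal I)$ with $k$-dimensional fibres such that locally there is a rank $k$ subbundle $\Theta\subset T^*N$ with $\mathcal J$ algebraically generated by $\pi^*\mathcal I$ and sections of $\Theta$, and $\Theta^\perp\cap\ker\pi_*=0$. A rank $r$ Bäcklund transformation $(N,\mathcal B;\pi,\bar\pi)$ relating $(M,\mathcal I)$, $(\bar M,\bar{\mathcal I})$: both $\pi,\bar\pi$ are rank $r$ integrable extensions. Hyperbolic Monge-Ampère system: EDS $(M^5,\mathcal I)$ locally generated by a contact form $\theta$, $\mathrm d\theta$ and a 2-form $\Phi$ such that $(\lambda\,\mathrm d\theta+\mu\Phi)^2\equiv0\bmod\theta$ has precisely two distinct solutions in $\mathbb{RP}^1$ at each point. Type $\mathscr B$: a rank 2 Bäcklund transformation relating two hyperbolic Monge-Ampère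 systems such that $\pi^*I^1\cap\bar\pi^*\bar I^1=0$ but, for local generators $\theta,\bar\theta$ of $\pi^*I^1,\bar\pi^*\bar I^1$ and $B^1=[\![\theta,\bar\theta,\gamma]\!]$, $\mathrm d\theta$ and $\mathrm d\bar\theta$ are linearly dependent mod $\theta,\bar\theta,\gamma$. $\mathcal B$ is Pfaffian: differentially generated by its degree 1 part. The ordered characteristic systems of $(N,\mathcal B)$ are $\chi_{10}=[\![B^1,\omega^1,\omega^2]\!]$, $\chi_{01}=[\![B^1,\omega^3,\omega^4]\!]$, where $\mathcal B$ is algebraically generated by $B^1,\omega^1\wedge\omega^2,\omega^3\wedge\omega^4$. Type $\mathscr B_1$: locally there exist 1-adapted coframings, i.e. coframings $(\omega^0,\bar\omega^0,\gamma,\omega^1,\dots,\omega^4)$ of $N$ with $[\![\omega^0]\!]=\pi^*I^1$, $[\![\bar\omega^0]\!]=\bar\pi^*\bar I^1$, $[\![\omega^0,\bar\omega^0,\gamma]\!]=B^1$, $\chi_{10}=[\![\omega^0,\bar\omega^0,\gamma,\omega^1,\omega^2]\!]$, $\chi_{01}=[\![\omega^0,\bar\omega^0,\gamma,\omega^3,\omega^4]\!]$, and $\mathrm d\omega^0\equiv\omega^1\wedge\omega^2+\omega^3\wedge\omega^4+\omega^3\wedge\gamma\bmod\omega^0$, $\mathrm d\bar\omega^0\equiv\omega^1\wedge\omega^2+\omega^3\wedge\omega^4+\omega^1\wedge\gamma\bmod\bar\omega^0$, $\mathrm d\gamma\equiv\omega^1\wedge\omega^2-\omega^3\wedge\omega^4\bmod\omega^0,\bar\omega^0,\gamma$.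 They are the sections of a $G$-structure $\mathcal G$ on $N$ (right action $\boldsymbol\omega\cdot g=g^{-1}\boldsymbol\omega$), where $G\subset GL(7,\mathbb R)$ consists of the matrices $$g=\begin{pmatrix} r&0&0&0&0&0&0\\0&r&0&0&0&0&0\\c&-c&r&0&0&0&0\\0&0&0&1&0&0&0\\-c&0&0&a&r&0&0\\0&0&0&0&0&1&0\\0&c&0&0&0&b&r\end{pmatrix},\quad a,b,c\in\mathbb R,\ r\ne0.$$ Structure equations on $\mathcal G$ (with $\boldsymbol\omega$ the tautological form): there are 1-forms $\phi,\varpi,\alpha,\beta$ (pseudo-connection) with $\mathrm d\omega^0=-\phi\wedge\omega^0+\Omega^0$, $\mathrm d\bar\omega^0=-\phi\wedge\bar\omega^0+\bar\Omega^0$, $\mathrm d\gamma=-\varpi\wedge(\omega^0-\bar\omega^0)-\phi\wedge\gamma+\Gamma$, $\mathrm d\omega^1=\Omega^1$, $\mathrm d\omega^2=\varpi\wedge\omega^0-\alpha\wedge\omega^1-\phi\wedge\omega^2+\Omega^2$, $\mathrm d\omega^3=\Omega^3$, $\mathrm d\omega^4=-\varpi\wedge\bar\omega^0-\beta\wedge\omega^3-\phi\wedge\omega^4+\Omega^4$. After absorption and using $\mathrm d^2=0$ the torsion is, with $K=\frac{P_4-P_2}4$ and $C_1K=0$: $\Omega^0=\omega^1\wedge\omega^2+\omega^3\wedge(\omega^4+\gamma)+(K\gamma+\sum_iP_i\omega^i)\wedge\omega^0$, $\bar\Omega^0=\omega^1\wedge(\omega^2+\gamma)+\omega^3\wedge\omega^4+(-K\gamma+(P_1+1)\omega^1+P_2\omega^2+(P_3+1)\omega^3+P_4\omega^4)\wedge\bar\omega^0$,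 $\Gamma=\omega^1\wedge\omega^2-\omega^3\wedge\omega^4+C_1(\omega^1-\omega^3)\wedge(\omega^0+\bar\omega^0)$, $\Omega^1=T^1_0\omega^0\wedge\bar\omega^0+\omega^0\wedge(T^1_1\omega^1+T^1_2(\omega^2+\gamma))+\bar\omega^0\wedge(\bar T^1_1\omega^1+\bar T^1_2\omega^2)+\gamma\wedge(R^1_1\omega^1+R^1_2\omega^2)+\frac{P_2}2\omega^3\wedge(\gamma+\omega^2+\omega^4)-\frac{P_2}2\omega^1\wedge\omega^2-\frac{P_1+P_3+1}2\omega^1\wedge\omega^3-\frac{P_4}2\omega^1\wedge\omega^4$, $\Omega^2=T^2_0\omega^0\wedge\bar\omega^0-\omega^0\wedge(C_1\omega^3+T^1_1(\omega^2+\gamma))-\bar T^1_1\bar\omega^0\wedge\omega^2-\big(R^1_1+\frac{P_2+P_4}4\big)\gamma\wedge\omega^2-\big(C_1+\frac{P_1}2\big)\omega^3\wedge(\gamma+\omega^2+\omega^4)$, $\Omega^3=T^3_0\bar\omega^0\wedge\omega^0+\bar\omega^0\wedge(\bar T^3_3\omega^3+\bar T^3_4(\omega^4+\gamma))+\omega^0\wedge(T^3_3\omega^3+T^3_4\omega^4)+\gamma\wedge(R^3_3\omega^3+R^3_4\omega^4)+\frac{P_4}2\omega^1\wedge(\gamma+\omega^2+\omega^4)+\frac{P_1+P_3+1}2\omega^1\wedge\omega^3+\frac{P_2}2\omega^2\wedge\omega^3-\frac{P_4}2\omega^3\wedge\omega^4$, $\Omega^4=-T^2_0\bar\omega^0\wedge\omega^0+\bar\omega^0\wedge(C_1\omega^1-\bar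 T^3_3(\omega^4+\gamma))-T^3_3\omega^0\wedge\omega^4-\big(R^3_3+\frac{P_2+P_4}4\big)\gamma\wedge\omega^4-\big(C_1+\frac{P_3+1}2\big)\omega^1\wedge(\gamma+\omega^2+\omega^4)$. The 20 remaining torsion functions are $C_1,P_1,\dots,P_4,R^1_1,R^1_2,R^3_3,R^3_4,T^1_0,T^2_0,T^3_0,T^1_1,T^1_2,\bar T^1_1,\bar T^1_2,T^3_3,T^3_4,\bar T^3_3,\bar T^3_4$. Along the fibres of $\mathcal G$ they vary by the $G$-action whose infinitesimal form is (V), all congruences mod $\omega^0,\bar\omega^0,\gamma,\omega^1,\dots,\omega^4$: $\mathrm dC_1\equiv0$; $\mathrm dP_1\equiv\alpha P_2-2\varpi$; $\mathrm dP_2\equiv\phi P_2$; $\mathrm dP_3\equiv\beta P_4+2\varpi$; $\mathrm dP_4\equiv\phi P_4$; $\mathrm dR^1_1\equiv\phi R^1_1+\alpha R^1_2$; $\mathrm dR^1_2\equiv2\phi R^1_2$; $\mathrm dR^3_3\equiv\phi R^3_3+\beta R^3_4$; $\mathrm dR^3_4\equiv2\phi R^3_4$; $\mathrm dT^1_0\equiv2\phi T^1_0-\varpi(T^1_2-\bar T^1_2)$; $\mathrm dT^2_0\equiv-\frac\alpha2T^1_0+\phi T^2_0+\frac\beta2T^3_0+\frac\varpi2(T^1_1-T^3_3-\bar T^1_1+\bar T^3_3)$; $\mathrm dT^3_0\equiv2\phi T^3_0-\varpi(T^3_4-\bar T^3_4)$; $\mathrm dT^1_1\equiv\phi T^1_1+\alpha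 T^1_2-\varpi(\frac{P_2}2-R^1_1)$; $\mathrm dT^1_2\equiv2\phi T^1_2+\varpi R^1_2$; $\mathrm d\bar T^1_1\equiv\phi\bar T^1_1+\alpha\bar T^1_2+\varpi(\frac{P_4}2-R^1_1)$; $\mathrm d\bar T^1_2\equiv2\phi\bar T^1_2-\varpi R^1_2$; $\mathrm d\bar T^3_3\equiv\phi\bar T^3_3+\beta\bar T^3_4-\varpi(-\frac{P_4}2+R^3_3)$; $\mathrm d\bar T^3_4\equiv2\phi\bar T^3_4-\varpi R^3_4$; $\mathrm dT^3_3\equiv\phi T^3_3+\beta T^3_4+\varpi(-\frac{P_2}2+R^3_3)$; $\mathrm dT^3_4\equiv2\phi T^3_4+\varpi R^3_4$. The orbits in question are the images in $\mathbb R^{20}$ of the fibres of $\mathcal G\to N$ under the map given by these 20 torsion functions (one orbit for each point of $N$). *)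

theory Defs
  imports "HOL-Analysis.Analysis" "HOL-Library.Function_Algebras"
begin

section \<open>Smooth manifolds\<close>

text \<open>
  Everything is in the \<open>C\<^sup>\<infinity>\<close> category. The domain \<open>S\<close> below is always open, so that the
  Frechet derivative at a point of \<open>S\<close> only depends on \<open>f\<close> on \<open>S\<close>.
\<close>

primrec times_differentiable_on ::
  "nat \<Rightarrow> 'e::real_normed_vector set \<Rightarrow> ('e \<Rightarrow> 'f::real_normed_vector) \<Rightarrow> bool" where
  "times_differentiable_on 0 S f \<longleftrightarrow> continuous_on S f"
| "times_differentiable_on (Suc n) S f \<longleftrightarrow>
     (\<forall>x\<in>S. f differentiable (at x)) \<and>
     (\<forall>v. times_differentiable_on n S (\<lambda>x. frechet_derivative f (at x) v))"

definition smooth_on :: "'e::real_normed_vector set \<Rightarrow> ('e \<Rightarrow> 'f::real_normed_vector) \<Rightarrow> bool" where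
  "smooth_on S f \<longleftrightarrow> (\<forall>n. times_differentiable_on n S f)"

text \<open>
  A chart is a pair of its domain and its coordinate map; a manifold is given by an atlas. Its
  dimension is the dimension of the Euclidean space \<open>'e\<close> it is modelled on.
\<close>

type_synonym ('a, 'e) chart = "'a set \<times> ('a \<Rightarrow> 'e)"

definition points :: "('a, 'e) chart set \<Rightarrow> 'a set" where
  "points A = \<Union> (fst ` A)"

definition chart_inv :: "('a, 'e) chart \<Rightarrow> 'e \<Rightarrow> 'a" where
  "chart_inv c = inv_into (fst c) (snd c)"

definition mtop :: "('a, 'e::euclidean_space) chart set \<Rightarrow> 'a topology" where
  "mtop A = topology (\<lambda>W. W \<subseteq> points A \<and> (\<forall>c\<in>A. open (snd c ` (W \<inter> fst c))))"

definition smooth_manifold :: "('a, 'e::euclidean_space) chart set \<Rightarrow> bool" where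
  "smooth_manifold A \<longleftrightarrow>
     (\<forall>c\<in>A. inj_on (snd c) (fst c) \<and> open (snd c ` fst c)) \<and>
     (\<forall>c\<in>A. \<forall>c'\<in>A. open (snd c ` (fst c \<inter> fst c')) \<and>
        smooth_on (snd c ` (fst c \<inter> fst c')) (\<lambda>x. snd c' (chart_inv c x))) \<and>
     Hausdorff_space (mtop A) \<and> second_countable (mtop A)"

text \<open>\<open>jac c f c' p\<close> is the differential of \<open>f\<close> at \<open>p\<close>, read in the charts \<open>c\<close> and \<open>c'\<close>.\<close>

definition jac :: "('a, 'e::euclidean_space) chart \<Rightarrow> ('a \<Rightarrow> 'b) \<Rightarrow> ('b, 'f::euclidean_space) chart
    \<Rightarrow> 'a \<Rightarrow> 'e \<Rightarrow> 'f" where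
  "jac c f c' p = frechet_derivative (\<lambda>x. snd c' (f (chart_inv c x))) (at (snd c p))"

definition smooth_map :: "('a, 'e::euclidean_space) chart set \<Rightarrow> ('b, 'f::euclidean_space) chart set
    \<Rightarrow> ('a \<Rightarrow> 'b) \<Rightarrow> bool" where
  "smooth_map A B f \<longleftrightarrow> f ` points A \<subseteq> points B \<and>
     (\<forall>c\<in>A. \<forall>c'\<in>B. open (snd c ` (fst c \<inter> f -` fst c')) \<and>
        smooth_on (snd c ` (fst c \<inter> f -` fst c')) (\<lambda>x. snd c' (f (chart_inv c x))))"

definition submersion :: "('a, 'e::euclidean_space) chart set \<Rightarrow> ('b, 'f::euclidean_space) chart set
    \<Rightarrow> ('a \<Rightarrow> 'b) \<Rightarrow> bool" where
  "submersion A B f \<longleftrightarrow> smooth_map A B f \<and>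
     (\<forall>c\<in>A. \<forall>c'\<in>B. \<forall>p \<in> fst c \<inter> f -` fst c'. surj (jac c f c' p))"


section \<open>Differential forms\<close>

text \<open>
  An element of the exterior algebra \<open>\<Lambda>\<^sup>*(T\<^sup>*\<^sub>p)\<close> is represented by its components: \<open>\<xi> c [w1, \<dots>, wk]\<close> is
  the value of the degree \<open>k\<close> part of \<open>\<xi>\<close> on the tangent vectors with coordinates \<open>w1, \<dots>, wk\<close> in
  the chart \<open>c\<close>. Elements may be inhomogeneous. Components in charts that do not contain the base
  point are \<open>0\<close>, and forms defined on an open set \<open>U\<close> are \<open>0\<close> outside \<open>U\<close>; so equality
  of forms is equality of functions, and \<open>+\<close>, \<open>-\<close> and \<open>0\<close> are the pointwise ones.
\<close>

type_synonym ('a, 'e) alt_form = "('a, 'e) chart \<Rightarrow> 'e list \<Rightarrow> real"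
type_synonym ('a, 'e) form = "'a \<Rightarrow> ('a, 'e) alt_form"

definition ext_at :: "('a, 'e::euclidean_space) chart set \<Rightarrow> 'a \<Rightarrow> ('a, 'e) alt_form set" where
  "ext_at A p = {\<xi>.
     (\<forall>c ws. \<not> (c \<in> A \<and> p \<in> fst c) \<longrightarrow> \<xi> c ws = 0) \<and>
     (\<forall>c\<in>A. p \<in> fst c \<longrightarrow>
        (\<forall>ws. \<forall>i<length ws. linear (\<lambda>w. \<xi> c (ws[i := w]))) \<and>
        (\<forall>ws i j. i < j \<and> j < length ws \<and> ws ! i = ws ! j \<longrightarrow> \<xi> c ws = 0)) \<and>
     (\<forall>c\<in>A. \<forall>c'\<in>A. p \<in> fst c \<inter> fst c' \<longrightarrow>
        (\<forall>ws. \<xi> c' (map (jac c (\<lambda>q. q) c' p) ws) = \<xi> c ws))}"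

definition scale :: "real \<Rightarrow> ('a, 'e) alt_form \<Rightarrow> ('a, 'e) alt_form"  (infixr "*\<^sub>\<Lambda>" 75) where
  "a *\<^sub>\<Lambda> \<xi> = (\<lambda>c ws. a * \<xi> c ws)"

text \<open>
  Shuffle formula: \<open>(\<xi> \<and> \<eta>)(w\<^sub>1,\<dots>,w\<^sub>n)\<close> is the sum, over the sets \<open>S\<close> of positions filled into \<open>\<xi>\<close>, of
  the terms \<open>\<plusminus>\<xi>(w\<^sub>S) \<eta>(w\<^sub>S\<^sub>')\<close> with \<open>S'\<close> the complement of \<open>S\<close>; so
  \<open>(\<xi> \<and> \<eta>)(v,w) = \<xi>(v) \<eta>(w) - \<xi>(w) \<eta>(v)\<close> in degree \<open>1\<close>.
\<close>

definition wedge :: "('a, 'e) alt_form \<Rightarrow> ('a, 'e) alt_form \<Rightarrow> ('a, 'e) alt_form"  (infixr "\<and>\<^sub>\<Lambda>" 70) where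
  "\<xi> \<and>\<^sub>\<Lambda> \<eta> = (\<lambda>c ws. \<Sum>S\<in>Pow {..<length ws}.
     (- 1) ^ card {(i, j). i \<in> S \<and> j \<in> {..<length ws} - S \<and> j < i} *
       \<xi> c (nths ws S) * \<eta> c (nths ws ({..<length ws} - S)))"

definition wedge_form :: "('a, 'e) form \<Rightarrow> ('a, 'e) form \<Rightarrow> ('a, 'e) form"  (infixr "\<and>\<^sub>\<Omega>" 70) where
  "\<omega> \<and>\<^sub>\<Omega> \<eta> = (\<lambda>p. \<omega> p \<and>\<^sub>\<Lambda> \<eta> p)"

text \<open>\<open>forms A U\<close> is \<open>\<Omega>\<^sup>*(U)\<close> for \<open>U\<close> open.\<close>

definition forms :: "('a, 'e::euclidean_space) chart set \<Rightarrow> 'a set \<Rightarrow> ('a, 'e) form set" where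
  "forms A U = {\<omega>. (\<forall>p\<in>U. \<omega> p \<in> ext_at A p) \<and> (\<forall>p. p \<notin> U \<longrightarrow> \<omega> p = 0) \<and>
     (\<forall>c\<in>A. \<forall>ws. smooth_on (snd c ` (U \<inter> fst c)) (\<lambda>x. \<omega> (chart_inv c x) c ws))}"

definition degree_forms ::
  "nat \<Rightarrow> ('a, 'e::euclidean_space) chart set \<Rightarrow> 'a set \<Rightarrow> ('a, 'e) form set" where
  "degree_forms k A U = {\<omega> \<in> forms A U. \<forall>p c ws. length ws \<noteq> k \<longrightarrow> \<omega> p c ws = 0}"

definition fn_form :: "('a, 'e) chart set \<Rightarrow> ('a \<Rightarrow> real) \<Rightarrow> ('a, 'e) form" where
  "fn_form A f = (\<lambda>p c ws. if c \<in> A \<and> p \<in> fst c \<and> ws = [] then f p else 0)"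

text \<open>
  The exterior derivative on \<open>U\<close>: in each chart, the alternating sum of the directional derivatives
  of the components.
\<close>

definition ext_d :: "('a, 'e::euclidean_space) chart set \<Rightarrow> 'a set \<Rightarrow> ('a, 'e) form \<Rightarrow> ('a, 'e) form" where
  "ext_d A U \<omega> = (\<lambda>p c ws. if p \<in> U \<and> c \<in> A \<and> p \<in> fst c then
     (\<Sum>i<length ws. (- 1) ^ i *
       frechet_derivative (\<lambda>x. \<omega> (chart_inv c x) c (take i ws @ drop (Suc i) ws)) (at (snd c p)) (ws ! i))
     else 0)"

definition restrict_form :: "'a set \<Rightarrow> ('a, 'e) form \<Rightarrow> ('a, 'e) form" where
  "restrict_form U \<omega> = (\<lambda>p. if p \<in> U then \<omega> p else 0)"

text \<open>
  Pullback of an element of \<open>\<Lambda>\<^sup>*(T\<^sup>*\<^bsub>f p\<^esub>)\<close> to \<open>p\<close>; the result does not depend on the chart chosen at \<open>f p\<close>.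
\<close>

definition pull_at :: "('a, 'e::euclidean_space) chart set \<Rightarrow> ('b, 'f::euclidean_space) chart set
    \<Rightarrow> ('a \<Rightarrow> 'b) \<Rightarrow> 'a \<Rightarrow> ('b, 'f) alt_form \<Rightarrow> ('a, 'e) alt_form" where
  "pull_at A B f p \<xi> = (\<lambda>c ws. if c \<in> A \<and> p \<in> fst c then
     (let c' = (SOME c'. c' \<in> B \<and> f p \<in> fst c') in \<xi> c' (map (jac c f c' p) ws)) else 0)"

definition pullback :: "('a, 'e::euclidean_space) chart set \<Rightarrow> ('b, 'f::euclidean_space) chart set
    \<Rightarrow> ('a \<Rightarrow> 'b) \<Rightarrow> ('b, 'f) form \<Rightarrow> ('a, 'e) form" where
  "pullback A B f \<omega> = (\<lambda>p. if p \<in> points A then pull_at A B f p (\<omega> (f p)) else 0)"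

text \<open>
  The fibre spanned by a set of covectors, linear independence of a list of them, and the sections
  over \<open>U\<close> of a family \<open>E\<close> of subspaces of the cotangent spaces.
\<close>

definition lin_span :: "('a, 'e) alt_form set \<Rightarrow> ('a, 'e) alt_form set" where
  "lin_span S = {(\<Sum>\<xi>\<in>T. a \<xi> *\<^sub>\<Lambda> \<xi>) | T a. finite T \<and> T \<subseteq> S}"

definition lin_indep :: "('a, 'e) alt_form list \<Rightarrow> bool" where
  "lin_indep \<xi>s \<longleftrightarrow> (\<forall>a. (\<Sum>i<length \<xi>s. a i *\<^sub>\<Lambda> (\<xi>s ! i)) = 0 \<longrightarrow> (\<forall>i<length \<xi>s. a i = 0))"

definition sections ::
  "('a, 'e::euclidean_space) chart set \<Rightarrow> 'a set \<Rightarrow> ('a \<Rightarrow> ('a, 'e) alt_form set) \<Rightarrow> ('a, 'e) form set" where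
  "sections A U E = {\<omega> \<in> degree_forms 1 A U. \<forall>p\<in>U. \<omega> p \<in> E p}"


section \<open>Exterior differential systems\<close>

text \<open>
  Two-sided ideals of an algebra \<open>R\<close> with multiplication \<open>m\<close>. This is used for \<open>R = \<Omega>\<^sup>*(U)\<close> and for
  \<open>R = \<Lambda>\<^sup>*(T\<^sup>*\<^sub>p)\<close>.
\<close>

definition is_ideal :: "('b::ab_group_add) set \<Rightarrow> ('b \<Rightarrow> 'b \<Rightarrow> 'b) \<Rightarrow> 'b set \<Rightarrow> bool" where
  "is_ideal R m J \<longleftrightarrow> J \<subseteq> R \<and> 0 \<in> J \<and> (\<forall>x\<in>J. \<forall>y\<in>J. x + y \<in> J) \<and>
     (\<forall>x\<in>J. \<forall>r\<in>R. m r x \<in> J \<and> m x r \<in> J)"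

definition gen_ideal :: "('b::ab_group_add) set \<Rightarrow> ('b \<Rightarrow> 'b \<Rightarrow> 'b) \<Rightarrow> 'b set \<Rightarrow> 'b set" where
  "gen_ideal R m S = \<Inter> {J. is_ideal R m J \<and> S \<subseteq> J}"

definition alg_ideal ::
  "('a, 'e::euclidean_space) chart set \<Rightarrow> 'a set \<Rightarrow> ('a, 'e) form set \<Rightarrow> ('a, 'e) form set" where
  "alg_ideal A U S = gen_ideal (forms A U) (\<and>\<^sub>\<Omega>) S"

definition alg_ideal_at ::
  "('a, 'e::euclidean_space) chart set \<Rightarrow> 'a \<Rightarrow> ('a, 'e) alt_form set \<Rightarrow> ('a, 'e) alt_form set" where
  "alg_ideal_at A p S = gen_ideal (ext_at A p) (\<and>\<^sub>\<Lambda>) S"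

definition EDS :: "('a, 'e::euclidean_space) chart set \<Rightarrow> ('a, 'e) form set \<Rightarrow> bool" where
  "EDS A I \<longleftrightarrow> is_ideal (forms A (points A)) (\<and>\<^sub>\<Omega>) I \<and> (\<forall>\<omega>\<in>I. ext_d A (points A) \<omega> \<in> I)"

definition local_ideal ::
  "('a, 'e::euclidean_space) chart set \<Rightarrow> 'a set \<Rightarrow> ('a, 'e) form set \<Rightarrow> ('a, 'e) form set" where
  "local_ideal A U I = alg_ideal A U (restrict_form U ` I)"

text \<open>\<open>deg1 A I p\<close> is the fibre at \<open>p\<close> of the bundle \<open>I\<^sup>1\<close> spanned by the degree 1 part of \<open>I\<close>.\<close>

definition deg1 ::
  "('a, 'e::euclidean_space) chart set \<Rightarrow> ('a, 'e) form set \<Rightarrow> 'a \<Rightarrow> ('a, 'e) alt_form set" where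
  "deg1 A I p = lin_span ((\<lambda>\<omega>. \<omega> p) ` (I \<inter> degree_forms 1 A (points A)))"

definition pull_deg1 :: "('a, 'e::euclidean_space) chart set \<Rightarrow> ('b, 'f::euclidean_space) chart set
    \<Rightarrow> ('a \<Rightarrow> 'b) \<Rightarrow> ('b, 'f) form set \<Rightarrow> 'a \<Rightarrow> ('a, 'e) alt_form set" where
  "pull_deg1 A B f I p = pull_at A B f p ` deg1 B I (f p)"

definition Pfaffian :: "('a, 'e::euclidean_space) chart set \<Rightarrow> ('a, 'e) form set \<Rightarrow> bool" where
  "Pfaffian A I \<longleftrightarrow> I = \<Inter> {J. EDS A J \<and> I \<inter> degree_forms 1 A (points A) \<subseteq> J}"

text \<open>
  The rank \<open>k\<close> subbundle \<open>\<Theta>\<close> is given, over a sufficiently small \<open>U\<close>, by the frame \<open>\<theta>s\<close>; the last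
  conjunct is \<open>\<Theta>\<^sup>\<bottom> \<inter> ker f\<^sub>* = 0\<close>, tangent vectors being given by their coordinates \<open>w\<close> in \<open>c\<close>.
\<close>

definition integrable_extension :: "nat \<Rightarrow>
    ('a, 'e::euclidean_space) chart set \<Rightarrow> ('a, 'e) form set \<Rightarrow>
    ('b, 'f::euclidean_space) chart set \<Rightarrow> ('b, 'f) form set \<Rightarrow> ('a \<Rightarrow> 'b) \<Rightarrow> bool" where
  "integrable_extension k A J B I f \<longleftrightarrow>
     EDS A J \<and> EDS B I \<and> submersion A B f \<and> DIM('e) = DIM('f) + k \<and>
     (\<forall>p\<in>points A. \<exists>U \<theta>s. openin (mtop A) U \<and> p \<in> U \<and>
        length \<theta>s = k \<and> set \<theta>s \<subseteq> degree_forms 1 A U \<and>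
        (\<forall>q\<in>U. lin_indep (map (\<lambda>\<theta>. \<theta> q) \<theta>s)) \<and>
        local_ideal A U J = alg_ideal A U
          (restrict_form U ` pullback A B f ` I \<union>
           sections A U (\<lambda>q. lin_span ((\<lambda>\<theta>. \<theta> q) ` set \<theta>s))) \<and>
        (\<forall>q\<in>U. \<forall>c\<in>A. \<forall>c'\<in>B. q \<in> fst c \<and> f q \<in> fst c' \<longrightarrow>
           (\<forall>w. (\<forall>\<theta>\<in>set \<theta>s. \<theta> q c [w] = 0) \<and> jac c f c' q w = 0 \<longrightarrow> w = 0)))"

definition Backlund :: "nat \<Rightarrow>
    ('n, 'e::euclidean_space) chart set \<Rightarrow> ('n, 'e) form set \<Rightarrow>
    ('m, 'f::euclidean_space) chart set \<Rightarrow> ('m, 'f) form set \<Rightarrow> ('n \<Rightarrow> 'm) \<Rightarrow>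
    ('l, 'g::euclidean_space) chart set \<Rightarrow> ('l, 'g) form set \<Rightarrow> ('n \<Rightarrow> 'l) \<Rightarrow> bool" where
  "Backlund r N B M I pr M' I' pr' \<longleftrightarrow>
     integrable_extension r N B M I pr \<and> integrable_extension r N B M' I' pr'"

text \<open>
  A point \<open>[l : m]\<close> of \<open>RP\<^sup>1\<close> is represented by the line \<open>span {(l, m)}\<close> in the plane.
\<close>

definition hyperbolic_MA :: "('m, 'f::euclidean_space) chart set \<Rightarrow> ('m, 'f) form set \<Rightarrow> bool" where
  "hyperbolic_MA M I \<longleftrightarrow> EDS M I \<and> DIM('f) = 5 \<and>
     (\<forall>p\<in>points M. \<exists>U \<theta> \<Phi>. openin (mtop M) U \<and> p \<in> U \<and>
        \<theta> \<in> degree_forms 1 M U \<and> \<Phi> \<in> degree_forms 2 M U \<and>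
        (\<forall>q\<in>U. (\<theta> \<and>\<^sub>\<Omega> ext_d M U \<theta> \<and>\<^sub>\<Omega> ext_d M U \<theta>) q \<noteq> 0) \<and>
        local_ideal M U I = alg_ideal M U {\<theta>, ext_d M U \<theta>, \<Phi>} \<and>
        (\<forall>q\<in>U. card {span {(l, m)} | (l::real) (m::real). (l, m) \<noteq> 0 \<and>
           (l *\<^sub>\<Lambda> ext_d M U \<theta> q + m *\<^sub>\<Lambda> \<Phi> q) \<and>\<^sub>\<Lambda> (l *\<^sub>\<Lambda> ext_d M U \<theta> q + m *\<^sub>\<Lambda> \<Phi> q)
             \<in> alg_ideal_at M q {\<theta> q}} = 2))"

definition type_B ::
   "('n, 'e::euclidean_space) chart set \<Rightarrow> ('n, 'e) form set \<Rightarrow>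
    ('m, 'f::euclidean_space) chart set \<Rightarrow> ('m, 'f) form set \<Rightarrow> ('n \<Rightarrow> 'm) \<Rightarrow>
    ('l, 'g::euclidean_space) chart set \<Rightarrow> ('l, 'g) form set \<Rightarrow> ('n \<Rightarrow> 'l) \<Rightarrow> bool" where
  "type_B N B M I pr M' I' pr' \<longleftrightarrow>
     Backlund 2 N B M I pr M' I' pr' \<and> hyperbolic_MA M I \<and> hyperbolic_MA M' I' \<and>
     (\<forall>p\<in>points N. pull_deg1 N M pr I p \<inter> pull_deg1 N M' pr' I' p = {0}) \<and>
     (\<forall>p\<in>points N. \<exists>U \<theta> \<theta>' \<gamma>. openin (mtop N) U \<and> p \<in> U \<and>
        {\<theta>, \<theta>', \<gamma>} \<subseteq> degree_forms 1 N U \<and>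
        (\<forall>q\<in>U. lin_indep [\<theta> q, \<theta>' q, \<gamma> q] \<and>
           pull_deg1 N M pr I q = lin_span {\<theta> q} \<and>
           pull_deg1 N M' pr' I' q = lin_span {\<theta>' q} \<and>
           deg1 N B q = lin_span {\<theta> q, \<theta>' q, \<gamma> q} \<and>
           (\<exists>a b. (a, b) \<noteq> (0, 0) \<and>
              a *\<^sub>\<Lambda> ext_d N U \<theta> q + b *\<^sub>\<Lambda> ext_d N U \<theta>' q \<in> alg_ideal_at N q {\<theta> q, \<theta>' q, \<gamma> q})))"


section \<open>Coframings and the \<open>G\<close>-structure\<close>

text \<open>
  The indices of a coframing \<open>(\<omega>\<^sup>0, \<omega>b\<^sup>0, \<gamma>, \<omega>\<^sup>1, \<dots>, \<omega>\<^sup>4)\<close>, in this order; \<open>\<omega>b\<^sup>0\<close> is the form usually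
  written with a bar.
\<close>

datatype cof = W0 | W0b | Gm | W1 | W2 | W3 | W4

instance cof :: finite
proof
  have "(UNIV :: cof set) \<subseteq> {W0, W0b, Gm, W1, W2, W3, W4}"
    using cof.exhaust by blast
  then show "finite (UNIV :: cof set)"
    by (rule finite_subset) simp
qed

primrec cof_pos :: "cof \<Rightarrow> nat" where
  "cof_pos W0 = 0" | "cof_pos W0b = 1" | "cof_pos Gm = 2" | "cof_pos W1 = 3"
| "cof_pos W2 = 4" | "cof_pos W3 = 5" | "cof_pos W4 = 6"

definition Gmat :: "real \<Rightarrow> real \<Rightarrow> real \<Rightarrow> real \<Rightarrow> real ^ cof ^ cof" where
  "Gmat r a b c = (\<chi> i j.
     [[ r,  0, 0, 0, 0, 0, 0],
      [ 0,  r, 0, 0, 0, 0, 0],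
      [ c, -c, r, 0, 0, 0, 0],
      [ 0,  0, 0, 1, 0, 0, 0],
      [-c,  0, 0, a, r, 0, 0],
      [ 0,  0, 0, 0, 0, 1, 0],
      [ 0,  c, 0, 0, 0, b, r]] ! cof_pos i ! cof_pos j)"

definition Ggroup :: "(real ^ cof ^ cof) set" where
  "Ggroup = {Gmat r a b c | r a b c. r \<noteq> 0}"

definition coframing ::
  "('a, 'e::euclidean_space) chart set \<Rightarrow> 'a set \<Rightarrow> (cof \<Rightarrow> ('a, 'e) form) \<Rightarrow> bool" where
  "coframing A U \<sigma> \<longleftrightarrow> openin (mtop A) U \<and> DIM('e) = CARD(cof) \<and>
     (\<forall>i. \<sigma> i \<in> degree_forms 1 A U) \<and>
     (\<forall>p\<in>U. lin_indep (map (\<lambda>i. \<sigma> i p) [W0, W0b, Gm, W1, W2, W3, W4]))"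

definition coact :: "(cof \<Rightarrow> ('a, 'e) alt_form) \<Rightarrow> real ^ cof ^ cof \<Rightarrow> cof \<Rightarrow> ('a, 'e) alt_form" where
  "coact u g = (\<lambda>i. \<Sum>j\<in>UNIV. (matrix_inv g $ i $ j) *\<^sub>\<Lambda> u j)"

text \<open>
  The two rank 5 bundles \<open>X10\<close>, \<open>X01\<close> are the characteristic systems of \<open>(N, B)\<close>, in this order.
\<close>

definition ordered_char_systems ::
  "('n, 'e::euclidean_space) chart set \<Rightarrow> ('n, 'e) form set \<Rightarrow>
   ('n \<Rightarrow> ('n, 'e) alt_form set) \<Rightarrow> ('n \<Rightarrow> ('n, 'e) alt_form set) \<Rightarrow> bool" where
  "ordered_char_systems N B X10 X01 \<longleftrightarrow>
     (\<forall>p\<in>points N. \<exists>U \<sigma>. p \<in> U \<and> coframing N U \<sigma> \<and>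
        (\<forall>q\<in>U. deg1 N B q = lin_span {\<sigma> W0 q, \<sigma> W0b q, \<sigma> Gm q} \<and>
           X10 q = lin_span (deg1 N B q \<union> {\<sigma> W1 q, \<sigma> W2 q}) \<and>
           X01 q = lin_span (deg1 N B q \<union> {\<sigma> W3 q, \<sigma> W4 q})) \<and>
        local_ideal N U B =
          alg_ideal N U (sections N U (deg1 N B) \<union> {\<sigma> W1 \<and>\<^sub>\<Omega> \<sigma> W2, \<sigma> W3 \<and>\<^sub>\<Omega> \<sigma> W4}))"

definition one_adapted ::
   "('n, 'e::euclidean_space) chart set \<Rightarrow> ('n, 'e) form set \<Rightarrow>
    ('m, 'f::euclidean_space) chart set \<Rightarrow> ('m, 'f) form set \<Rightarrow> ('n \<Rightarrow> 'm) \<Rightarrow>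
    ('l, 'g::euclidean_space) chart set \<Rightarrow> ('l, 'g) form set \<Rightarrow> ('n \<Rightarrow> 'l) \<Rightarrow>
    ('n \<Rightarrow> ('n, 'e) alt_form set) \<Rightarrow> ('n \<Rightarrow> ('n, 'e) alt_form set) \<Rightarrow>
    'n set \<Rightarrow> (cof \<Rightarrow> ('n, 'e) form) \<Rightarrow> bool" where
  "one_adapted N B M I pr M' I' pr' X10 X01 U \<sigma> \<longleftrightarrow>
     coframing N U \<sigma> \<and>
     (\<forall>p\<in>U. lin_span {\<sigma> W0 p} = pull_deg1 N M pr I p \<and>
        lin_span {\<sigma> W0b p} = pull_deg1 N M' pr' I' p \<and>
        lin_span {\<sigma> W0 p, \<sigma> W0b p, \<sigma> Gm p} = deg1 N B p \<and>
        X10 p = lin_span {\<sigma> W0 p, \<sigma> W0b p, \<sigma> Gm p, \<sigma> W1 p, \<sigma> W2 p} \<and>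
        X01 p = lin_span {\<sigma> W0 p, \<sigma> W0b p, \<sigma> Gm p, \<sigma> W3 p, \<sigma> W4 p}) \<and>
     ext_d N U (\<sigma> W0) - (\<sigma> W1 \<and>\<^sub>\<Omega> \<sigma> W2 + \<sigma> W3 \<and>\<^sub>\<Omega> \<sigma> W4 + \<sigma> W3 \<and>\<^sub>\<Omega> \<sigma> Gm)
       \<in> alg_ideal N U {\<sigma> W0} \<and>
     ext_d N U (\<sigma> W0b) - (\<sigma> W1 \<and>\<^sub>\<Omega> \<sigma> W2 + \<sigma> W3 \<and>\<^sub>\<Omega> \<sigma> W4 + \<sigma> W1 \<and>\<^sub>\<Omega> \<sigma> Gm)
       \<in> alg_ideal N U {\<sigma> W0b} \<and>
     ext_d N U (\<sigma> Gm) - (\<sigma> W1 \<and>\<^sub>\<Omega> \<sigma> W2 - \<sigma> W3 \<and>\<^sub>\<Omega> \<sigma> W4)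
       \<in> alg_ideal N U {\<sigma> W0, \<sigma> W0b, \<sigma> Gm}"

definition type_B1 ::
   "('n, 'e::euclidean_space) chart set \<Rightarrow> ('n, 'e) form set \<Rightarrow>
    ('m, 'f::euclidean_space) chart set \<Rightarrow> ('m, 'f) form set \<Rightarrow> ('n \<Rightarrow> 'm) \<Rightarrow>
    ('l, 'g::euclidean_space) chart set \<Rightarrow> ('l, 'g) form set \<Rightarrow> ('n \<Rightarrow> 'l) \<Rightarrow>
    ('n \<Rightarrow> ('n, 'e) alt_form set) \<Rightarrow> ('n \<Rightarrow> ('n, 'e) alt_form set) \<Rightarrow> bool" where
  "type_B1 N B M I pr M' I' pr' X10 X01 \<longleftrightarrow>
     type_B N B M I pr M' I' pr' \<and> ordered_char_systems N B X10 X01 \<and>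
     (\<forall>p\<in>points N. \<exists>U \<sigma>. p \<in> U \<and> one_adapted N B M I pr M' I' pr' X10 X01 U \<sigma>)"

text \<open>
  A \<open>G\<close>-structure is a set of pairs of a point \<open>p\<close> and a coframe at \<open>p\<close>, whose fibres are the orbits of
  the right action \<open>coact\<close>, i.e. \<open>u \<cdot> g = g\<^sup>-\<^sup>1 u\<close>.
\<close>

type_synonym ('a, 'e) cofpt = "'a \<times> (cof \<Rightarrow> ('a, 'e) alt_form)"

definition G_structure :: "('a, 'e::euclidean_space) chart set \<Rightarrow> ('a, 'e) cofpt set \<Rightarrow> bool" where
  "G_structure N GG \<longleftrightarrow> fst ` GG \<subseteq> points N \<and>
     (\<forall>p\<in>points N. \<exists>U \<sigma>. p \<in> U \<and> coframing N U \<sigma> \<and>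
        (\<forall>q\<in>U. {u. (q, u) \<in> GG} = coact (\<lambda>i. \<sigma> i q) ` Ggroup))"

definition G_section ::
  "('a, 'e::euclidean_space) chart set \<Rightarrow> ('a, 'e) cofpt set \<Rightarrow> 'a set \<Rightarrow> (cof \<Rightarrow> ('a, 'e) form) \<Rightarrow> bool" where
  "G_section N GG U \<sigma> \<longleftrightarrow> coframing N U \<sigma> \<and> (\<forall>p\<in>U. (p, \<lambda>i. \<sigma> i p) \<in> GG)"

text \<open>
  The total space of the \<open>G\<close>-structure as an 11-dimensional manifold: a chart of \<open>N\<close> and a local section \<open>\<sigma>\<close>
  give the chart sending \<open>(p, \<sigma>(p) \<cdot> g)\<close> to the coordinates of \<open>p\<close> and the entries \<open>(r, a, b, c)\<close> of \<open>g\<close>.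
\<close>

definition G_atlas :: "('a, 'e::euclidean_space) chart set \<Rightarrow> ('a, 'e) cofpt set
    \<Rightarrow> (('a, 'e) cofpt, 'e \<times> real \<times> real \<times> real \<times> real) chart set" where
  "G_atlas N GG = {({(p, u) \<in> GG. p \<in> fst k \<inter> U},
       \<lambda>(p, u). (snd k p,
         THE (r, a, b, c). r \<noteq> 0 \<and> u = coact (\<lambda>i. \<sigma> i p) (Gmat r a b c))) | k U \<sigma>.
     k \<in> N \<and> G_section N GG U \<sigma>}"

text \<open>Component \<open>i\<close> of the tautological form: at \<open>(p, u)\<close> it is the pullback of the covector \<open>u i\<close>.\<close>

definition taut :: "('a, 'e::euclidean_space) chart set \<Rightarrow> ('a, 'e) cofpt set \<Rightarrow> cof
    \<Rightarrow> (('a, 'e) cofpt, 'e \<times> real \<times> real \<times> real \<times> real) form" where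
  "taut N GG i = (\<lambda>x. if x \<in> GG then pull_at (G_atlas N GG) N fst x (snd x i) else 0)"


section \<open>Structure equations\<close>

text \<open>
  The 20 torsion functions, in the notation \<open>T12\<close> for \<open>T\<^sup>1\<^sub>2\<close>, with a final \<open>b\<close> for the ones written with a bar.
\<close>

datatype tors = C1 | P1 | P2 | P3 | P4 | R11 | R12 | R33 | R34 | T10 | T20 | T30
  | T11 | T12 | T11b | T12b | T33 | T34 | T33b | T34b

instance tors :: finite
proof
  have "(UNIV :: tors set) \<subseteq> {C1, P1, P2, P3, P4, R11, R12, R33, R34, T10, T20, T30,
      T11, T12, T11b, T12b, T33, T34, T33b, T34b}"
    using tors.exhaust by blast
  then show "finite (UNIV :: tors set)"
    by (rule finite_subset) simp
qed

text \<open>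
  The torsion two-forms at a point, as functions of the values \<open>t\<close> of the torsion functions and \<open>w\<close> of the
  tautological form.
\<close>

definition Kval :: "real ^ tors \<Rightarrow> real" where
  "Kval t = (t $ P4 - t $ P2) / 4"

definition torsion :: "real ^ tors \<Rightarrow> (cof \<Rightarrow> ('a, 'e) alt_form) \<Rightarrow> cof \<Rightarrow> ('a, 'e) alt_form" where
  "torsion t w i = (case i of
     W0 \<Rightarrow> w W1 \<and>\<^sub>\<Lambda> w W2 + w W3 \<and>\<^sub>\<Lambda> (w W4 + w Gm)
       + (Kval t *\<^sub>\<Lambda> w Gm + (t$P1) *\<^sub>\<Lambda> w W1 + (t$P2) *\<^sub>\<Lambda> w W2 + (t$P3) *\<^sub>\<Lambda> w W3 + (t$P4) *\<^sub>\<Lambda> w W4) \<and>\<^sub>\<Lambda> w W0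
   | W0b \<Rightarrow> w W1 \<and>\<^sub>\<Lambda> (w W2 + w Gm) + w W3 \<and>\<^sub>\<Lambda> w W4
       + (- Kval t *\<^sub>\<Lambda> w Gm + (t$P1 + 1) *\<^sub>\<Lambda> w W1 + (t$P2) *\<^sub>\<Lambda> w W2 + (t$P3 + 1) *\<^sub>\<Lambda> w W3
            + (t$P4) *\<^sub>\<Lambda> w W4) \<and>\<^sub>\<Lambda> w W0b
   | Gm \<Rightarrow> w W1 \<and>\<^sub>\<Lambda> w W2 - w W3 \<and>\<^sub>\<Lambda> w W4 + (t$C1) *\<^sub>\<Lambda> ((w W1 - w W3) \<and>\<^sub>\<Lambda> (w W0 + w W0b))
   | W1 \<Rightarrow> (t$T10) *\<^sub>\<Lambda> (w W0 \<and>\<^sub>\<Lambda> w W0b)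
       + w W0 \<and>\<^sub>\<Lambda> ((t$T11) *\<^sub>\<Lambda> w W1 + (t$T12) *\<^sub>\<Lambda> (w W2 + w Gm))
       + w W0b \<and>\<^sub>\<Lambda> ((t$T11b) *\<^sub>\<Lambda> w W1 + (t$T12b) *\<^sub>\<Lambda> w W2)
       + w Gm \<and>\<^sub>\<Lambda> ((t$R11) *\<^sub>\<Lambda> w W1 + (t$R12) *\<^sub>\<Lambda> w W2)
       + (t$P2 / 2) *\<^sub>\<Lambda> (w W3 \<and>\<^sub>\<Lambda> (w Gm + w W2 + w W4))
       - (t$P2 / 2) *\<^sub>\<Lambda> (w W1 \<and>\<^sub>\<Lambda> w W2)
       - ((t$P1 + t$P3 + 1) / 2) *\<^sub>\<Lambda> (w W1 \<and>\<^sub>\<Lambda> w W3)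
       - (t$P4 / 2) *\<^sub>\<Lambda> (w W1 \<and>\<^sub>\<Lambda> w W4)
   | W2 \<Rightarrow> (t$T20) *\<^sub>\<Lambda> (w W0 \<and>\<^sub>\<Lambda> w W0b)
       - w W0 \<and>\<^sub>\<Lambda> ((t$C1) *\<^sub>\<Lambda> w W3 + (t$T11) *\<^sub>\<Lambda> (w W2 + w Gm))
       - (t$T11b) *\<^sub>\<Lambda> (w W0b \<and>\<^sub>\<Lambda> w W2)
       - (t$R11 + (t$P2 + t$P4) / 4) *\<^sub>\<Lambda> (w Gm \<and>\<^sub>\<Lambda> w W2)
       - (t$C1 + t$P1 / 2) *\<^sub>\<Lambda> (w W3 \<and>\<^sub>\<Lambda> (w Gm + w W2 + w W4))
   | W3 \<Rightarrow> (t$T30) *\<^sub>\<Lambda> (w W0b \<and>\<^sub>\<Lambda> w W0)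
       + w W0b \<and>\<^sub>\<Lambda> ((t$T33b) *\<^sub>\<Lambda> w W3 + (t$T34b) *\<^sub>\<Lambda> (w W4 + w Gm))
       + w W0 \<and>\<^sub>\<Lambda> ((t$T33) *\<^sub>\<Lambda> w W3 + (t$T34) *\<^sub>\<Lambda> w W4)
       + w Gm \<and>\<^sub>\<Lambda> ((t$R33) *\<^sub>\<Lambda> w W3 + (t$R34) *\<^sub>\<Lambda> w W4)
       + (t$P4 / 2) *\<^sub>\<Lambda> (w W1 \<and>\<^sub>\<Lambda> (w Gm + w W2 + w W4))
       + ((t$P1 + t$P3 + 1) / 2) *\<^sub>\<Lambda> (w W1 \<and>\<^sub>\<Lambda> w W3)
       + (t$P2 / 2) *\<^sub>\<Lambda> (w W2 \<and>\<^sub>\<Lambda> w W3)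
       - (t$P4 / 2) *\<^sub>\<Lambda> (w W3 \<and>\<^sub>\<Lambda> w W4)
   | W4 \<Rightarrow> - ((t$T20) *\<^sub>\<Lambda> (w W0b \<and>\<^sub>\<Lambda> w W0))
       + w W0b \<and>\<^sub>\<Lambda> ((t$C1) *\<^sub>\<Lambda> w W1 - (t$T33b) *\<^sub>\<Lambda> (w W4 + w Gm))
       - (t$T33) *\<^sub>\<Lambda> (w W0 \<and>\<^sub>\<Lambda> w W4)
       - (t$R33 + (t$P2 + t$P4) / 4) *\<^sub>\<Lambda> (w Gm \<and>\<^sub>\<Lambda> w W4)
       - (t$C1 + (t$P3 + 1) / 2) *\<^sub>\<Lambda> (w W1 \<and>\<^sub>\<Lambda> (w Gm + w W2 + w W4)))"

text \<open>
  \<open>conn \<phi> \<pi> \<alpha> \<beta> w\<close> is the term \<open>-\<Phi> \<and> w\<close> of the structure equations, where \<open>\<Phi>\<close> is the pseudo-connection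
  with values in the Lie algebra of \<open>G\<close>; \<open>\<pi>\<close> is the entry at the position of \<open>c\<close>.
\<close>

definition conn :: "('a, 'e) alt_form \<Rightarrow> ('a, 'e) alt_form \<Rightarrow> ('a, 'e) alt_form \<Rightarrow> ('a, 'e) alt_form
    \<Rightarrow> (cof \<Rightarrow> ('a, 'e) alt_form) \<Rightarrow> cof \<Rightarrow> ('a, 'e) alt_form" where
  "conn \<phi> \<pi> \<alpha> \<beta> w i = (case i of
     W0 \<Rightarrow> - (\<phi> \<and>\<^sub>\<Lambda> w W0)
   | W0b \<Rightarrow> - (\<phi> \<and>\<^sub>\<Lambda> w W0b)
   | Gm \<Rightarrow> - (\<pi> \<and>\<^sub>\<Lambda> (w W0 - w W0b)) - \<phi> \<and>\<^sub>\<Lambda> w Gm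
   | W1 \<Rightarrow> 0
   | W2 \<Rightarrow> \<pi> \<and>\<^sub>\<Lambda> w W0 - \<alpha> \<and>\<^sub>\<Lambda> w W1 - \<phi> \<and>\<^sub>\<Lambda> w W2
   | W3 \<Rightarrow> 0
   | W4 \<Rightarrow> - (\<pi> \<and>\<^sub>\<Lambda> w W0b) - \<beta> \<and>\<^sub>\<Lambda> w W3 - \<phi> \<and>\<^sub>\<Lambda> w W4)"

definition structure_equations ::
   "('a, 'e::euclidean_space) chart set \<Rightarrow> ('a, 'e) cofpt set \<Rightarrow>
    (('a, 'e) cofpt, 'e \<times> real \<times> real \<times> real \<times> real) form \<Rightarrow>
    (('a, 'e) cofpt, 'e \<times> real \<times> real \<times> real \<times> real) form \<Rightarrow>
    (('a, 'e) cofpt, 'e \<times> real \<times> real \<times> real \<times> real) form \<Rightarrow>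
    (('a, 'e) cofpt, 'e \<times> real \<times> real \<times> real \<times> real) form \<Rightarrow>
    (('a, 'e) cofpt \<Rightarrow> real ^ tors) \<Rightarrow> bool" where
  "structure_equations N GG \<phi> \<pi> \<alpha> \<beta> \<tau> \<longleftrightarrow>
     {\<phi>, \<pi>, \<alpha>, \<beta>} \<subseteq> degree_forms 1 (G_atlas N GG) GG \<and>
     (\<forall>k. fn_form (G_atlas N GG) (\<lambda>x. \<tau> x $ k) \<in> degree_forms 0 (G_atlas N GG) GG) \<and>
     (\<forall>x\<in>GG. \<tau> x $ C1 * Kval (\<tau> x) = 0) \<and>
     (\<forall>x\<in>GG. \<forall>i. ext_d (G_atlas N GG) GG (taut N GG i) x =
        conn (\<phi> x) (\<pi> x) (\<alpha> x) (\<beta> x) (\<lambda>j. taut N GG j x) i + torsion (\<tau> x) (\<lambda>j. taut N GG j x) i)"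

text \<open>The infinitesimal \<open>G\<close>-action on the torsion functions.\<close>

definition inf_action :: "('a, 'e) alt_form \<Rightarrow> ('a, 'e) alt_form \<Rightarrow> ('a, 'e) alt_form \<Rightarrow> ('a, 'e) alt_form
    \<Rightarrow> real ^ tors \<Rightarrow> tors \<Rightarrow> ('a, 'e) alt_form" where
  "inf_action \<phi> \<pi> \<alpha> \<beta> t k = (case k of
     C1 \<Rightarrow> 0
   | P1 \<Rightarrow> (t$P2) *\<^sub>\<Lambda> \<alpha> - 2 *\<^sub>\<Lambda> \<pi>
   | P2 \<Rightarrow> (t$P2) *\<^sub>\<Lambda> \<phi>
   | P3 \<Rightarrow> (t$P4) *\<^sub>\<Lambda> \<beta> + 2 *\<^sub>\<Lambda> \<pi>
   | P4 \<Rightarrow> (t$P4) *\<^sub>\<Lambda> \<phi>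
   | R11 \<Rightarrow> (t$R11) *\<^sub>\<Lambda> \<phi> + (t$R12) *\<^sub>\<Lambda> \<alpha>
   | R12 \<Rightarrow> (2 * t$R12) *\<^sub>\<Lambda> \<phi>
   | R33 \<Rightarrow> (t$R33) *\<^sub>\<Lambda> \<phi> + (t$R34) *\<^sub>\<Lambda> \<beta>
   | R34 \<Rightarrow> (2 * t$R34) *\<^sub>\<Lambda> \<phi>
   | T10 \<Rightarrow> (2 * t$T10) *\<^sub>\<Lambda> \<phi> - (t$T12 - t$T12b) *\<^sub>\<Lambda> \<pi>
   | T20 \<Rightarrow> - (t$T10 / 2) *\<^sub>\<Lambda> \<alpha> + (t$T20) *\<^sub>\<Lambda> \<phi> + (t$T30 / 2) *\<^sub>\<Lambda> \<beta>
             + ((t$T11 - t$T33 - t$T11b + t$T33b) / 2) *\<^sub>\<Lambda> \<pi>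
   | T30 \<Rightarrow> (2 * t$T30) *\<^sub>\<Lambda> \<phi> - (t$T34 - t$T34b) *\<^sub>\<Lambda> \<pi>
   | T11 \<Rightarrow> (t$T11) *\<^sub>\<Lambda> \<phi> + (t$T12) *\<^sub>\<Lambda> \<alpha> - (t$P2 / 2 - t$R11) *\<^sub>\<Lambda> \<pi>
   | T12 \<Rightarrow> (2 * t$T12) *\<^sub>\<Lambda> \<phi> + (t$R12) *\<^sub>\<Lambda> \<pi>
   | T11b \<Rightarrow> (t$T11b) *\<^sub>\<Lambda> \<phi> + (t$T12b) *\<^sub>\<Lambda> \<alpha> + (t$P4 / 2 - t$R11) *\<^sub>\<Lambda> \<pi>
   | T12b \<Rightarrow> (2 * t$T12b) *\<^sub>\<Lambda> \<phi> - (t$R12) *\<^sub>\<Lambda> \<pi>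
   | T33b \<Rightarrow> (t$T33b) *\<^sub>\<Lambda> \<phi> + (t$T34b) *\<^sub>\<Lambda> \<beta> - (- (t$P4 / 2) + t$R33) *\<^sub>\<Lambda> \<pi>
   | T34b \<Rightarrow> (2 * t$T34b) *\<^sub>\<Lambda> \<phi> - (t$R34) *\<^sub>\<Lambda> \<pi>
   | T33 \<Rightarrow> (t$T33) *\<^sub>\<Lambda> \<phi> + (t$T34) *\<^sub>\<Lambda> \<beta> + (- (t$P2 / 2) + t$R33) *\<^sub>\<Lambda> \<pi>
   | T34 \<Rightarrow> (2 * t$T34) *\<^sub>\<Lambda> \<phi> + (t$R34) *\<^sub>\<Lambda> \<pi>)"

definition torsion_variation ::
   "('a, 'e::euclidean_space) chart set \<Rightarrow> ('a, 'e) cofpt set \<Rightarrow>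
    (('a, 'e) cofpt, 'e \<times> real \<times> real \<times> real \<times> real) form \<Rightarrow>
    (('a, 'e) cofpt, 'e \<times> real \<times> real \<times> real \<times> real) form \<Rightarrow>
    (('a, 'e) cofpt, 'e \<times> real \<times> real \<times> real \<times> real) form \<Rightarrow>
    (('a, 'e) cofpt, 'e \<times> real \<times> real \<times> real \<times> real) form \<Rightarrow>
    (('a, 'e) cofpt \<Rightarrow> real ^ tors) \<Rightarrow> bool" where
  "torsion_variation N GG \<phi> \<pi> \<alpha> \<beta> \<tau> \<longleftrightarrow>
     (\<forall>x\<in>GG. \<forall>k. ext_d (G_atlas N GG) GG (fn_form (G_atlas N GG) (\<lambda>y. \<tau> y $ k)) x
        - inf_action (\<phi> x) (\<pi> x) (\<alpha> x) (\<beta> x) (\<tau> x) k \<in> lin_span (range (\<lambda>i. taut N GG i x)))"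


section \<open>Orbits and their dimension\<close>

definition orbit :: "('a, 'e) cofpt set \<Rightarrow> (('a, 'e) cofpt \<Rightarrow> real ^ tors) \<Rightarrow> 'a \<Rightarrow> (real ^ tors) set" where
  "orbit GG \<tau> p = \<tau> ` {x \<in> GG. fst x = p}"

text \<open>
  \<open>S\<close> is an immersed submanifold: it carries a manifold structure (whose topology may be finer than the
  subspace topology) for which the inclusion into the ambient space is a smooth immersion.
\<close>

definition immersed_submanifold ::
  "('b::euclidean_space, 'e::euclidean_space) chart set \<Rightarrow> 'b set \<Rightarrow> bool" where
  "immersed_submanifold A S \<longleftrightarrow> smooth_manifold A \<and> points A = S \<and>
     (\<forall>c\<in>A. smooth_on (snd c ` fst c) (chart_inv c) \<and>
        (\<forall>x\<in>snd c ` fst c. inj (frechet_derivative (chart_inv c) (at x))))"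

text \<open>
  An immersed submanifold of dimension 0, 1 or 2. Euclidean space types have positive dimension; the manifolds
  of dimension 0 are the countable sets.
\<close>

definition dim_at_most_2 :: "'b::euclidean_space set \<Rightarrow> bool" where
  "dim_at_most_2 S \<longleftrightarrow> countable S \<or>
     (\<exists>A :: ('b, real) chart set. immersed_submanifold A S) \<or>
     (\<exists>A :: ('b, real ^ 2) chart set. immersed_submanifold A S)"

end

theory Submission
  imports Defs
begin

text \<open>
  The torsion functions transform along the fibres of the \<open>G\<close>-structure by an explicit action of \<open>G\<close>, and
  the theorem is read off from it.

  The action is found without integrating its infinitesimal form. The structure equations are normalized
  so strictly that they determine the torsion: each torsion function is a linear combination of
  components of the differentials of the coframe in which the pseudo-connection cancels. If a local section
  \<open>\<sigma>\<close> is replaced by \<open>\<sigma> \<cdot> g\<close> with constant \<open>g\<close>, these differentials change by a fixed linear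
  transformation, and so the torsion at \<open>\<sigma>(p) \<cdot> g\<close> is an explicit function of \<open>g\<close> and of the torsion at
  \<open>\<sigma>(p)\<close> (\<open>torsion_of_changed_frame\<close>, \<open>torsion_equivariant\<close>). This covers both components of the
  fibre at once. It needs the tautological form in the charts of the bundle, on which it is shown to be a
  smooth form whose differential along a section is the differential of that section.

  Modulo \<open>\<omega>\<^sup>1\<close>, the differential of \<open>\<omega>\<^sup>1\<close> has the coefficients \<open>P2\<close>, \<open>R12\<close>, \<open>T10\<close>, \<open>T12\<close>, \<open>T12b\<close>, and the
  differential of \<open>\<omega>\<^sup>3\<close> modulo \<open>\<omega>\<^sup>3\<close> has \<open>P4\<close>, \<open>R34\<close>, \<open>T30\<close>, \<open>T34\<close>, \<open>T34b\<close>. Integrability of both forms therefore means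
  that these ten functions vanish. To express this by membership in the ideal generated by \<open>\<omega>\<^sup>1\<close> or
  \<open>\<omega>\<^sup>3\<close>, one needs that products of forms are forms, i.e. that the shuffle product of alternating
  functions is alternating.

  If the ten functions vanish, the parameters \<open>a\<close> and \<open>b\<close> of the group act trivially. With \<open>s = c / r\<close> the
  orbit consists of the points \<open>base + s \<beta> + r (v0 + s v1 + s\<^sup>2 v2)\<close> with \<open>r \<noteq> 0\<close>, where \<open>\<beta>\<close> has the
  \<open>P1\<close>-component \<open>- 2\<close> and the \<open>v\<close>'s have the \<open>P1\<close>-component \<open>0\<close>. Either the vector in parentheses is zero
  for all \<open>s\<close>, and the orbit is a line, or it is never zero, and the orbit is an injectively immersed
  surface (\<open>integrable_imp_orbit_dim\<close>).

  Conversely, if one of the ten functions is nonzero at a point, then suitable group elements vary three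
  torsion functions independently along the orbit: one of \<open>P1\<close> and \<open>P3\<close> by means of \<open>s\<close>, a second function
  by \<open>r\<close>, and a third one by \<open>a\<close> or \<open>b\<close>. So some projection of the orbit to \<open>\<real>\<^sup>3\<close> contains a nonempty open set. For an immersed
  submanifold of dimension at most two this projection would be a null set (\<open>orbit_dim_imp_integrable\<close>).
\<close>


section \<open>Calculus of smooth functions\<close>

lemma times_differentiable_on_Suc_imp:
  "times_differentiable_on (Suc n) S f \<Longrightarrow> times_differentiable_on n S f"
proof (induction n arbitrary: f)
  case 0
  then show ?case
    by (auto intro!: continuous_at_imp_continuous_on differentiable_imp_continuous_within)
next
  case (Suc n)
  then show ?case unfolding times_differentiable_on.simps(2) by blast
qed

lemma times_differentiable_on_cong:
  assumes "open S" "\<And>x. x \<in> S \<Longrightarrow> f x = g x" "times_differentiable_on n S f"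
  shows "times_differentiable_on n S g"
  using assms(2,3)
proof (induction n arbitrary: f g)
  case 0
  then show ?case using continuous_on_cong by fastforce
next
  case (Suc n)
  have d: "g differentiable (at x)" if "x \<in> S" for x
  proof -
    have "(f has_derivative frechet_derivative f (at x)) (at x)"
      using Suc.prems(2) that by (auto simp: frechet_derivative_works[symmetric])
    then have "(g has_derivative frechet_derivative f (at x)) (at x)"
      using has_derivative_transform_within_open[OF _ \<open>open S\<close> that] Suc.prems(1) by blast
    then show ?thesis unfolding differentiable_def by blast
  qed
  have "times_differentiable_on n S (\<lambda>x. frechet_derivative g (at x) v)" for v
  proof (rule Suc.IH)
    show "times_differentiable_on n S (\<lambda>x. frechet_derivative f (at x) v)"
      using Suc.prems(2) by simp
    fix x assume "x \<in> S"
    then show "frechet_derivative f (at x) v = frechet_derivative g (at x) v"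
      using frechet_derivative_transform_within_open[OF _ \<open>open S\<close>, of f x g] Suc.prems by auto
  qed
  with d show ?case by simp
qed

lemma times_differentiable_on_const: "times_differentiable_on n S (\<lambda>x. c)"
  by (induction n arbitrary: c) auto

lemma times_differentiable_on_subset:
  "times_differentiable_on n T f \<Longrightarrow> S \<subseteq> T \<Longrightarrow> times_differentiable_on n S f"
  proof (induction n arbitrary: f)
  case 0
  then show ?case using continuous_on_subset by auto
next
  case (Suc n)
  then show ?case by auto
qed

lemma times_differentiable_on_add:
  assumes "open S"
  shows "times_differentiable_on n S f \<Longrightarrow> times_differentiable_on n S g \<Longrightarrow>
    times_differentiable_on n S (\<lambda>x. f x + g x)"
proof (induction n arbitrary: f g)
  case 0
  then show ?case by (auto intro: continuous_on_add)
next
  case (Suc n)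
  have "times_differentiable_on n S (\<lambda>x. frechet_derivative (\<lambda>x. f x + g x) (at x) v)" for v
  proof (rule times_differentiable_on_cong[OF assms])
    show "times_differentiable_on n S (\<lambda>x. frechet_derivative f (at x) v + frechet_derivative g (at x) v)"
      using Suc by auto
    fix x assume "x \<in> S"
    then show "frechet_derivative f (at x) v + frechet_derivative g (at x) v =
        frechet_derivative (\<lambda>x. f x + g x) (at x) v"
      using Suc.prems
      by (intro fun_cong[OF frechet_derivative_at[OF has_derivative_add]])
        (auto simp: frechet_derivative_works[symmetric])
  qed
  then show ?case using Suc.prems by (auto intro: differentiable_add)
qed

lemma times_differentiable_on_scaleR:
  fixes f :: "'e::real_normed_vector \<Rightarrow> real" and g :: "'e \<Rightarrow> 'f::real_normed_vector"
  assumes "open S"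
  shows "times_differentiable_on n S f \<Longrightarrow> times_differentiable_on n S g \<Longrightarrow>
    times_differentiable_on n S (\<lambda>x. f x *\<^sub>R g x)"
proof (induction n arbitrary: f g)
  case 0
  then show ?case by (auto intro: continuous_on_scaleR)
next
  case (Suc n)
  have der: "((\<lambda>x. f x *\<^sub>R g x) has_derivative
      (\<lambda>v. f x *\<^sub>R frechet_derivative g (at x) v + frechet_derivative f (at x) v *\<^sub>R g x)) (at x)"
    if "x \<in> S" for x
    by (rule has_derivative_scaleR) (use Suc.prems that in \<open>auto simp: frechet_derivative_works[symmetric]\<close>)
  have "times_differentiable_on n S (\<lambda>x. frechet_derivative (\<lambda>x. f x *\<^sub>R g x) (at x) v)" for v
  proof (rule times_differentiable_on_cong[OF assms])
    show "times_differentiable_on n S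
        (\<lambda>x. f x *\<^sub>R frechet_derivative g (at x) v + frechet_derivative f (at x) v *\<^sub>R g x)"
      using Suc.prems Suc.prems[THEN times_differentiable_on_Suc_imp]
      by (intro times_differentiable_on_add[OF assms] Suc.IH) simp_all
    fix x assume "x \<in> S"
    then show "f x *\<^sub>R frechet_derivative g (at x) v + frechet_derivative f (at x) v *\<^sub>R g x =
        frechet_derivative (\<lambda>x. f x *\<^sub>R g x) (at x) v"
      by (intro fun_cong[OF frechet_derivative_at[OF der]])
  qed
  then show ?case using der by (auto simp: differentiable_def)
qed

lemma times_differentiable_on_comp_linear:
  assumes L: "bounded_linear L" and "open S" "L ` S \<subseteq> T"
  shows "times_differentiable_on n T f \<Longrightarrow> times_differentiable_on n S (\<lambda>x. f (L x))"
proof (induction n arbitrary: f)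
  case 0
  then show ?case
    using continuous_on_compose2[OF _ linear_continuous_on[OF L] assms(3)] by simp
next
  case (Suc n)
  have der: "((\<lambda>x. f (L x)) has_derivative (\<lambda>v. frechet_derivative f (at (L x)) (L v))) (at x)"
    if "x \<in> S" for x
    by (rule has_derivative_compose[OF bounded_linear_imp_has_derivative[OF L]])
      (use Suc.prems that assms(3) in \<open>auto simp: frechet_derivative_works[symmetric]\<close>)
  have "times_differentiable_on n S (\<lambda>x. frechet_derivative (\<lambda>x. f (L x)) (at x) v)" for v
  proof (rule times_differentiable_on_cong[OF \<open>open S\<close>])
    show "times_differentiable_on n S (\<lambda>x. frechet_derivative f (at (L x)) (L v))"
      using Suc by auto
    fix x assume "x \<in> S"
    then show "frechet_derivative f (at (L x)) (L v) = frechet_derivative (\<lambda>x. f (L x)) (at x) v"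
      by (intro fun_cong[OF frechet_derivative_at[OF der]])
  qed
  then show ?case using der by (auto simp: differentiable_def)
qed

lemma times_differentiable_on_inverse:
  fixes f :: "'e::real_normed_vector \<Rightarrow> real"
  assumes "open S" "\<And>x. x \<in> S \<Longrightarrow> f x \<noteq> 0"
  shows "times_differentiable_on n S f \<Longrightarrow> times_differentiable_on n S (\<lambda>x. inverse (f x))"
proof (induction n)
  case 0
  then show ?case using assms by (simp add: Limits.continuous_on_inverse)
next
  case (Suc n)
  have der: "((\<lambda>x. inverse (f x)) has_derivative
      (\<lambda>v. - (inverse (f x) * frechet_derivative f (at x) v * inverse (f x)))) (at x)"
    if "x \<in> S" for x
    by (rule Deriv.has_derivative_inverse) (use Suc.prems that assms in \<open>auto simp: frechet_derivative_works[symmetric]\<close>)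
  have i: "times_differentiable_on n S (\<lambda>x. inverse (f x))"
    using Suc times_differentiable_on_Suc_imp by blast
  have "times_differentiable_on n S (\<lambda>x. frechet_derivative (\<lambda>x. inverse (f x)) (at x) v)" for v
  proof (rule times_differentiable_on_cong[OF \<open>open S\<close>])
    show "times_differentiable_on n S
      (\<lambda>x. (- 1) *\<^sub>R (inverse (f x) *\<^sub>R (frechet_derivative f (at x) v *\<^sub>R inverse (f x))))"
      using Suc.prems by (intro times_differentiable_on_scaleR \<open>open S\<close> i times_differentiable_on_const) auto
    fix x assume "x \<in> S"
    show "(- 1) *\<^sub>R (inverse (f x) *\<^sub>R (frechet_derivative f (at x) v *\<^sub>R inverse (f x)))
      = frechet_derivative (\<lambda>x. inverse (f x)) (at x) v"
      unfolding frechet_derivative_at[OF der[OF \<open>x \<in> S\<close>], symmetric] by simp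
  qed
  then show ?case using der by (auto simp: differentiable_def)
qed

lemma smooth_on_cong:
  "open S \<Longrightarrow> (\<And>x. x \<in> S \<Longrightarrow> f x = g x) \<Longrightarrow> smooth_on S f \<Longrightarrow> smooth_on S g"
  unfolding smooth_on_def using times_differentiable_on_cong by blast

lemma smooth_on_subset: "smooth_on T f \<Longrightarrow> S \<subseteq> T \<Longrightarrow> smooth_on S f"
  unfolding smooth_on_def using times_differentiable_on_subset by blast

lemma smooth_on_const: "smooth_on S (\<lambda>x. c)"
  unfolding smooth_on_def using times_differentiable_on_const by blast

lemma smooth_on_add:
  "open S \<Longrightarrow> smooth_on S f \<Longrightarrow> smooth_on S g \<Longrightarrow> smooth_on S (\<lambda>x. f x + g x)"
  unfolding smooth_on_def using times_differentiable_on_add by blast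

lemma smooth_on_scaleR:
  fixes f :: "'e::real_normed_vector \<Rightarrow> real" and g :: "'e \<Rightarrow> 'f::real_normed_vector"
  shows "open S \<Longrightarrow> smooth_on S f \<Longrightarrow> smooth_on S g \<Longrightarrow> smooth_on S (\<lambda>x. f x *\<^sub>R g x)"
  unfolding smooth_on_def using times_differentiable_on_scaleR by blast

lemma smooth_on_mult:
  fixes f g :: "'e::real_normed_vector \<Rightarrow> real"
  shows "open S \<Longrightarrow> smooth_on S f \<Longrightarrow> smooth_on S g \<Longrightarrow> smooth_on S (\<lambda>x. f x * g x)"
  using smooth_on_scaleR[of S f g] by simp

lemma smooth_on_sum:
  assumes "open S" "\<And>i. i \<in> I \<Longrightarrow> smooth_on S (f i)"
  shows "smooth_on S (\<lambda>x. \<Sum>i\<in>I. f i x)"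
  using assms(2)
  by (induction I rule: infinite_finite_induct) (auto intro: smooth_on_const smooth_on_add[OF assms(1)])

lemma smooth_on_comp_linear:
  "bounded_linear L \<Longrightarrow> open S \<Longrightarrow> L ` S \<subseteq> T \<Longrightarrow> smooth_on T f \<Longrightarrow> smooth_on S (\<lambda>x. f (L x))"
  unfolding smooth_on_def using times_differentiable_on_comp_linear by blast

lemma smooth_on_ident: "smooth_on S (\<lambda>x. x)"
proof -
  have "times_differentiable_on n S (\<lambda>x. x)" for n
    by (cases n) (auto intro: times_differentiable_on_const)
  then show ?thesis unfolding smooth_on_def by blast
qed

lemma smooth_on_linear: "bounded_linear L \<Longrightarrow> open S \<Longrightarrow> smooth_on S L"
  using smooth_on_comp_linear[of L S UNIV "\<lambda>x. x"] smooth_on_ident by auto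

lemma smooth_on_inverse:
  fixes f :: "'e::real_normed_vector \<Rightarrow> real"
  shows "open S \<Longrightarrow> (\<And>x. x \<in> S \<Longrightarrow> f x \<noteq> 0) \<Longrightarrow> smooth_on S f \<Longrightarrow> smooth_on S (\<lambda>x. inverse (f x))"
  unfolding smooth_on_def using times_differentiable_on_inverse by blast

lemma smooth_on_imp_differentiable: "smooth_on S f \<Longrightarrow> x \<in> S \<Longrightarrow> f differentiable (at x)"
  unfolding smooth_on_def using times_differentiable_on.simps(2) by blast

section \<open>The exterior algebra\<close>

lemma wedge_apply_2:
  "(\<xi> \<and>\<^sub>\<Lambda> \<eta>) c [v, w] = \<xi> c [] * \<eta> c [v, w] + \<xi> c [v] * \<eta> c [w] - \<xi> c [w] * \<eta> c [v] + \<xi> c [v, w] * \<eta> c []"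
proof -
  have P: "Pow {..<length [v, w]} = {{}, {0}, {1}, {0, 1}}"
    by (auto simp: lessThan_Suc Pow_insert numeral_2_eq_2)
  have e: "{(i, j). i = (0::nat) \<and> j < Suc (Suc 0) \<and> 0 < j \<and> j < i} = {}"
    "{(i, j). i = Suc 0 \<and> j < Suc (Suc 0) \<and> j \<noteq> Suc 0 \<and> j < i} = {(Suc 0, 0)}"
    "{(i, j). (i = 0 \<or> i = Suc 0) \<and> j < Suc (Suc 0) \<and> 0 < j \<and> j \<noteq> Suc 0 \<and> j < i} = {}"
    by auto
  have n: "{..<Suc (Suc 0)} - {0} = {Suc 0}" "{..<Suc (Suc 0)} - {Suc 0} = {0}"
    "{..<Suc (Suc 0)} - {0, Suc 0} = {}"
    "nths [v, w] {0} = [v]" "nths [v, w] {Suc 0} = [w]" "nths [v, w] {0, Suc 0} = [v, w]"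
    by (auto simp: nths_Cons)
  have d: "{} \<noteq> {0::nat}" "{} \<noteq> {Suc 0}" "{0::nat} \<noteq> {Suc 0}" "{} \<noteq> {0, Suc 0}" "{0::nat} \<noteq> {0, Suc 0}"
    "{Suc 0} \<noteq> {0, Suc 0}"
    by auto
  show ?thesis
    unfolding wedge_def P
    by (simp add: e n d)
qed

definition alternating :: "('e::real_vector list \<Rightarrow> real) \<Rightarrow> bool" where
  "alternating F \<longleftrightarrow> (\<forall>ws. \<forall>i<length ws. linear (\<lambda>w. F (ws[i := w]))) \<and>
     (\<forall>ws i j. i < j \<and> j < length ws \<and> ws ! i = ws ! j \<longrightarrow> F ws = 0)"

lemma alternating_adjacent_zero: "alternating F \<Longrightarrow> F (us @ x # x # vs) = 0"
proof -
  assume "alternating F"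
  then have "\<lbrakk>i < j; j < length ws; ws ! i = ws ! j\<rbrakk> \<Longrightarrow> F ws = 0" for ws i j
    unfolding alternating_def by blast
  from this[of "length us" "Suc (length us)" "us @ x # x # vs"] show ?thesis
    by (simp add: nth_append)
qed

text \<open>
  An alternating function changes sign when two adjacent arguments are exchanged, so two equal
  arguments can be moved next to each other.
\<close>

lemma alternating_if_adjacent:
  assumes lin: "\<And>ws i. i < length ws \<Longrightarrow> linear (\<lambda>w. F (ws[i := w]))"
    and adj: "\<And>us x vs. F (us @ x # x # vs) = 0"
  shows "alternating F"
proof -
  have swap: "F (us @ x # y # vs) = - F (us @ y # x # vs)" for us x y vs
  proof -
    have l1: "linear (\<lambda>w. F (us @ w # z # vs))" for z
      using lin[of "length us" "us @ z # z # vs"] by simp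
    have l2: "linear (\<lambda>w. F (us @ z # w # vs))" for z
      using lin[of "Suc (length us)" "us @ z # z # vs"] by (simp add: list_update_append)
    have "F (us @ (x + y) # (x + y) # vs) = F (us @ x # x # vs) + F (us @ x # y # vs)
        + (F (us @ y # x # vs) + F (us @ y # y # vs))"
      by (simp add: linear_add[OF l1] linear_add[OF l2])
    then show ?thesis using adj by simp
  qed
  have zero: "F (us @ x # zs @ x # vs) = 0" for us x zs vs
  proof (induction zs arbitrary: us)
    case Nil
    then show ?case using adj by simp
  next
    case (Cons z zs)
    have "F (us @ x # z # zs @ x # vs) = - F ((us @ [z]) @ x # zs @ x # vs)"
      using swap[of us x z "zs @ x # vs"] by simp
    then show ?case using Cons[of "us @ [z]"] by simp
  qed
  have split: "\<exists>us zs vs. ws = us @ ws ! i # zs @ ws ! i # vs"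
    if "i < j" "j < length ws" "ws ! i = ws ! j" for ws :: "'a list" and i j
  proof -
    have "ws = take i ws @ ws ! i # drop (Suc i) ws"
      using that(1,2) by (intro id_take_nth_drop) simp
    also have "drop (Suc i) ws = take (j - Suc i) (drop (Suc i) ws) @ drop (Suc i) ws ! (j - Suc i)
        # drop (Suc (j - Suc i)) (drop (Suc i) ws)"
      using that(1,2) by (intro id_take_nth_drop) simp
    also have "drop (Suc i) ws ! (j - Suc i) = ws ! i"
      using that by simp
    finally show ?thesis by blast
  qed
  have "F ws = 0" if ij: "i < j" "j < length ws" "ws ! i = ws ! j" for ws i j
  proof -
    obtain us zs vs where "ws = us @ ws ! i # zs @ ws ! i # vs" using split[OF ij] by blast
    then show ?thesis using zero by metis
  qed
  with lin show ?thesis unfolding alternating_def by blast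
qed

lemma nths_cong: "(\<And>j. j < length xs \<Longrightarrow> j \<in> A \<longleftrightarrow> j \<in> B) \<Longrightarrow> nths xs A = nths xs B"
  unfolding nths_def by (rule arg_cong[where f = "map fst"], rule filter_cong) (auto simp: set_zip)

lemma nths_list_update_notin: "i \<notin> A \<Longrightarrow> nths (ws[i := w]) A = nths ws A"
proof (induction ws arbitrary: i A)
  case (Cons a ws)
  then show ?case by (cases i) (simp_all add: nths_Cons)
qed simp

lemma nths_list_update_in:
  assumes "i \<in> A" "i < length ws"
  obtains k where "k < length (nths ws A)" "\<And>w. nths (ws[i := w]) A = (nths ws A)[k := w]"
proof
  let ?k = "length (nths (take i ws) A)" and ?B = "{j. j + length (take i ws) \<in> A}"
  have l: "length (take i ws) = i" using assms by simp
  have ws: "ws = take i ws @ ws ! i # drop (Suc i) ws"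
    using assms id_take_nth_drop by blast
  have e: "nths ws A = nths (take i ws) A @ ws ! i # nths (drop (Suc i) ws) {j. Suc j \<in> ?B}"
    by (subst ws, subst nths_append) (use assms in \<open>simp add: nths_Cons l\<close>)
  show "?k < length (nths ws A)" unfolding e by simp
  fix w
  have "ws[i := w] = take i ws @ w # drop (Suc i) ws"
    using assms by (simp add: upd_conv_take_nth_drop)
  then have "nths (ws[i := w]) A = nths (take i ws) A @ w # nths (drop (Suc i) ws) {j. Suc j \<in> ?B}"
    using assms by (simp add: nths_append nths_Cons l)
  then show "nths (ws[i := w]) A = (nths ws A)[?k := w]" unfolding e by simp
qed

text \<open>
  When the arguments at the positions \<open>i\<close> and \<open>i + 1\<close> agree, exchange these two positions in \<open>S\<close>. If
  \<open>S\<close> contains exactly one of them, this leaves both factors unchanged and changes the number of inversions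
  by one, so that the two terms cancel. All other terms vanish.
\<close>

lemma alternating_shuffle:
  assumes f: "alternating f" and g: "alternating g"
  shows "alternating (\<lambda>ws. \<Sum>S\<in>Pow {..<length ws}.
     (- 1) ^ card {(i, j). i \<in> S \<and> j \<in> {..<length ws} - S \<and> j < i} *
       f (nths ws S) * g (nths ws ({..<length ws} - S)))"
proof (rule alternating_if_adjacent)
  fix ws :: "'a list" and i assume i: "i < length ws"
  have "linear (\<lambda>w. c * f (nths (ws[i := w]) S) * g (nths (ws[i := w]) ({..<length ws} - S)))" for S and c :: real
  proof (cases "i \<in> S")
    case True
    obtain k where k: "k < length (nths ws S)" "\<And>w. nths (ws[i := w]) S = (nths ws S)[k := w]"
      using nths_list_update_in[OF True i] by blast
    have l: "linear (\<lambda>w. f ((nths ws S)[k := w]))"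
      using f k(1) unfolding alternating_def by blast
    have "nths (ws[i := w]) ({..<length ws} - S) = nths ws ({..<length ws} - S)" for w
      using True by (intro nths_list_update_notin) simp
    then have e: "(\<lambda>w. c * f (nths (ws[i := w]) S) * g (nths (ws[i := w]) ({..<length ws} - S))) =
        (\<lambda>w. (c * g (nths ws ({..<length ws} - S))) *\<^sub>R f ((nths ws S)[k := w]))"
      by (simp only: k(2)) (simp add: mult.commute mult.left_commute)
    show ?thesis unfolding e by (rule linear_compose_scale_right[OF l])
  next
    case False
    then have iS: "i \<in> {..<length ws} - S" using i by simp
    obtain k where k: "k < length (nths ws ({..<length ws} - S))"
      "\<And>w. nths (ws[i := w]) ({..<length ws} - S) = (nths ws ({..<length ws} - S))[k := w]"
      using nths_list_update_in[OF iS i] by blast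
    have l: "linear (\<lambda>w. g ((nths ws ({..<length ws} - S))[k := w]))"
      using g k(1) unfolding alternating_def by blast
    have "nths (ws[i := w]) S = nths ws S" for w
      using False by (rule nths_list_update_notin)
    then have e: "(\<lambda>w. c * f (nths (ws[i := w]) S) * g (nths (ws[i := w]) ({..<length ws} - S))) =
        (\<lambda>w. (c * f (nths ws S)) *\<^sub>R g ((nths ws ({..<length ws} - S))[k := w]))"
      by (simp only: k(2)) simp
    show ?thesis unfolding e by (rule linear_compose_scale_right[OF l])
  qed
  then show "linear (\<lambda>w. \<Sum>S\<in>Pow {..<length (ws[i := w])}.
     (- 1) ^ card {(i', j). i' \<in> S \<and> j \<in> {..<length (ws[i := w])} - S \<and> j < i'} *
       f (nths (ws[i := w]) S) * g (nths (ws[i := w]) ({..<length (ws[i := w])} - S)))"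
    by (simp only: length_list_update) (rule linear_compose_sum, blast)
next
  fix us vs :: "'a list" and x
  define ws where "ws = us @ x # x # vs"
  define N where "N = {..<length ws}"
  define i where "i = length us"
  define s where "s = (\<lambda>k. if k = i then Suc i else if k = Suc i then i else k)"
  define inv where "inv = (\<lambda>S. {(a, b). a \<in> S \<and> b \<in> N - S \<and> b < a})"
  define T where "T = (\<lambda>S. (- 1) ^ card (inv S) * f (nths ws S) * g (nths ws (N - S)))"
  have ss: "s (s k) = k" for k by (simp add: s_def)
  have mem: "k \<in> s ` S \<longleftrightarrow> s k \<in> S" for k S
    using ss by (metis image_iff)
  have sss: "s ` s ` S = S" for S by (simp add: image_image ss)
  have sN: "s k \<in> N \<longleftrightarrow> k \<in> N" for k by (auto simp: s_def N_def ws_def i_def)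
  have fin: "finite (inv S)" if "S \<subseteq> N" for S
    by (rule finite_subset[of _ "N \<times> N"]) (use that in \<open>auto simp: inv_def N_def\<close>)
  have sub: "s ` S \<subseteq> N" if "S \<subseteq> N" for S using that sN by blast
  have nths_ws: "nths ws A = nths us A @ (if i \<in> A then [x] else []) @ (if Suc i \<in> A then [x] else [])
      @ nths vs {j. Suc (Suc (j + i)) \<in> A}" for A
    by (simp add: ws_def nths_append nths_Cons i_def)
  have nths_s: "nths ws (s ` A) = nths ws A" if "(i \<in> A) \<noteq> (Suc i \<in> A)" for A
  proof -
    have "nths us (s ` A) = nths us A"
      by (rule nths_cong) (auto simp: mem s_def i_def)
    moreover have "{j. Suc (Suc (j + i)) \<in> s ` A} = {j. Suc (Suc (j + i)) \<in> A}"
      by (auto simp: mem s_def)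
    ultimately show ?thesis using that by (auto simp: nths_ws mem s_def)
  qed
  have compl: "N - s ` S = s ` (N - S)" for S
    by (rule set_eqI) (simp only: Diff_iff mem sN)
  have half: "T (s ` S) = - T S" if "S \<subseteq> N" "i \<in> S" "Suc i \<notin> S" for S
  proof -
    define ff where "ff = (\<lambda>(a, b). (s a, s b))"
    have ff: "ff (ff z) = z" for z
      by (cases z) (simp add: ff_def ss)
    have ffmem: "z \<in> ff ` X \<longleftrightarrow> ff z \<in> X" for z X
      using ff by (metis image_iff)
    have "i \<in> N" "Suc i \<in> N" by (auto simp: N_def ws_def i_def)
    then have "(a, b) \<in> inv (s ` S) \<longleftrightarrow> (a, b) = (Suc i, i) \<or> (s a, s b) \<in> inv S" for a b
      using that(2,3) by (auto simp: inv_def mem sN) (auto simp: s_def split: if_splits)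
    then have "inv (s ` S) = insert (Suc i, i) (ff ` inv S)"
      by (intro set_eqI) (auto simp: ffmem, auto simp: ff_def)
    moreover have "(Suc i, i) \<notin> ff ` inv S"
      unfolding ffmem by (simp add: ff_def inv_def s_def)
    moreover have "inj_on ff (inv S)"
      using ff by (metis inj_onI)
    ultimately have "card (inv (s ` S)) = Suc (card (inv S))"
      using fin[OF that(1)] by (simp add: card_image)
    moreover have "nths ws (N - s ` S) = nths ws (N - S)"
      unfolding compl by (rule nths_s) (use that in \<open>auto simp: N_def ws_def i_def\<close>)
    ultimately show ?thesis using that nths_s[of S] by (simp add: T_def)
  qed
  have anti: "T (s ` S) = - T S" if S: "S \<subseteq> N" for S
  proof (cases "(i \<in> S) = (Suc i \<in> S)")
    case True
    have "s ` S = S" using True by (auto simp: mem s_def)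
    moreover have "T S = 0"
    proof (cases "i \<in> S")
      case i: True
      then have "f (nths ws S) = 0"
        using True alternating_adjacent_zero[OF f] by (simp add: nths_ws)
      then show ?thesis by (simp add: T_def)
    next
      case i: False
      have "i \<in> N" "Suc i \<in> N" by (auto simp: N_def ws_def i_def)
      then have "g (nths ws (N - S)) = 0"
        using i True alternating_adjacent_zero[OF g] by (simp add: nths_ws)
      then show ?thesis by (simp add: T_def)
    qed
    ultimately show ?thesis by simp
  next
    case False
    show ?thesis
    proof (cases "i \<in> S")
      case True
      then show ?thesis using half[OF S] False by simp
    next
      case i: False
      then have "T (s ` s ` S) = - T (s ` S)"
        using False by (intro half[OF sub[OF S]]) (auto simp: mem s_def)
      then show ?thesis by (simp add: sss)
    qed
  qed
  have "sum T (Pow N) = (\<Sum>S\<in>Pow N. T (s ` S))"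
    by (rule sum.reindex_bij_witness[of _ "(`) s" "(`) s"]) (use sss sub in auto)
  also have "\<dots> = - sum T (Pow N)"
    using anti by (simp add: sum_negf)
  finally have "sum T (Pow N) = 0" by simp
  then show "(\<Sum>S\<in>Pow {..<length (us @ x # x # vs)}.
     (- 1) ^ card {(i, j). i \<in> S \<and> j \<in> {..<length (us @ x # x # vs)} - S \<and> j < i} *
       f (nths (us @ x # x # vs) S) * g (nths (us @ x # x # vs) ({..<length (us @ x # x # vs)} - S))) = 0"
    unfolding T_def inv_def N_def ws_def by simp
qed


lemma ext_at_iff:
  "\<xi> \<in> ext_at A p \<longleftrightarrow> (\<forall>c ws. \<not> (c \<in> A \<and> p \<in> fst c) \<longrightarrow> \<xi> c ws = 0) \<and>
     (\<forall>c\<in>A. p \<in> fst c \<longrightarrow> alternating (\<xi> c)) \<and>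
     (\<forall>c\<in>A. \<forall>c'\<in>A. p \<in> fst c \<inter> fst c' \<longrightarrow>
        (\<forall>ws. \<xi> c' (map (jac c (\<lambda>q. q) c' p) ws) = \<xi> c ws))"
  unfolding ext_at_def alternating_def by blast

lemma alternating_add: "alternating F \<Longrightarrow> alternating G \<Longrightarrow> alternating (\<lambda>ws. F ws + G ws)"
  unfolding alternating_def by (simp add: linear_compose_add)

lemma alternating_scale: "alternating F \<Longrightarrow> alternating (\<lambda>ws. (a::real) * F ws)"
  unfolding alternating_def
  using linear_compose_scale_right[of "\<lambda>w. F (ws[i := w])" a for ws i] by simp

lemma ext_at_zero: "0 \<in> ext_at A p"
  unfolding ext_at_iff alternating_def by (simp add: linear_zero)

lemma ext_at_add: "\<xi> \<in> ext_at A p \<Longrightarrow> \<eta> \<in> ext_at A p \<Longrightarrow> \<xi> + \<eta> \<in> ext_at A p"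
  unfolding ext_at_iff plus_fun_def by (simp add: alternating_add)

lemma ext_at_scale: "\<xi> \<in> ext_at A p \<Longrightarrow> a *\<^sub>\<Lambda> \<xi> \<in> ext_at A p"
  unfolding ext_at_iff scale_def by (simp add: alternating_scale)

lemma ext_at_sum: "(\<And>i. i \<in> I \<Longrightarrow> f i \<in> ext_at A p) \<Longrightarrow> (\<Sum>i\<in>I. f i) \<in> ext_at A p"
  by (induction I rule: infinite_finite_induct) (auto intro: ext_at_zero ext_at_add)

lemma ext_at_wedge:
  assumes "\<xi> \<in> ext_at A p" "\<eta> \<in> ext_at A p"
  shows "\<xi> \<and>\<^sub>\<Lambda> \<eta> \<in> ext_at A p"
proof -
  have "alternating ((\<xi> \<and>\<^sub>\<Lambda> \<eta>) c)" if "c \<in> A" "p \<in> fst c" for c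
    unfolding wedge_def by (rule alternating_shuffle) (use assms that in \<open>auto simp: ext_at_iff\<close>)
  moreover have "(\<xi> \<and>\<^sub>\<Lambda> \<eta>) c' (map (jac c (\<lambda>q. q) c' p) ws) = (\<xi> \<and>\<^sub>\<Lambda> \<eta>) c ws"
    if "c \<in> A" "c' \<in> A" "p \<in> fst c \<inter> fst c'" for c c' ws
    using assms that by (simp add: wedge_def nths_map ext_at_iff)
  moreover have "(\<xi> \<and>\<^sub>\<Lambda> \<eta>) c ws = 0" if "\<not> (c \<in> A \<and> p \<in> fst c)" for c ws
  proof -
    have "\<xi> c ws' = 0" for ws' using assms(1) that unfolding ext_at_iff by blast
    then show ?thesis by (simp add: wedge_def)
  qed
  ultimately show ?thesis unfolding ext_at_iff by blast
qed

lemma sum_alt_form_apply: "(\<Sum>i\<in>I. f i) c ws = (\<Sum>i\<in>I. (f i :: ('a, 'e) alt_form) c ws)"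
  by (induction I rule: infinite_finite_induct) auto

lemma wedge_scale_left: "(a *\<^sub>\<Lambda> \<xi>) \<and>\<^sub>\<Lambda> \<eta> = a *\<^sub>\<Lambda> (\<xi> \<and>\<^sub>\<Lambda> \<eta>)"
  by (intro ext) (simp add: wedge_def scale_def sum_distrib_left mult_ac)

lemma wedge_scale_right: "\<xi> \<and>\<^sub>\<Lambda> (a *\<^sub>\<Lambda> \<eta>) = a *\<^sub>\<Lambda> (\<xi> \<and>\<^sub>\<Lambda> \<eta>)"
  by (intro ext) (simp add: wedge_def scale_def sum_distrib_left mult_ac)

lemma wedge_zero [simp]: "0 \<and>\<^sub>\<Lambda> \<eta> = 0" "\<xi> \<and>\<^sub>\<Lambda> 0 = 0"
  by (intro ext, simp add: wedge_def)+

lemma scale_zero [simp]: "0 *\<^sub>\<Lambda> \<xi> = 0" "a *\<^sub>\<Lambda> 0 = 0"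
  by (intro ext, simp add: scale_def)+


section \<open>Forms and ideals\<close>

lemma forms_zero: "0 \<in> forms A U"
  unfolding forms_def by (simp add: ext_at_zero smooth_on_const)

lemma forms_add:
  assumes "\<And>c. c \<in> A \<Longrightarrow> open (snd c ` (U \<inter> fst c))" "\<omega> \<in> forms A U" "\<eta> \<in> forms A U"
  shows "\<omega> + \<eta> \<in> forms A U"
  using assms unfolding forms_def by (simp add: ext_at_add smooth_on_add)

lemma forms_scale:
  assumes "\<And>c. c \<in> A \<Longrightarrow> open (snd c ` (U \<inter> fst c))" "\<omega> \<in> forms A U"
    and "\<And>c. c \<in> A \<Longrightarrow> smooth_on (snd c ` (U \<inter> fst c)) (\<lambda>x. f (chart_inv c x))"
  shows "(\<lambda>p. f p *\<^sub>\<Lambda> \<omega> p) \<in> forms A U"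
  using assms unfolding forms_def by (simp add: ext_at_scale[unfolded scale_def] scale_def[abs_def] smooth_on_mult zero_fun_def)

text \<open>
  Ideals consist of forms, so this is what makes ideals generated by forms meaningful: without it there
  might be no ideal that contains the generators.
\<close>

lemma forms_wedge:
  assumes "\<And>c. c \<in> A \<Longrightarrow> open (snd c ` (U \<inter> fst c))" "\<omega> \<in> forms A U" "\<eta> \<in> forms A U"
  shows "\<omega> \<and>\<^sub>\<Omega> \<eta> \<in> forms A U"
  using assms unfolding forms_def wedge_form_def
  by (auto simp: ext_at_wedge)
    (auto simp: wedge_def intro!: smooth_on_sum smooth_on_mult smooth_on_const)

text \<open>
  In each term of the shuffle formula both factors are evaluated on sub-tuples of the arguments, so
  vanishing on all tuples taken from \<open>Z\<close> is inherited by products.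
\<close>

lemma is_ideal_vanishing_forms:
  fixes A :: "('a, 'e::euclidean_space) chart set" and Z :: "'a \<Rightarrow> ('a, 'e) chart \<Rightarrow> 'e set"
  assumes opn: "\<And>c. c \<in> A \<Longrightarrow> open (snd c ` (U \<inter> fst c))"
  shows "is_ideal (forms A U) (\<and>\<^sub>\<Omega>) {\<eta> \<in> forms A U. \<forall>p c ws. set ws \<subseteq> Z p c \<longrightarrow> \<eta> p c ws = 0}"
proof -
  have z: "(\<xi> \<and>\<^sub>\<Lambda> \<eta>) c ws = 0" "(\<eta> \<and>\<^sub>\<Lambda> \<xi>) c ws = 0"
    if "\<And>ws. set ws \<subseteq> Y \<Longrightarrow> \<xi> c ws = 0" "set ws \<subseteq> Y" for \<xi> \<eta> :: "('a, 'e) alt_form" and c ws Y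
    using that set_nths_subset[of ws] by (simp_all add: wedge_def subset_iff)
  let ?J = "{\<eta> \<in> forms A U. \<forall>p c ws. set ws \<subseteq> Z p c \<longrightarrow> \<eta> p c ws = 0}"
  have "r \<and>\<^sub>\<Omega> x \<in> ?J \<and> x \<and>\<^sub>\<Omega> r \<in> ?J" if "x \<in> ?J" "r \<in> forms A U" for x r
  proof -
    have "(r \<and>\<^sub>\<Omega> x) p c ws = 0 \<and> (x \<and>\<^sub>\<Omega> r) p c ws = 0" if "set ws \<subseteq> Z p c" for p c ws
      unfolding wedge_form_def using z[of "Z p c" "x p" c ws "r p"] that \<open>x \<in> ?J\<close> by blast
    then show ?thesis using that forms_wedge[OF opn] by blast
  qed
  then show ?thesis
    unfolding is_ideal_def using forms_zero forms_add[OF opn] by simp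
qed

lemma alg_ideal_subset: "is_ideal (forms A U) (\<and>\<^sub>\<Omega>) J \<Longrightarrow> S \<subseteq> J \<Longrightarrow> alg_ideal A U S \<subseteq> J"
  unfolding alg_ideal_def gen_ideal_def by blast

lemma alg_ideal_generator: "\<omega> \<in> S \<Longrightarrow> \<omega> \<in> alg_ideal A U S"
  and alg_ideal_add: "\<omega> \<in> alg_ideal A U S \<Longrightarrow> \<eta> \<in> alg_ideal A U S \<Longrightarrow> \<omega> + \<eta> \<in> alg_ideal A U S"
  and alg_ideal_wedge_left: "\<omega> \<in> alg_ideal A U S \<Longrightarrow> \<eta> \<in> forms A U \<Longrightarrow> \<eta> \<and>\<^sub>\<Omega> \<omega> \<in> alg_ideal A U S"
  and alg_ideal_wedge_right: "\<omega> \<in> alg_ideal A U S \<Longrightarrow> \<eta> \<in> forms A U \<Longrightarrow> \<omega> \<and>\<^sub>\<Omega> \<eta> \<in> alg_ideal A U S"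
  unfolding alg_ideal_def gen_ideal_def is_ideal_def by blast+


lemma ext_at_alternating: "\<xi> \<in> ext_at A p \<Longrightarrow> c \<in> A \<Longrightarrow> p \<in> fst c \<Longrightarrow> alternating (\<xi> c)"
  and ext_at_off: "\<xi> \<in> ext_at A p \<Longrightarrow> \<not> (c \<in> A \<and> p \<in> fst c) \<Longrightarrow> \<xi> c ws = 0"
  and ext_at_change: "\<xi> \<in> ext_at A p \<Longrightarrow> c \<in> A \<Longrightarrow> c' \<in> A \<Longrightarrow> p \<in> fst c \<Longrightarrow> p \<in> fst c' \<Longrightarrow>
    \<xi> c' (map (jac c (\<lambda>q. q) c' p) ws) = \<xi> c ws"
  unfolding ext_at_iff by blast+


section \<open>The topology of a manifold\<close>

lemma openin_mtop:
  assumes "\<And>c. c \<in> A \<Longrightarrow> inj_on (snd c) (fst c)"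
  shows "openin (mtop A) W \<longleftrightarrow> W \<subseteq> points A \<and> (\<forall>c\<in>A. open (snd c ` (W \<inter> fst c)))"
proof -
  have int: "snd c ` (S \<inter> T \<inter> fst c) = snd c ` (S \<inter> fst c) \<inter> snd c ` (T \<inter> fst c)" if "c \<in> A" for c S T
    using assms[OF that] unfolding inj_on_def by blast
  have un: "snd c ` (\<Union>K \<inter> fst c) = (\<Union>S\<in>K. snd c ` (S \<inter> fst c))" for c and K :: "'a set set"
    by blast
  have "istopology (\<lambda>W. W \<subseteq> points A \<and> (\<forall>c\<in>A. open (snd c ` (W \<inter> fst c))))"
    unfolding istopology_def by (auto simp: int un)
  then show ?thesis unfolding mtop_def by simp
qed

lemma open_chart_image:
  assumes "smooth_manifold A" "openin (mtop A) U" "c \<in> A"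
  shows "open (snd c ` (U \<inter> fst c))"
  using assms openin_mtop[of A U] unfolding smooth_manifold_def by blast

lemma chart_inv_simp: "inj_on (snd c) (fst c) \<Longrightarrow> p \<in> fst c \<Longrightarrow> chart_inv c (snd c p) = p"
  unfolding chart_inv_def by (rule inv_into_f_f)

lemma smooth_manifold_inj: "smooth_manifold A \<Longrightarrow> c \<in> A \<Longrightarrow> inj_on (snd c) (fst c)"
  unfolding smooth_manifold_def by blast

lemma chart_change_differentiable:
  assumes "smooth_manifold A" "c \<in> A" "c' \<in> A" "p \<in> fst c" "p \<in> fst c'"
  shows "(\<lambda>x. snd c' (chart_inv c x)) differentiable (at (snd c p))"
proof (rule smooth_on_imp_differentiable)
  show "smooth_on (snd c ` (fst c \<inter> fst c')) (\<lambda>x. snd c' (chart_inv c x))"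
    using assms unfolding smooth_manifold_def by blast
qed (use assms in blast)


section \<open>The structure group and its action on coframes\<close>

lemma UNIV_cof: "(UNIV :: cof set) = {W0, W0b, Gm, W1, W2, W3, W4}"
  using cof.exhaust by blast

lemma sum_cof: "(\<Sum>j\<in>UNIV. f j) = f W0 + f W0b + f Gm + f W1 + f W2 + f W3 + f (W4 :: cof)"
  for f :: "cof \<Rightarrow> 'b::comm_monoid_add"
  unfolding UNIV_cof by (simp add: ac_simps)

lemma forall_cof: "(\<forall>j. P j) \<longleftrightarrow> P W0 \<and> P W0b \<and> P Gm \<and> P W1 \<and> P W2 \<and> P W3 \<and> P W4"
  by (metis cof.exhaust)

lemma Gmat_nth: "Gmat r a b c $ i $ j =
     [[ r,  0, 0, 0, 0, 0, 0],
      [ 0,  r, 0, 0, 0, 0, 0],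
      [ c, -c, r, 0, 0, 0, 0],
      [ 0,  0, 0, 1, 0, 0, 0],
      [-c,  0, 0, a, r, 0, 0],
      [ 0,  0, 0, 0, 0, 1, 0],
      [ 0,  c, 0, 0, 0, b, r]] ! cof_pos i ! cof_pos j"
  by (simp add: Gmat_def)

lemma Gmat_mult:
  "Gmat r a b c ** Gmat r' a' b' c' = Gmat (r * r') (a + r * a') (b + r * b') (c * r' + r * c')"
  by (simp add: vec_eq_iff forall_cof matrix_matrix_mult_def sum_cof Gmat_nth)

lemma Gmat_one: "Gmat 1 0 0 0 = mat 1"
  by (simp add: vec_eq_iff forall_cof mat_def Gmat_nth)

lemma Gmat_inject: "Gmat r a b c = Gmat r' a' b' c' \<longleftrightarrow> r = r' \<and> a = a' \<and> b = b' \<and> c = c'"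
  by (auto simp: vec_eq_iff forall_cof Gmat_nth)

lemma matrix_inv_Gmat:
  assumes "r \<noteq> 0"
  shows "matrix_inv (Gmat r a b c) = Gmat (1 / r) (- a / r) (- b / r) (- c / r\<^sup>2)"
proof -
  let ?A = "Gmat r a b c" and ?B = "Gmat (1 / r) (- a / r) (- b / r) (- c / r\<^sup>2)"
  have AB: "?A ** ?B = mat 1" "?B ** ?A = mat 1"
    using assms by (simp_all add: Gmat_mult Gmat_one[symmetric] Gmat_inject field_simps power2_eq_square)
  then have "?A ** matrix_inv ?A = mat 1"
    unfolding matrix_inv_def by (metis (mono_tags, lifting) someI_ex)
  then have "?B ** (?A ** matrix_inv ?A) = ?B" by simp
  then show ?thesis using AB(2) by (simp add: matrix_mul_assoc)
qed

lemma coact_Gmat: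
  assumes "r \<noteq> 0"
  shows "coact u (Gmat r a b c) W0 k ws = u W0 k ws / r"
    "coact u (Gmat r a b c) W0b k ws = u W0b k ws / r"
    "coact u (Gmat r a b c) Gm k ws = u Gm k ws / r - c / r\<^sup>2 * (u W0 k ws - u W0b k ws)"
    "coact u (Gmat r a b c) W1 k ws = u W1 k ws"
    "coact u (Gmat r a b c) W2 k ws = u W2 k ws / r + c / r\<^sup>2 * u W0 k ws - a / r * u W1 k ws"
    "coact u (Gmat r a b c) W3 k ws = u W3 k ws"
    "coact u (Gmat r a b c) W4 k ws = u W4 k ws / r - c / r\<^sup>2 * u W0b k ws - b / r * u W3 k ws"
  using assms
  by (simp_all add: coact_def matrix_inv_Gmat sum_cof scale_def Gmat_nth algebra_simps)

lemma coact_coact: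
  assumes "r \<noteq> 0" "r' \<noteq> 0"
  shows "coact (coact u (Gmat r a b c)) (Gmat r' a' b' c') = coact u (Gmat r a b c ** Gmat r' a' b' c')"
proof (intro ext)
  fix i k ws
  show "coact (coact u (Gmat r a b c)) (Gmat r' a' b' c') i k ws = coact u (Gmat r a b c ** Gmat r' a' b' c') i k ws"
    using assms by (cases i) (simp_all add: Gmat_mult coact_Gmat field_simps power2_eq_square)
qed

lemma coact_one: "coact u (Gmat 1 0 0 0) = u"
proof (intro ext)
  fix i k ws
  show "coact u (Gmat 1 0 0 0) i k ws = u i k ws"
    by (cases i) (simp_all add: coact_Gmat)
qed

lemma coact_ext_at: "(\<And>j. u j \<in> ext_at A p) \<Longrightarrow> coact u g i \<in> ext_at A p"
  unfolding coact_def by (intro ext_at_sum ext_at_scale)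

lemma coframing_indep:
  assumes "coframing A U \<sigma>" "p \<in> U" "(\<Sum>j\<in>UNIV. X j *\<^sub>\<Lambda> \<sigma> j p) = 0"
  shows "X j = 0"
proof -
  let ?l = "[W0, W0b, Gm, W1, W2, W3, W4]"
  have "lin_indep (map (\<lambda>i. \<sigma> i p) ?l)"
    using assms(1,2) unfolding coframing_def by blast
  moreover have "(\<Sum>i<length (map (\<lambda>i. \<sigma> i p) ?l). X (?l ! i) *\<^sub>\<Lambda> (map (\<lambda>i. \<sigma> i p) ?l ! i)) = 0"
    using assms(3) by (simp add: sum_cof eval_nat_numeral lessThan_Suc ac_simps)
  ultimately have "\<forall>i<length (map (\<lambda>i. \<sigma> i p) ?l). X (?l ! i) = 0"
    unfolding lin_indep_def by (elim allE[where x = "\<lambda>i. X (?l ! i)"]) blast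
  moreover have "cof_pos j < length (map (\<lambda>i. \<sigma> i p) ?l)" by (cases j) simp_all
  ultimately have "X (?l ! cof_pos j) = 0" by blast
  then show ?thesis by (cases j) simp_all
qed

lemma coact_inject:
  assumes "coframing A U \<sigma>" "p \<in> U" "r \<noteq> 0" "r' \<noteq> 0"
    and e: "coact (\<lambda>i. \<sigma> i p) (Gmat r a b c) = coact (\<lambda>i. \<sigma> i p) (Gmat r' a' b' c')"
  shows "r = r' \<and> a = a' \<and> b = b' \<and> c = c'"
proof -
  let ?g = "matrix_inv (Gmat r a b c)" and ?h = "matrix_inv (Gmat r' a' b' c')"
  have "?g $ i $ j - ?h $ i $ j = 0" for i j
  proof (rule coframing_indep[OF assms(1,2), of "\<lambda>j. ?g $ i $ j - ?h $ i $ j"])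
    have "(\<Sum>j\<in>UNIV. (?g $ i $ j - ?h $ i $ j) *\<^sub>\<Lambda> \<sigma> j p) =
        coact (\<lambda>i. \<sigma> i p) (Gmat r a b c) i - coact (\<lambda>i. \<sigma> i p) (Gmat r' a' b' c') i"
      unfolding coact_def
      by (intro ext) (simp add: sum_alt_form_apply scale_def sum_subtractf left_diff_distrib)
    then show "(\<Sum>j\<in>UNIV. (?g $ i $ j - ?h $ i $ j) *\<^sub>\<Lambda> \<sigma> j p) = 0" using e by simp
  qed
  then have "?g = ?h" by (simp add: vec_eq_iff)
  then show ?thesis using assms(3,4) by (auto simp: matrix_inv_Gmat Gmat_inject)
qed

lemma coframing_ext_at: "coframing A U \<sigma> \<Longrightarrow> p \<in> U \<Longrightarrow> \<sigma> j p \<in> ext_at A p"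
  and coframing_degree: "coframing A U \<sigma> \<Longrightarrow> length ws \<noteq> 1 \<Longrightarrow> \<sigma> j p c ws = 0"
  and coframing_openin: "coframing A U \<sigma> \<Longrightarrow> openin (mtop A) U"
  and coframing_smooth: "coframing A U \<sigma> \<Longrightarrow> c \<in> A \<Longrightarrow>
    smooth_on (snd c ` (U \<inter> fst c)) (\<lambda>x. \<sigma> j (chart_inv c x) c ws)"
  unfolding coframing_def degree_forms_def forms_def by blast+

text \<open>
  Otherwise some nontrivial combination of the coframe would vanish on all vectors in the chart \<open>k\<close>,
  hence in all charts, against linear independence.
\<close>

lemma coframing_components_surj:
  fixes A :: "('a, 'e::euclidean_space) chart set"
  assumes cof: "coframing A U \<sigma>" and "p \<in> U" "k \<in> A" "p \<in> fst k"
  obtains v where "\<And>j. \<sigma> j p k [v] = X j"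
proof -
  let ?L = "\<lambda>v. (\<chi> j. \<sigma> j p k [v]) :: real ^ cof"
  have l: "linear (\<lambda>v. \<sigma> j p k [v])" for j
  proof -
    have "alternating (\<sigma> j p k)"
      by (rule ext_at_alternating[OF coframing_ext_at[OF cof \<open>p \<in> U\<close>] assms(3,4)])
    then have "linear (\<lambda>w. \<sigma> j p k ([0][0 := w]))"
      unfolding alternating_def by (metis length_Cons zero_less_Suc)
    then show ?thesis by simp
  qed
  have lin: "linear ?L"
    by (rule linearI) (simp_all add: vec_eq_iff linear_add[OF l] linear_cmul[OF l])
  have "span (range ?L) = UNIV"
  proof (rule ccontr)
    assume "span (range ?L) \<noteq> UNIV"
    then obtain a where a: "a \<noteq> 0" "\<And>x. x \<in> span (range ?L) \<Longrightarrow> a \<bullet> x = 0"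
      using span_not_UNIV_orthogonal by blast
    let ?\<eta> = "\<Sum>j\<in>UNIV. (a $ j) *\<^sub>\<Lambda> \<sigma> j p"
    have \<eta>k: "?\<eta> k [v] = 0" for v
      using a(2)[OF span_base, of "?L v"] by (simp add: inner_vec_def sum_alt_form_apply scale_def)
    have \<eta>1: "?\<eta> c ws = 0" if "length ws \<noteq> 1" for c ws
      by (simp add: sum_alt_form_apply scale_def coframing_degree[OF cof that])
    have mem: "?\<eta> \<in> ext_at A p"
      by (intro ext_at_sum ext_at_scale coframing_ext_at[OF cof \<open>p \<in> U\<close>])
    have "?\<eta> c ws = 0" for c ws
    proof (cases "c \<in> A \<and> p \<in> fst c \<and> length ws = 1")
      case True
      then obtain w where "ws = [w]" by (auto simp: length_Suc_conv)
      moreover have "?\<eta> c ws = ?\<eta> k (map (jac c (\<lambda>q. q) k p) ws)"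
        using True assms(3,4) by (intro ext_at_change[OF mem, symmetric]) auto
      ultimately show ?thesis using \<eta>k by simp
    next
      case False
      then show ?thesis using ext_at_off[OF mem, of c ws] \<eta>1[of ws c] by blast
    qed
    then have "?\<eta> = 0" by (intro ext) simp
    then have "a $ j = 0" for j
      by (rule coframing_indep[OF cof \<open>p \<in> U\<close>])
    then show False using a(1) by (simp add: vec_eq_iff)
  qed
  moreover have "span (range ?L) = range ?L"
    using linear_subspace_image[OF lin subspace_UNIV] by (simp only: span_eq_iff)
  ultimately have "(\<chi> j. X j) \<in> range ?L" by (metis UNIV_I)
  then obtain v where "(\<chi> j. X j) = ?L v" by (rule imageE)
  then have "\<sigma> j p k [v] = X j" for j by (simp add: vec_eq_iff)
  then show thesis using that by blast
qed


section \<open>The total space of the structure of adapted coframes\<close>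

text \<open>
  The members of the atlas of the bundle, as a function of the chart of \<open>N\<close> and the local section that
  they are built from.
\<close>

definition G_chart :: "('a, 'e::euclidean_space) cofpt set \<Rightarrow> ('a, 'e) chart \<Rightarrow> 'a set
    \<Rightarrow> (cof \<Rightarrow> ('a, 'e) form) \<Rightarrow> (('a, 'e) cofpt, 'e \<times> real \<times> real \<times> real \<times> real) chart" where
  "G_chart GG k U \<sigma> = ({(p, u) \<in> GG. p \<in> fst k \<inter> U},
     \<lambda>(p, u). (snd k p, THE (r, a, b, c). r \<noteq> 0 \<and> u = coact (\<lambda>i. \<sigma> i p) (Gmat r a b c)))"

lemma G_atlas_G_chart: "G_atlas N GG = {G_chart GG k U \<sigma> | k U \<sigma>. k \<in> N \<and> G_section N GG U \<sigma>}"
  unfolding G_atlas_def G_chart_def ..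

locale G_bundle =
  fixes N :: "('a, 'e::euclidean_space) chart set" and GG :: "('a, 'e) cofpt set"
  assumes manifold: "smooth_manifold N" and G_str: "G_structure N GG"
begin

lemma fibre_is_orbit:
  assumes "(p, u) \<in> GG"
  shows "(p, v) \<in> GG \<longleftrightarrow> (\<exists>r a b c. r \<noteq> 0 \<and> v = coact u (Gmat r a b c))"
proof -
  have "p \<in> points N" using assms G_str unfolding G_structure_def by force
  then obtain U \<sigma> where "p \<in> U" and fib: "\<forall>q\<in>U. {u. (q, u) \<in> GG} = coact (\<lambda>i. \<sigma> i q) ` Ggroup"
    using G_str unfolding G_structure_def by blast
  then have mem: "(p, w) \<in> GG \<longleftrightarrow> w \<in> coact (\<lambda>i. \<sigma> i p) ` Ggroup" for w by blast
  then have fib: "(p, w) \<in> GG \<longleftrightarrow> (\<exists>r a b c. r \<noteq> 0 \<and> w = coact (\<lambda>i. \<sigma> i p) (Gmat r a b c))" for w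
    unfolding Ggroup_def by blast
  obtain r a b c where r: "r \<noteq> 0" and u: "u = coact (\<lambda>i. \<sigma> i p) (Gmat r a b c)"
    using assms fib by blast
  show ?thesis
  proof
    assume "(p, v) \<in> GG"
    then obtain r' a' b' c' where r': "r' \<noteq> 0" and v: "v = coact (\<lambda>i. \<sigma> i p) (Gmat r' a' b' c')"
      using fib by blast
    have "v = coact u (Gmat (r' / r) ((a' - a) / r) ((b' - b) / r) ((c' - c * (r' / r)) / r))"
      using r r' unfolding u v by (simp add: coact_coact Gmat_mult)
    moreover have "r' / r \<noteq> 0" using r r' by simp
    ultimately show "\<exists>r a b c. r \<noteq> 0 \<and> v = coact u (Gmat r a b c)" by blast
  next
    assume "\<exists>r a b c. r \<noteq> 0 \<and> v = coact u (Gmat r a b c)"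
    then obtain r' a' b' c' where r': "r' \<noteq> 0" and v: "v = coact u (Gmat r' a' b' c')"
      by blast
    have "v = coact (\<lambda>i. \<sigma> i p) (Gmat (r * r') (a + r * a') (b + r * b') (c * r' + r * c'))"
      using r r' unfolding u v by (simp add: coact_coact Gmat_mult)
    then show "(p, v) \<in> GG" using fib r r' by (metis mult_eq_0_iff)
  qed
qed

lemma section_coframing: "G_section N GG U \<sigma> \<Longrightarrow> coframing N U \<sigma>"
  and section_in_GG: "G_section N GG U \<sigma> \<Longrightarrow> p \<in> U \<Longrightarrow> (p, \<lambda>i. \<sigma> i p) \<in> GG"
  unfolding G_section_def by blast+

lemma GG_over_section:
  assumes "G_section N GG U \<sigma>" "p \<in> U"
  shows "(p, v) \<in> GG \<longleftrightarrow> (\<exists>r a b c. r \<noteq> 0 \<and> v = coact (\<lambda>i. \<sigma> i p) (Gmat r a b c))"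
  using fibre_is_orbit[OF section_in_GG[OF assms]] .

context
  fixes k :: "('a, 'e) chart" and U \<sigma>
  assumes k: "k \<in> N" and sec: "G_section N GG U \<sigma>"
begin

lemma mem_G_chart:
  "x \<in> fst (G_chart GG k U \<sigma>) \<longleftrightarrow> (\<exists>p r a b c. p \<in> fst k \<and> p \<in> U \<and> r \<noteq> 0 \<and>
     x = (p, coact (\<lambda>i. \<sigma> i p) (Gmat r a b c)))"
proof -
  obtain p u where x: "x = (p, u)" by (cases x)
  have "x \<in> fst (G_chart GG k U \<sigma>) \<longleftrightarrow> (p, u) \<in> GG \<and> p \<in> fst k \<and> p \<in> U"
    by (auto simp: G_chart_def x)
  then show ?thesis using GG_over_section[OF sec] unfolding x by blast
qed

lemma G_chart_coordinates:
  assumes "p \<in> U" "r \<noteq> 0"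
  shows "snd (G_chart GG k U \<sigma>) (p, coact (\<lambda>i. \<sigma> i p) (Gmat r a b c)) = (snd k p, r, a, b, c)"
proof -
  have "(THE (r', a', b', c'). r' \<noteq> 0 \<and>
      coact (\<lambda>i. \<sigma> i p) (Gmat r a b c) = coact (\<lambda>i. \<sigma> i p) (Gmat r' a' b' c')) = (r, a, b, c)"
  proof (rule the_equality)
    fix z :: "real \<times> real \<times> real \<times> real"
    assume z: "case z of (r', a', b', c') \<Rightarrow> r' \<noteq> 0 \<and>
      coact (\<lambda>i. \<sigma> i p) (Gmat r a b c) = coact (\<lambda>i. \<sigma> i p) (Gmat r' a' b' c')"
    obtain r' a' b' c' where ze: "z = (r', a', b', c')" by (cases z)
    have "r' \<noteq> 0" "coact (\<lambda>i. \<sigma> i p) (Gmat r a b c) = coact (\<lambda>i. \<sigma> i p) (Gmat r' a' b' c')"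
      using z unfolding ze prod.case by blast+
    from coact_inject[OF section_coframing[OF sec] \<open>p \<in> U\<close> assms(2) this]
    show "z = (r, a, b, c)" unfolding ze by blast
  qed (use assms(2) in simp)
  then show ?thesis by (simp add: G_chart_def)
qed

lemma G_chart_image:
  "snd (G_chart GG k U \<sigma>) ` fst (G_chart GG k U \<sigma>) = snd k ` (U \<inter> fst k) \<times> (UNIV - {0}) \<times> UNIV"
proof -
  have *: "y \<in> snd (G_chart GG k U \<sigma>) ` fst (G_chart GG k U \<sigma>) \<longleftrightarrow>
      (\<exists>p r a b c. p \<in> fst k \<and> p \<in> U \<and> r \<noteq> 0 \<and> y = (snd k p, r, a, b, c))" (is "?l \<longleftrightarrow> ?r") for y
  proof
    assume ?l
    then obtain x where "x \<in> fst (G_chart GG k U \<sigma>)" "y = snd (G_chart GG k U \<sigma>) x" by blast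
    then show ?r unfolding mem_G_chart using G_chart_coordinates by blast
  next
    assume ?r
    then obtain p r a b c where p: "p \<in> fst k" "p \<in> U" "r \<noteq> 0" "y = (snd k p, r, a, b, c)" by blast
    then have "y = snd (G_chart GG k U \<sigma>) (p, coact (\<lambda>i. \<sigma> i p) (Gmat r a b c))"
      by (simp add: G_chart_coordinates)
    moreover have "(p, coact (\<lambda>i. \<sigma> i p) (Gmat r a b c)) \<in> fst (G_chart GG k U \<sigma>)"
      unfolding mem_G_chart using p by blast
    ultimately show ?l by (rule image_eqI)
  qed
  show ?thesis
  proof (rule set_eqI)
    fix y :: "'e \<times> real \<times> real \<times> real \<times> real"
    obtain x r a b c where y: "y = (x, r, a, b, c)" by (cases y)
    show "y \<in> snd (G_chart GG k U \<sigma>) ` fst (G_chart GG k U \<sigma>) \<longleftrightarrow>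
        y \<in> snd k ` (U \<inter> fst k) \<times> (UNIV - {0}) \<times> UNIV"
      unfolding * by (auto simp: y)
  qed
qed

lemma G_chart_inj: "inj_on (snd (G_chart GG k U \<sigma>)) (fst (G_chart GG k U \<sigma>))"
proof (rule inj_onI)
  fix x y
  assume xm: "x \<in> fst (G_chart GG k U \<sigma>)" and ym: "y \<in> fst (G_chart GG k U \<sigma>)"
    and eq: "snd (G_chart GG k U \<sigma>) x = snd (G_chart GG k U \<sigma>) y"
  obtain p r a b c where
    x: "p \<in> fst k" "p \<in> U" "r \<noteq> 0" "x = (p, coact (\<lambda>i. \<sigma> i p) (Gmat r a b c))"
    using xm unfolding mem_G_chart by blast
  obtain q r' a' b' c' where
    y: "q \<in> fst k" "q \<in> U" "r' \<noteq> 0" "y = (q, coact (\<lambda>i. \<sigma> i q) (Gmat r' a' b' c'))"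
    using ym unfolding mem_G_chart by blast
  have e: "(snd k p, r, a, b, c) = (snd k q, r', a', b', c')"
    using eq unfolding x(4) y(4) G_chart_coordinates[OF x(2,3)] G_chart_coordinates[OF y(2,3)] .
  have "p = q"
    by (rule inj_onD[OF smooth_manifold_inj[OF manifold k] _ x(1) y(1)]) (use e in simp)
  then show "x = y" using e unfolding x(4) y(4) by simp
qed

lemma G_chart_inv:
  assumes "x \<in> snd k ` (U \<inter> fst k)" "r \<noteq> 0"
  shows "chart_inv (G_chart GG k U \<sigma>) (x, r, a, b, c) =
    (chart_inv k x, coact (\<lambda>i. \<sigma> i (chart_inv k x)) (Gmat r a b c))"
proof -
  obtain p where p: "p \<in> U" "p \<in> fst k" "x = snd k p" using assms by blast
  then have inv: "chart_inv k (snd k p) = p" using chart_inv_simp[OF smooth_manifold_inj[OF manifold k]] by simp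
  have "(p, coact (\<lambda>i. \<sigma> i p) (Gmat r a b c)) \<in> fst (G_chart GG k U \<sigma>)"
    using mem_G_chart p assms(2) by blast
  from chart_inv_simp[OF G_chart_inj this] show ?thesis
    unfolding p(3) inv G_chart_coordinates[OF p(1) assms(2)] .
qed

lemma G_chart_image_open: "open (snd k ` (U \<inter> fst k) \<times> (UNIV - {0::real}) \<times> (UNIV :: (real \<times> real \<times> real) set))"
  by (intro open_Times open_chart_image[OF manifold coframing_openin[OF section_coframing[OF sec]] k])
    (simp_all add: open_delete)

lemma G_chart_mem_atlas: "G_chart GG k U \<sigma> \<in> G_atlas N GG"
  unfolding G_atlas_G_chart using k sec by blast

text \<open>
  In the charts of the bundle the projection to \<open>N\<close> is \<open>(x, r, a, b, c) \<mapsto> x\<close>, so its differential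
  forgets the fibre components of a vector.
\<close>

lemma projection_has_derivative:
  assumes x: "x \<in> fst (G_chart GG k U \<sigma>)" and k': "k' \<in> N" "fst x \<in> fst k'"
  shows "((\<lambda>y. snd k' (fst (chart_inv (G_chart GG k U \<sigma>) y))) has_derivative
    (\<lambda>V. jac k (\<lambda>q. q) k' (fst x) (fst V))) (at (snd (G_chart GG k U \<sigma>) x))"
proof -
  obtain p r a b c where p: "p \<in> fst k" "p \<in> U" "r \<noteq> 0" and
    xe: "x = (p, coact (\<lambda>i. \<sigma> i p) (Gmat r a b c))"
    using x unfolding mem_G_chart by blast
  have sx: "snd (G_chart GG k U \<sigma>) x = (snd k p, r, a, b, c)"
    using p by (simp add: xe G_chart_coordinates)
  have "(\<lambda>y. snd k' (chart_inv k y)) differentiable (at (snd k p))"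
    using chart_change_differentiable[OF manifold k k'(1) p(1)] k' xe by simp
  then have "((\<lambda>y. snd k' (chart_inv k y)) has_derivative jac k (\<lambda>q. q) k' p) (at (snd k p))"
    unfolding jac_def frechet_derivative_works .
  then have D: "((\<lambda>y. snd k' (chart_inv k (fst y))) has_derivative (\<lambda>V. jac k (\<lambda>q. q) k' p (fst V)))
      (at (snd k p, r, a, b, c))"
    by (intro has_derivative_compose[OF has_derivative_fst[OF has_derivative_ident]]) simp
  have fx: "fst x = p" using xe by simp
  show ?thesis
    unfolding sx fx
  proof (rule has_derivative_transform_within_open[OF D G_chart_image_open])
    show "(snd k p, r, a, b, c) \<in> snd k ` (U \<inter> fst k) \<times> (UNIV - {0}) \<times> UNIV" using p by blast
    fix y :: "'e \<times> real \<times> real \<times> real \<times> real"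
    assume "y \<in> snd k ` (U \<inter> fst k) \<times> (UNIV - {0}) \<times> UNIV"
    then show "snd k' (chart_inv k (fst y)) = snd k' (fst (chart_inv (G_chart GG k U \<sigma>) y))"
      by (cases y) (auto simp: G_chart_inv)
  qed
qed

lemma GG_ext_at: "(p, u) \<in> GG \<Longrightarrow> p \<in> U \<Longrightarrow> u i \<in> ext_at N p"
  using GG_over_section[OF sec] coact_ext_at coframing_ext_at[OF section_coframing[OF sec]]
  by metis

text \<open>
  The tautological form only sees the base components of vectors, and on these it is the coframe itself.
  The chart of \<open>N\<close> that is chosen in the definition of the pullback drops out because covectors transform
  correctly under changes of charts.
\<close>

lemma taut_apply:
  assumes x: "x \<in> fst (G_chart GG k U \<sigma>)"
  shows "taut N GG i x (G_chart GG k U \<sigma>) Vs = snd x i k (map fst Vs)"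
proof -
  obtain p u where xe: "x = (p, u)" and pu: "(p, u) \<in> GG" "p \<in> fst k" "p \<in> U"
    using x by (cases x) (auto simp: G_chart_def)
  define k' where "k' = (SOME k'. k' \<in> N \<and> p \<in> fst k')"
  have k': "k' \<in> N \<and> p \<in> fst k'"
    unfolding k'_def by (rule someI[of _ k]) (use k pu in simp)
  have jac: "jac (G_chart GG k U \<sigma>) fst k' x = (\<lambda>V. jac k (\<lambda>q. q) k' p (fst V))"
    using frechet_derivative_at[OF projection_has_derivative[OF x]] k' xe unfolding jac_def[of _ fst] by simp
  have "taut N GG i x (G_chart GG k U \<sigma>) Vs = u i k' (map (jac k (\<lambda>q. q) k' p) (map fst Vs))"
    using pu x G_chart_mem_atlas
    by (simp add: taut_def pull_at_def xe k'_def[symmetric] jac[unfolded xe] comp_def)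
  also have "\<dots> = u i k (map fst Vs)"
    using GG_ext_at[OF pu(1,3)] k pu(2) k' by (intro ext_at_change) auto
  finally show ?thesis by (simp add: xe)
qed

end

end


context G_bundle
begin

lemma G_atlas_cases:
  assumes "C \<in> G_atlas N GG"
  obtains k U \<sigma> where "k \<in> N" "G_section N GG U \<sigma>" "C = G_chart GG k U \<sigma>"
  using assms unfolding G_atlas_G_chart by blast

lemma G_atlas_domain: "C \<in> G_atlas N GG \<Longrightarrow> GG \<inter> fst C = fst C"
  by (erule G_atlas_cases) (auto simp: G_chart_def)

lemma G_atlas_open: "C \<in> G_atlas N GG \<Longrightarrow> open (snd C ` (GG \<inter> fst C))"
  using G_atlas_domain by (metis G_atlas_cases G_chart_image G_chart_image_open)

lemma taut_in_chart:
  assumes k: "k \<in> N" and sec: "G_section N GG U \<sigma>" and "x \<in> snd k ` (U \<inter> fst k)" "r \<noteq> 0"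
  shows "taut N GG i (chart_inv (G_chart GG k U \<sigma>) (x, r, a, b, c)) (G_chart GG k U \<sigma>) Vs =
    coact (\<lambda>j. \<sigma> j (chart_inv k x)) (Gmat r a b c) i k (map fst Vs)"
proof -
  let ?C = "G_chart GG k U \<sigma>"
  have "chart_inv k x \<in> U \<inter> fst k"
    using assms(3) chart_inv_simp[OF smooth_manifold_inj[OF manifold k]] by auto
  then have "chart_inv ?C (x, r, a, b, c) \<in> fst ?C"
    unfolding G_chart_inv[OF k sec assms(3,4)] mem_G_chart[OF k sec] using assms(4) by blast
  from taut_apply[OF k sec this] show ?thesis
    by (simp add: G_chart_inv[OF k sec assms(3,4)])
qed

lemma taut_smooth:
  assumes k: "k \<in> N" and sec: "G_section N GG U \<sigma>"
  shows "smooth_on (snd (G_chart GG k U \<sigma>) ` fst (G_chart GG k U \<sigma>))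
    (\<lambda>y. taut N GG i (chart_inv (G_chart GG k U \<sigma>) y) (G_chart GG k U \<sigma>) Vs)"
proof -
  let ?C = "G_chart GG k U \<sigma>"
  define D where "D = snd k ` (U \<inter> fst k) \<times> (UNIV - {0::real}) \<times> (UNIV :: (real \<times> real \<times> real) set)"
  have D: "open D" unfolding D_def by (rule G_chart_image_open[OF k sec])
  define S where "S = (\<lambda>j (y :: 'e \<times> real \<times> real \<times> real \<times> real). \<sigma> j (chart_inv k (fst y)) k (map fst Vs))"
  define R where "R = (\<lambda>y :: 'e \<times> real \<times> real \<times> real \<times> real. inverse (fst (snd y)))"
  have sS: "smooth_on D (S j)" for j
    unfolding S_def
    by (rule smooth_on_comp_linear[OF bounded_linear_fst D _ coframing_smooth[OF section_coframing[OF sec] k]])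
      (auto simp: D_def)
  have lin: "smooth_on D L" if "bounded_linear L" for L :: "'e \<times> real \<times> real \<times> real \<times> real \<Rightarrow> real"
    by (rule smooth_on_linear[OF that D])
  have sR: "smooth_on D R"
    unfolding R_def
    by (intro smooth_on_inverse[OF D] lin bounded_linear_fst_comp bounded_linear_snd) (auto simp: D_def)
  have sA: "smooth_on D (\<lambda>y. fst (snd (snd y)))"
    by (intro lin bounded_linear_fst_comp bounded_linear_snd_comp bounded_linear_snd)
  have sB: "smooth_on D (\<lambda>y. fst (snd (snd (snd y))))"
    by (intro lin bounded_linear_fst_comp bounded_linear_snd_comp bounded_linear_snd)
  have sC: "smooth_on D (\<lambda>y. snd (snd (snd (snd y))))"
    by (intro lin bounded_linear_snd_comp bounded_linear_snd)
  note intros = smooth_on_add[OF D] smooth_on_mult[OF D] smooth_on_const sS sR sA sB sC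
  define F where "F = (\<lambda>y. case i of
      W0 \<Rightarrow> R y * S W0 y | W0b \<Rightarrow> R y * S W0b y
    | Gm \<Rightarrow> R y * S Gm y + (- 1) * (snd (snd (snd (snd y))) * (R y * (R y * (S W0 y + (- 1) * S W0b y))))
    | W1 \<Rightarrow> S W1 y
    | W2 \<Rightarrow> R y * S W2 y + (snd (snd (snd (snd y))) * (R y * (R y * S W0 y)) + (- 1) * (fst (snd (snd y)) * (R y * S W1 y)))
    | W3 \<Rightarrow> S W3 y
    | W4 \<Rightarrow> R y * S W4 y + (- 1) * (snd (snd (snd (snd y))) * (R y * (R y * S W0b y)) + fst (snd (snd (snd y))) * (R y * S W3 y)))"
  have "smooth_on D F"
    unfolding F_def by (cases i; simp only: cof.case; intro intros)
  moreover have "F y = taut N GG i (chart_inv ?C y) ?C Vs" if "y \<in> D" for y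
  proof -
    obtain x r a b c where y: "y = (x, r, a, b, c)" by (cases y)
    have xr: "x \<in> snd k ` (U \<inter> fst k)" "r \<noteq> 0" using that unfolding D_def y by auto
    show ?thesis
      unfolding y taut_in_chart[OF k sec xr] F_def S_def R_def
      by (cases i; simp only: cof.case fst_conv snd_conv coact_Gmat[OF xr(2)])
        (simp_all add: divide_inverse algebra_simps power2_eq_square)
  qed
  ultimately show ?thesis
    unfolding G_chart_image[OF k sec] D_def[symmetric] by (rule smooth_on_cong[OF D, rotated])
qed

text \<open>
  Two local sections differ by a function with values in the group. Its entries are rational
  functions of the components of the two coframes on a fixed vector, chosen so that the denominators do
  not vanish.
\<close>

lemma transition_differentiable:
  assumes k: "k \<in> N" and sec: "G_section N GG U \<sigma>" and sec': "G_section N GG U' \<sigma>'" and k': "k' \<in> N"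
    and x: "x \<in> fst (G_chart GG k U \<sigma>)" "x \<in> fst (G_chart GG k' U' \<sigma>')"
  shows "(\<lambda>y. snd (G_chart GG k' U' \<sigma>') (chart_inv (G_chart GG k U \<sigma>) y))
    differentiable (at (snd (G_chart GG k U \<sigma>) x))"
proof -
  let ?C = "G_chart GG k U \<sigma>" and ?C' = "G_chart GG k' U' \<sigma>'"
  obtain p r0 a0 b0 c0 where p: "p \<in> fst k" "p \<in> U" "r0 \<noteq> 0"
    and xe: "x = (p, coact (\<lambda>i. \<sigma> i p) (Gmat r0 a0 b0 c0))"
    using x(1) unfolding mem_G_chart[OF k sec] by blast
  have p': "p \<in> fst k'" "p \<in> U'"
    using x(2) unfolding mem_G_chart[OF k' sec'] xe by blast+
  have sx: "snd ?C x = (snd k p, r0, a0, b0, c0)"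
    unfolding xe by (rule G_chart_coordinates[OF k sec p(2,3)])
  note cof = section_coframing[OF sec] and cof' = section_coframing[OF sec']
  \<comment> \<open>The components of \<open>w\<close> are chosen to make the denominators in \<open>\<rho>\<close>, \<open>\<Gamma>\<close>, \<open>\<A>\<close>, \<open>\<B>\<close> below nonzero at \<open>p\<close>.\<close>
  obtain w where w: "\<And>j. \<sigma>' j p k [w] = (if j \<in> {W0, W1, W3} then 1 else 0)"
    using coframing_components_surj[OF cof' p'(2) k p(1), of "\<lambda>j. if j \<in> {W0, W1, W3} then 1 else 0"]
    by blast
  define f where "f = (\<lambda>j x. \<sigma> j (chart_inv k x) k [w])"
  define f' where "f' = (\<lambda>j x. \<sigma>' j (chart_inv k x) k [w])"
  define S where "S = snd k ` (U \<inter> fst k) \<inter> snd k ` (U' \<inter> fst k)"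
  have S: "open S"
    unfolding S_def using open_chart_image[OF manifold _ k] coframing_openin[OF cof] coframing_openin[OF cof']
    by blast
  have pS: "snd k p \<in> S" using p p' unfolding S_def by blast
  have inv: "chart_inv k (snd k q) = q" if "q \<in> fst k" for q
    using chart_inv_simp[OF smooth_manifold_inj[OF manifold k] that] .
  have sf: "smooth_on S (f j)" for j
    unfolding f_def S_def by (rule smooth_on_subset[OF coframing_smooth[OF cof k]]) blast
  have sf': "smooth_on S (f' j)" for j
    unfolding f'_def S_def by (rule smooth_on_subset[OF coframing_smooth[OF cof' k]]) blast
  have f'p: "f' j (snd k p) = (if j \<in> {W0, W1, W3} then 1 else 0)" for j
    unfolding f'_def inv[OF p(1)] w ..
  define \<rho> where "\<rho> = (\<lambda>x. f' W0 x / f W0 x)"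
  define \<Gamma> where "\<Gamma> = (\<lambda>x. \<rho> x * \<rho> x * (f' Gm x / \<rho> x - f Gm x) / (f' W0 x - f' W0b x))"
  define \<A> where "\<A> = (\<lambda>x. \<rho> x * (f' W2 x / \<rho> x + \<Gamma> x / (\<rho> x * \<rho> x) * f' W0 x - f W2 x) / f' W1 x)"
  define \<B> where "\<B> = (\<lambda>x. \<rho> x * (f' W4 x / \<rho> x - \<Gamma> x / (\<rho> x * \<rho> x) * f' W0b x - f W4 x) / f' W3 x)"
  \<comment> \<open>The change of frame is read off from the components of the two frames on \<open>w\<close>.\<close>
  have coeff: "f W0 x \<noteq> 0 \<and> \<rho> x \<noteq> 0 \<and>
      (\<lambda>j. \<sigma> j (chart_inv k x)) = coact (\<lambda>j. \<sigma>' j (chart_inv k x)) (Gmat (\<rho> x) (\<A> x) (\<B> x) (\<Gamma> x))"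
    if xS: "x \<in> S" and nz: "f' W0 x \<noteq> 0" "f' W1 x \<noteq> 0" "f' W3 x \<noteq> 0" "f' W0 x - f' W0b x \<noteq> 0" for x
  proof -
    define q where "q = chart_inv k x"
    have q: "q \<in> U" "q \<in> U'" "q \<in> fst k"
    proof -
      obtain q1 where q1: "q1 \<in> U" "q1 \<in> fst k" "x = snd k q1" using xS unfolding S_def by blast
      obtain q2 where q2: "q2 \<in> U'" "q2 \<in> fst k" "x = snd k q2" using xS unfolding S_def by blast
      have "q = q1" unfolding q_def q1(3) by (rule inv[OF q1(2)])
      moreover have "q = q2" unfolding q_def q2(3) by (rule inv[OF q2(2)])
      ultimately show "q \<in> U" "q \<in> U'" "q \<in> fst k" using q1 q2 by simp_all
    qed
    obtain r a b c where r: "r \<noteq> 0" and e: "(\<lambda>i. \<sigma> i q) = coact (\<lambda>i. \<sigma>' i q) (Gmat r a b c)"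
      using section_in_GG[OF sec q(1)] unfolding GG_over_section[OF sec' q(2)] by blast
    have fj: "f j x = coact (\<lambda>i. \<sigma>' i q) (Gmat r a b c) j k [w]" for j
      unfolding f_def q_def[symmetric] using fun_cong[OF e, of j] by simp
    have f'j: "\<sigma>' j q k [w] = f' j x" for j unfolding f'_def q_def ..
    note fs = fj[of W0] fj[of Gm] fj[of W2] fj[of W4]
    note fs = fs[unfolded coact_Gmat[OF r] f'j]
    have 1: "\<rho> x = r" "f W0 x \<noteq> 0" using fs(1) nz(1) r by (simp_all add: \<rho>_def)
    have 2: "\<Gamma> x = c" unfolding \<Gamma>_def 1(1) fs(2) using nz(4) r by (simp add: field_simps power2_eq_square)
    have 3: "\<A> x = a" unfolding \<A>_def 1(1) 2 fs(3) using nz(2) r by (simp add: field_simps power2_eq_square)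
    have 4: "\<B> x = b" unfolding \<B>_def 1(1) 2 fs(4) using nz(3) r by (simp add: field_simps power2_eq_square)
    show ?thesis using 1 2 3 4 r e unfolding q_def by simp
  qed
  define d where "d = (\<lambda>x. f' W0 x * (f' W1 x * (f' W3 x * (f' W0 x + (- 1) * f' W0b x))))"
  have "smooth_on S d"
    unfolding d_def by (intro smooth_on_mult[OF S] smooth_on_add[OF S] smooth_on_const sf')
  then have "continuous_on S d"
    by (simp add: continuous_at_imp_continuous_on differentiable_imp_continuous_within smooth_on_imp_differentiable)
  then have O: "open (S \<inter> d -` (- {0}))"
    using S by (intro continuous_open_preimage) auto
  define Y where "Y = (S \<inter> d -` (- {0})) \<times> (UNIV - {0::real}) \<times> (UNIV :: (real \<times> real \<times> real) set)"
  have Y: "open Y" unfolding Y_def by (intro open_Times O) (simp_all add: open_delete)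
  have nz: "f' W0 x \<noteq> 0" "f' W1 x \<noteq> 0" "f' W3 x \<noteq> 0" "f' W0 x - f' W0b x \<noteq> 0"
    if "x \<in> S \<inter> d -` (- {0})" for x
    using that unfolding d_def by auto
  have dp: "snd k p \<in> S \<inter> d -` (- {0})" using pS by (simp add: d_def f'p)
  have trans: "snd ?C' (chart_inv ?C y) = (snd k' (chart_inv k (fst y)), \<rho> (fst y) * fst (snd y),
      \<A> (fst y) + \<rho> (fst y) * fst (snd (snd y)), \<B> (fst y) + \<rho> (fst y) * fst (snd (snd (snd y))),
      \<Gamma> (fst y) * fst (snd y) + \<rho> (fst y) * snd (snd (snd (snd y))))" if "y \<in> Y" for y
  proof -
    obtain x r a b c where y: "y = (x, r, a, b, c)" by (cases y)
    have x: "x \<in> S \<inter> d -` (- {0})" "r \<noteq> 0" using that unfolding Y_def y by auto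
    have xU: "x \<in> snd k ` (U \<inter> fst k)" "x \<in> snd k ` (U' \<inter> fst k)" using x(1) unfolding S_def by blast+
    have q: "chart_inv k x \<in> U'" using xU(2) inv by auto
    have "x \<in> S" using x(1) by blast
    note co = coeff[OF this nz[OF x(1)]]
    have "chart_inv ?C y = (chart_inv k x, coact (\<lambda>j. \<sigma> j (chart_inv k x)) (Gmat r a b c))"
      unfolding y by (rule G_chart_inv[OF k sec xU(1) x(2)])
    also have "coact (\<lambda>j. \<sigma> j (chart_inv k x)) (Gmat r a b c) = coact (\<lambda>j. \<sigma>' j (chart_inv k x))
        (Gmat (\<rho> x * r) (\<A> x + \<rho> x * a) (\<B> x + \<rho> x * b) (\<Gamma> x * r + \<rho> x * c))"
      using co x(2) by (simp add: coact_coact Gmat_mult)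
    finally show ?thesis
      using G_chart_coordinates[OF k' sec' q, of "\<rho> x * r"] co x(2) by (simp add: y)
  qed
  have df: "f j differentiable (at (snd k p))" and df': "f' j differentiable (at (snd k p))" for j
    using smooth_on_imp_differentiable[OF sf pS] smooth_on_imp_differentiable[OF sf' pS] by blast+
  note co = coeff[OF pS nz[OF dp]]
  have ne: "f W0 (snd k p) \<noteq> 0" "\<rho> (snd k p) \<noteq> 0" "\<rho> (snd k p) * \<rho> (snd k p) \<noteq> 0" using co by auto
  have d\<rho>: "\<rho> differentiable (at (snd k p))"
    unfolding \<rho>_def by (intro differentiable_divide df df' ne)
  have d\<Gamma>: "\<Gamma> differentiable (at (snd k p))"
    unfolding \<Gamma>_def
    by (intro differentiable_divide differentiable_mult differentiable_diff differentiable_add df df' d\<rho> ne nz[OF dp])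
  have d\<A>: "\<A> differentiable (at (snd k p))"
    unfolding \<A>_def
    by (intro differentiable_divide differentiable_mult differentiable_diff differentiable_add df df' d\<rho> d\<Gamma> ne nz[OF dp])
  have d\<B>: "\<B> differentiable (at (snd k p))"
    unfolding \<B>_def
    by (intro differentiable_divide differentiable_mult differentiable_diff differentiable_add df df' d\<rho> d\<Gamma> ne nz[OF dp])
  have dk: "(\<lambda>x. snd k' (chart_inv k x)) differentiable (at (snd k p))"
    using chart_change_differentiable[OF manifold k k' p(1) p'(1)] .
  have fst': "(\<lambda>y. h (fst y)) differentiable (at (snd k p, r0, a0, b0, c0))"
    if "h differentiable (at (snd k p))" for h :: "'e \<Rightarrow> 'z::real_normed_vector"
  proof -
    have "(h has_derivative frechet_derivative h (at (snd k p))) (at (fst (snd k p, r0, a0, b0, c0)))"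
      using that by (simp add: frechet_derivative_works[symmetric])
    from has_derivative_compose[OF has_derivative_fst[OF has_derivative_ident] this] show ?thesis
      unfolding differentiable_def by blast
  qed
  have lin: "L differentiable (at y)" if "bounded_linear L" for L :: "'e \<times> real \<times> real \<times> real \<times> real \<Rightarrow> real" and y
    using bounded_linear_imp_differentiable[OF that] .
  have l: "(\<lambda>y :: 'e \<times> real \<times> real \<times> real \<times> real. fst (snd y)) differentiable (at y)"
    "(\<lambda>y :: 'e \<times> real \<times> real \<times> real \<times> real. fst (snd (snd y))) differentiable (at y)"
    "(\<lambda>y :: 'e \<times> real \<times> real \<times> real \<times> real. fst (snd (snd (snd y)))) differentiable (at y)"
    "(\<lambda>y :: 'e \<times> real \<times> real \<times> real \<times> real. snd (snd (snd (snd y)))) differentiable (at y)" for y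
    by (intro lin bounded_linear_fst_comp bounded_linear_snd_comp bounded_linear_snd)+
  have "(\<lambda>y. (snd k' (chart_inv k (fst y)), \<rho> (fst y) * fst (snd y),
      \<A> (fst y) + \<rho> (fst y) * fst (snd (snd y)), \<B> (fst y) + \<rho> (fst y) * fst (snd (snd (snd y))),
      \<Gamma> (fst y) * fst (snd y) + \<rho> (fst y) * snd (snd (snd (snd y))))) differentiable (at (snd ?C x))"
    unfolding sx
    by (intro differentiable_Pair differentiable_add differentiable_mult l fst' dk d\<rho> d\<A> d\<B> d\<Gamma>)
  then obtain T where "((\<lambda>y. (snd k' (chart_inv k (fst y)), \<rho> (fst y) * fst (snd y),
      \<A> (fst y) + \<rho> (fst y) * fst (snd (snd y)), \<B> (fst y) + \<rho> (fst y) * fst (snd (snd (snd y))),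
      \<Gamma> (fst y) * fst (snd y) + \<rho> (fst y) * snd (snd (snd (snd y))))) has_derivative T) (at (snd ?C x))"
    unfolding differentiable_def by blast
  moreover have "snd ?C x \<in> Y" unfolding sx Y_def using dp p(3) by blast
  ultimately have "((\<lambda>y. snd ?C' (chart_inv ?C y)) has_derivative T) (at (snd ?C x))"
    by (rule has_derivative_transform_within_open[OF _ Y]) (rule trans[symmetric])
  then show ?thesis unfolding differentiable_def by blast
qed


lemma alternating_map:
  fixes F :: "'y::real_vector list \<Rightarrow> real" and L :: "'z::real_vector \<Rightarrow> 'y"
  shows "alternating F \<Longrightarrow> linear L \<Longrightarrow> alternating (\<lambda>ws. F (map L ws))"
  unfolding alternating_def
proof (intro conjI allI impI; elim conjE)
  fix ws :: "'z list" and i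
  assume "\<forall>ws. \<forall>i<length ws. linear (\<lambda>w. F (ws[i := w]))" "linear L" "i < length ws"
  then show "linear (\<lambda>w. F (map L (ws[i := w])))"
    using linear_compose[of L "\<lambda>w. F ((map L ws)[i := w])"] by (simp add: map_update comp_def)
next
  fix ws :: "'z list" and i j
  assume "\<forall>ws i j. i < j \<and> j < length ws \<and> ws ! i = ws ! j \<longrightarrow> F ws = 0"
    and "i < j" "j < length ws" "ws ! i = ws ! j"
  moreover from this have "map L ws ! i = map L ws ! j" by simp
  ultimately show "F (map L ws) = 0" by (metis length_map)
qed

text \<open>
  Changes of charts on the bundle project to changes of charts on \<open>N\<close>, under which the coframe
  transforms correctly.
\<close>

lemma taut_ext_at:
  assumes "x \<in> GG"
  shows "taut N GG i x \<in> ext_at (G_atlas N GG) x"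
proof -
  obtain p u where xe: "x = (p, u)" by (cases x)
  have "taut N GG i x C ws = 0" if "\<not> (C \<in> G_atlas N GG \<and> x \<in> fst C)" for C ws
    using that by (auto simp: taut_def pull_at_def)
  moreover have "alternating (taut N GG i x C)" if "C \<in> G_atlas N GG" "x \<in> fst C" for C
    using that(1)
  proof (cases rule: G_atlas_cases)
    case (1 k U \<sigma>)
    have p: "p \<in> fst k" "p \<in> U" using that(2) unfolding 1 xe by (auto simp: G_chart_def)
    have "alternating (u i k)"
      using GG_ext_at[OF 1(1,2)] assms p unfolding xe by (intro ext_at_alternating[OF _ 1(1)]) auto
    then have "alternating (\<lambda>Vs. u i k (map fst Vs))"
      by (rule alternating_map) (rule linear_fst)
    moreover have "taut N GG i x C = (\<lambda>Vs. u i k (map fst Vs))"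
      unfolding 1(3) using taut_apply[OF 1(1,2)] that(2) unfolding 1(3) xe by (intro ext) simp
    ultimately show ?thesis by simp
  qed
  moreover have "taut N GG i x C' (map (jac C (\<lambda>q. q) C' x) Vs) = taut N GG i x C Vs"
    if C: "C \<in> G_atlas N GG" "C' \<in> G_atlas N GG" and xC: "x \<in> fst C" "x \<in> fst C'" for C C' Vs
  proof -
    obtain k U \<sigma> where 1: "k \<in> N" "G_section N GG U \<sigma>" "C = G_chart GG k U \<sigma>"
      using C(1) by (rule G_atlas_cases)
    obtain k' U' \<sigma>' where 2: "k' \<in> N" "G_section N GG U' \<sigma>'" "C' = G_chart GG k' U' \<sigma>'"
      using C(2) by (rule G_atlas_cases)
    have p: "p \<in> fst k" "p \<in> U" "p \<in> fst k'" using xC unfolding 1 2 xe by (auto simp: G_chart_def)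
    let ?T = "\<lambda>y. snd C' (chart_inv C y)"
    have "(?T has_derivative jac C (\<lambda>q. q) C' x) (at (snd C x))"
      using transition_differentiable[OF 1(1,2) 2(2,1)] xC unfolding 1(3) 2(3) jac_def
      by (simp add: frechet_derivative_works[symmetric])
    then have "((\<lambda>y. fst (?T y)) has_derivative (\<lambda>V. fst (jac C (\<lambda>q. q) C' x V))) (at (snd C x))"
      by (rule has_derivative_fst)
    moreover have "(\<lambda>y. fst (?T y)) = (\<lambda>y. snd k' (fst (chart_inv C y)))"
      unfolding 2(3) G_chart_def by (simp add: case_prod_beta)
    moreover have "((\<lambda>y. snd k' (fst (chart_inv C y))) has_derivative (\<lambda>V. jac k (\<lambda>q. q) k' p (fst V)))
        (at (snd C x))"
      unfolding 1(3) xe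
      by (rule projection_has_derivative[OF 1(1,2) xC(1)[unfolded 1(3)] 2(1), unfolded xe fst_conv, OF p(3)])
    ultimately have "(\<lambda>V. fst (jac C (\<lambda>q. q) C' x V)) = (\<lambda>V. jac k (\<lambda>q. q) k' p (fst V))"
      using has_derivative_unique by metis
    then have m: "map fst (map (jac C (\<lambda>q. q) C' x) Vs) = map (jac k (\<lambda>q. q) k' p) (map fst Vs)"
      by (simp add: comp_def)
    have a: "taut N GG i x C' Ws = u i k' (map fst Ws)" for Ws
      using taut_apply[OF 2(1,2) xC(2)[unfolded 2(3)]] unfolding 2(3) xe by simp
    have b: "taut N GG i x C Ws = u i k (map fst Ws)" for Ws
      using taut_apply[OF 1(1,2) xC(1)[unfolded 1(3)]] unfolding 1(3) xe by simp
    have "u i k' (map (jac k (\<lambda>q. q) k' p) (map fst Vs)) = u i k (map fst Vs)"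
      using GG_ext_at[OF 1(1,2)] assms p 1(1) 2(1) unfolding xe by (intro ext_at_change) auto
    then show ?thesis
      unfolding a b m .
  qed
  ultimately show ?thesis unfolding ext_at_iff by blast
qed

lemma taut_forms: "taut N GG i \<in> forms (G_atlas N GG) GG"
proof -
  have "smooth_on (snd C ` (GG \<inter> fst C)) (\<lambda>y. taut N GG i (chart_inv C y) C ws)"
    if "C \<in> G_atlas N GG" for C ws
    using that
  proof (cases rule: G_atlas_cases)
    case (1 k U \<sigma>)
    show ?thesis unfolding G_atlas_domain[OF that] unfolding 1(3) by (rule taut_smooth[OF 1(1,2)])
  qed
  moreover have "taut N GG i x = 0" if "x \<notin> GG" for x using that by (simp add: taut_def)
  ultimately show ?thesis unfolding forms_def using taut_ext_at by blast
qed

text \<open>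
  A section \<open>\<sigma>\<close> pulls the tautological form back to \<open>\<sigma>\<close>; on vectors tangent to the slice through
  the identity of the group, the derivative of the tautological form is that of \<open>\<sigma>\<close>.
\<close>

lemma ext_d_taut_section:
  assumes sec: "G_section N GG U \<sigma>" and k: "k \<in> N" and p: "p \<in> U" "p \<in> fst k"
  shows "ext_d (G_atlas N GG) GG (taut N GG i) (p, \<lambda>i. \<sigma> i p) (G_chart GG k U \<sigma>) [(v, 0), (w, 0)] =
    ext_d N U (\<sigma> i) p k [v, w]"
proof -
  let ?C = "G_chart GG k U \<sigma>" and ?x = "(p, \<lambda>i. \<sigma> i p)"
  have xC: "?x \<in> fst ?C" using section_in_GG[OF sec p(1)] p by (simp add: G_chart_def)
  have sx: "snd ?C ?x = (snd k p, 1, 0, 0, 0)"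
    using G_chart_coordinates[OF k sec p(1), of 1 0 0 0] by (simp add: coact_one)
  have der: "frechet_derivative (\<lambda>y. taut N GG i (chart_inv ?C y) ?C [(w, 0)]) (at (snd ?C ?x)) (v, 0) =
      frechet_derivative (\<lambda>x. \<sigma> i (chart_inv k x) k [w]) (at (snd k p)) v" (is "frechet_derivative ?F _ _ = _")
    for v w
  proof -
    have "?F differentiable (at (snd ?C ?x))"
      using smooth_on_imp_differentiable[OF taut_smooth[OF k sec]] xC by blast
    then have F: "(?F has_derivative frechet_derivative ?F (at (snd ?C ?x))) (at (snd k p, 1, 0, 0, 0))"
      unfolding frechet_derivative_works[symmetric] sx .
    have "((\<lambda>x. (x, 1, 0, 0, 0)) has_derivative (\<lambda>v. (v, 0, 0, 0, 0))) (at (snd k p))"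
      by (intro has_derivative_Pair has_derivative_ident has_derivative_const)
    from has_derivative_compose[OF this F]
    have "((\<lambda>x. ?F (x, 1, 0, 0, 0)) has_derivative (\<lambda>v. frechet_derivative ?F (at (snd ?C ?x)) (v, 0, 0, 0, 0)))
        (at (snd k p))" .
    then have "((\<lambda>x. \<sigma> i (chart_inv k x) k [w]) has_derivative
        (\<lambda>v. frechet_derivative ?F (at (snd ?C ?x)) (v, 0, 0, 0, 0))) (at (snd k p))"
    proof (rule has_derivative_transform_within_open)
      show "open (snd k ` (U \<inter> fst k))"
        by (rule open_chart_image[OF manifold coframing_openin[OF section_coframing[OF sec]] k])
      show "snd k p \<in> snd k ` (U \<inter> fst k)" using p by blast
      fix x assume "x \<in> snd k ` (U \<inter> fst k)"
      from taut_in_chart[OF k sec this, of 1 i 0 0 0 "[(w, 0)]"]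
      show "?F (x, 1, 0, 0, 0) = \<sigma> i (chart_inv k x) k [w]" by (simp add: coact_one)
    qed
    from frechet_derivative_at[OF this] show ?thesis by (simp add: zero_prod_def fun_eq_iff)
  qed
  have "?x \<in> GG" using section_in_GG[OF sec p(1)] .
  then show ?thesis
    using xC G_chart_mem_atlas[OF k sec] p k der by (simp add: ext_d_def)
qed

lemma G_section_coact:
  assumes sec: "G_section N GG U \<sigma>" and r: "r \<noteq> 0"
  shows "G_section N GG U (\<lambda>i q. coact (\<lambda>j. \<sigma> j q) (Gmat r a b c) i)" (is "G_section N GG U ?\<sigma>'")
proof -
  let ?g = "Gmat r a b c"
  note cof = section_coframing[OF sec]
  note U = coframing_openin[OF cof]
  have "?\<sigma>' i \<in> degree_forms 1 N U" for i
  proof -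
    have "?\<sigma>' i q = 0" if "q \<notin> U" for q
    proof -
      have "\<sigma> j q = 0" for j
        using cof that unfolding coframing_def degree_forms_def forms_def by blast
      then show ?thesis by (simp add: coact_def)
    qed
    moreover have "?\<sigma>' i q c ws = 0" if "length ws \<noteq> 1" for q c ws
      using coframing_degree[OF cof that] by (simp add: coact_def sum_alt_form_apply scale_def)
    moreover have "smooth_on (snd k ` (U \<inter> fst k)) (\<lambda>x. ?\<sigma>' i (chart_inv k x) k ws)" if "k \<in> N" for k ws
      unfolding coact_def sum_alt_form_apply scale_def
      by (intro smooth_on_sum smooth_on_mult smooth_on_const coframing_smooth[OF cof that]
          open_chart_image[OF manifold U that])
    moreover have "?\<sigma>' i q \<in> ext_at N q" if "q \<in> U" for q
      by (intro coact_ext_at coframing_ext_at[OF cof that])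
    ultimately show ?thesis
      unfolding degree_forms_def forms_def by blast
  qed
  moreover have "lin_indep (map (\<lambda>i. ?\<sigma>' i p) [W0, W0b, Gm, W1, W2, W3, W4])" if "p \<in> U" for p
    unfolding lin_indep_def
  proof (intro allI impI)
    let ?l = "[W0, W0b, Gm, W1, W2, W3, W4]"
    fix X :: "nat \<Rightarrow> real" and i
    assume z: "(\<Sum>i<length (map (\<lambda>i. ?\<sigma>' i p) ?l). X i *\<^sub>\<Lambda> (map (\<lambda>i. ?\<sigma>' i p) ?l ! i)) = 0"
      and i: "i < length (map (\<lambda>i. ?\<sigma>' i p) ?l)"
    \<comment> \<open>The coefficients of the given combination in terms of the original coframe.\<close>
    let ?Y = "\<lambda>j. case j of W0 \<Rightarrow> X 0 / r - c / r\<^sup>2 * X 2 + c / r\<^sup>2 * X 4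
      | W0b \<Rightarrow> X 1 / r + c / r\<^sup>2 * X 2 - c / r\<^sup>2 * X 6 | Gm \<Rightarrow> X 2 / r | W1 \<Rightarrow> X 3 - a / r * X 4
      | W2 \<Rightarrow> X 4 / r | W3 \<Rightarrow> X 5 - b / r * X 6 | W4 \<Rightarrow> X 6 / r"
    have "(\<Sum>j\<in>UNIV. ?Y j *\<^sub>\<Lambda> \<sigma> j p) =
        (\<Sum>i<length (map (\<lambda>i. ?\<sigma>' i p) ?l). X i *\<^sub>\<Lambda> (map (\<lambda>i. ?\<sigma>' i p) ?l ! i))"
      by (intro ext) (simp add: sum_cof scale_def coact_Gmat[OF r] eval_nat_numeral lessThan_Suc algebra_simps)
    then have "?Y j = 0" for j
      using z by (intro coframing_indep[OF cof that]) simp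
    from this[of W0] this[of W0b] this[of Gm] this[of W1] this[of W2] this[of W3] this[of W4]
    have "X 0 = 0 \<and> X 1 = 0 \<and> X 2 = 0 \<and> X 3 = 0 \<and> X 4 = 0 \<and> X 5 = 0 \<and> X 6 = 0"
      using r by simp
    then show "X i = 0" using i by (auto simp: eval_nat_numeral less_Suc_eq)
  qed
  moreover have "(p, \<lambda>i. ?\<sigma>' i p) \<in> GG" if "p \<in> U" for p
    unfolding GG_over_section[OF sec that] using r by blast
  ultimately show ?thesis using cof unfolding G_section_def coframing_def by blast
qed

lemma ext_d_coact:
  assumes sec: "G_section N GG U \<sigma>" and k: "k \<in> N" and p: "p \<in> U" "p \<in> fst k"
  shows "ext_d N U (\<lambda>q. coact (\<lambda>j. \<sigma> j q) g i) p k [v, w] =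
    (\<Sum>j\<in>UNIV. matrix_inv g $ i $ j * ext_d N U (\<sigma> j) p k [v, w])"
proof -
  have d: "(\<lambda>x. \<sigma> j (chart_inv k x) k ws) differentiable (at (snd k p))" for j ws
    by (rule smooth_on_imp_differentiable[OF coframing_smooth[OF section_coframing[OF sec] k]])
      (use p in blast)
  have "frechet_derivative (\<lambda>x. coact (\<lambda>j. \<sigma> j (chart_inv k x)) g i k ws) (at (snd k p)) =
      (\<lambda>v. \<Sum>j\<in>UNIV. matrix_inv g $ i $ j *
        frechet_derivative (\<lambda>x. \<sigma> j (chart_inv k x) k ws) (at (snd k p)) v)" for ws
    unfolding coact_def sum_alt_form_apply scale_def
    by (rule frechet_derivative_at[symmetric], intro has_derivative_sum has_derivative_mult_right)
      (use d in \<open>simp add: frechet_derivative_works[symmetric]\<close>)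
  then show ?thesis
    using p k by (simp add: ext_d_def sum_subtractf right_diff_distrib)
qed

end


section \<open>The group action on the torsion\<close>

text \<open>
  The closed form of the action whose infinitesimal form is \<^const>\<open>inf_action\<close>. The parameter \<open>s\<close> stands for \<open>c / r\<close>;
  with respect to it the action of the subgroup \<open>a = b = 0\<close> is that of a product of the multiplicative and
  the additive group.
\<close>

definition torsion_action :: "real \<Rightarrow> real \<Rightarrow> real \<Rightarrow> real \<Rightarrow> real ^ tors \<Rightarrow> tors \<Rightarrow> real" where
  "torsion_action r a b s t k = (case k of
     C1 \<Rightarrow> t$C1
   | P1 \<Rightarrow> t$P1 + a * t$P2 - 2 * s
   | P2 \<Rightarrow> r * t$P2
   | P3 \<Rightarrow> t$P3 + b * t$P4 + 2 * s
   | P4 \<Rightarrow> r * t$P4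
   | R11 \<Rightarrow> r * (t$R11 + a * t$R12)
   | R12 \<Rightarrow> r\<^sup>2 * t$R12
   | R33 \<Rightarrow> r * (t$R33 + b * t$R34)
   | R34 \<Rightarrow> r\<^sup>2 * t$R34
   | T10 \<Rightarrow> r\<^sup>2 * (t$T10 - s * (t$T12 - t$T12b) - s\<^sup>2 * t$R12)
   | T20 \<Rightarrow> r * (t$T20 - a * t$T10 / 2 + b * t$T30 / 2
       + s / 2 * (t$T11 + a * t$T12 - t$T11b - a * t$T12b - t$T33 - b * t$T34 + t$T33b + b * t$T34b)
       + s\<^sup>2 / 2 * (t$R11 + a * t$R12 - t$R33 - b * t$R34))
   | T30 \<Rightarrow> r\<^sup>2 * (t$T30 - s * (t$T34 - t$T34b) - s\<^sup>2 * t$R34)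
   | T11 \<Rightarrow> r * (t$T11 + a * t$T12 + s * (t$R11 + a * t$R12 - t$P2 / 2))
   | T12 \<Rightarrow> r\<^sup>2 * (t$T12 + s * t$R12)
   | T11b \<Rightarrow> r * (t$T11b + a * t$T12b - s * (t$R11 + a * t$R12 - t$P4 / 2))
   | T12b \<Rightarrow> r\<^sup>2 * (t$T12b - s * t$R12)
   | T33 \<Rightarrow> r * (t$T33 + b * t$T34 + s * (t$R33 + b * t$R34 - t$P2 / 2))
   | T34 \<Rightarrow> r\<^sup>2 * (t$T34 + s * t$R34)
   | T33b \<Rightarrow> r * (t$T33b + b * t$T34b - s * (t$R33 + b * t$R34 - t$P4 / 2))
   | T34b \<Rightarrow> r\<^sup>2 * (t$T34b - s * t$R34))"

text \<open>
  The structure equations as real equations. Here \<open>X\<close> and \<open>Z\<close> are the components of two vectors in the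
  coframe, \<open>B i j\<close> is the value of \<open>\<omega>\<^sup>i \<and> \<omega>\<^sup>j\<close> and \<open>q \<xi> j\<close> that of \<open>\<xi> \<and> \<omega>\<^sup>j\<close>.
\<close>

lemma structure_form_apply:
  fixes w :: "cof \<Rightarrow> ('b, 'f) alt_form"
  assumes "\<And>j. w j c [] = 0" and [simp]: "\<phi> c [] = 0" "\<pi> c [] = 0" "\<alpha> c [] = 0" "\<beta> c [] = 0"
  shows "(conn \<phi> \<pi> \<alpha> \<beta> w i + torsion t w i) c [V, Y] = (let
     X = (\<lambda>j. w j c [V]); Z = (\<lambda>j. w j c [Y]); B = (\<lambda>i j. X i * Z j - Z i * X j);
     q = (\<lambda>\<xi> j. \<xi> c [V] * Z j - \<xi> c [Y] * X j)
   in case i of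
     W0 \<Rightarrow> B W1 W2 + B W3 W4 + B W3 Gm
       + Kval t * B Gm W0 + t$P1 * B W1 W0 + t$P2 * B W2 W0 + t$P3 * B W3 W0 + t$P4 * B W4 W0 - q \<phi> W0
   | W0b \<Rightarrow> B W1 W2 + B W1 Gm + B W3 W4
       - Kval t * B Gm W0b + (t$P1 + 1) * B W1 W0b + t$P2 * B W2 W0b + (t$P3 + 1) * B W3 W0b + t$P4 * B W4 W0b
       - q \<phi> W0b
   | Gm \<Rightarrow> B W1 W2 - B W3 W4 + t$C1 * (B W1 W0 + B W1 W0b - B W3 W0 - B W3 W0b)
       - q \<pi> W0 + q \<pi> W0b - q \<phi> Gm
   | W1 \<Rightarrow> t$T10 * B W0 W0b + t$T11 * B W0 W1 + t$T12 * (B W0 W2 + B W0 Gm)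
       + t$T11b * B W0b W1 + t$T12b * B W0b W2 + t$R11 * B Gm W1 + t$R12 * B Gm W2
       + t$P2 / 2 * (B W3 Gm + B W3 W2 + B W3 W4) - t$P2 / 2 * B W1 W2
       - (t$P1 + t$P3 + 1) / 2 * B W1 W3 - t$P4 / 2 * B W1 W4
   | W2 \<Rightarrow> t$T20 * B W0 W0b - t$C1 * B W0 W3 - t$T11 * (B W0 W2 + B W0 Gm) - t$T11b * B W0b W2
       - (t$R11 + (t$P2 + t$P4) / 4) * B Gm W2 - (t$C1 + t$P1 / 2) * (B W3 Gm + B W3 W2 + B W3 W4)
       + q \<pi> W0 - q \<alpha> W1 - q \<phi> W2
   | W3 \<Rightarrow> t$T30 * B W0b W0 + t$T33b * B W0b W3 + t$T34b * (B W0b W4 + B W0b Gm)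
       + t$T33 * B W0 W3 + t$T34 * B W0 W4 + t$R33 * B Gm W3 + t$R34 * B Gm W4
       + t$P4 / 2 * (B W1 Gm + B W1 W2 + B W1 W4) + (t$P1 + t$P3 + 1) / 2 * B W1 W3
       + t$P2 / 2 * B W2 W3 - t$P4 / 2 * B W3 W4
   | W4 \<Rightarrow> - t$T20 * B W0b W0 + t$C1 * B W0b W1 - t$T33b * (B W0b W4 + B W0b Gm) - t$T33 * B W0 W4
       - (t$R33 + (t$P2 + t$P4) / 4) * B Gm W4 - (t$C1 + (t$P3 + 1) / 2) * (B W1 Gm + B W1 W2 + B W1 W4)
       - q \<pi> W0b - q \<beta> W3 - q \<phi> W4)"
  by (cases i; simp only: conn_def torsion_def Let_def cof.case)
    (simp_all add: wedge_apply_2 scale_def assms(1) algebra_simps add_divide_distrib diff_divide_distrib)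

text \<open>
  The structure equations determine the torsion: each torsion function is a linear combination of
  components of the differentials of the coframe in which the pseudo-connection cancels. So the effect
  of a change of frame on the torsion follows from the transformation rule of these differentials;
  the group parameter \<open>c\<close> enters through \<open>s = c / r\<close>.
\<close>

lemma torsion_of_changed_frame:
  fixes u :: "cof \<Rightarrow> ('b, 'f) alt_form" and u' :: "cof \<Rightarrow> ('b, 'f) alt_form" and e :: "'v \<Rightarrow> 'f"
  assumes r: "r \<noteq> 0"
    and nil: "\<And>j. u j d [] = 0" "\<phi> d [] = 0" "\<pi> d [] = 0" "\<alpha> d [] = 0" "\<beta> d [] = 0"
      "\<And>j. u' j d' [] = 0" "\<phi>' d' [] = 0" "\<pi>' d' [] = 0" "\<alpha>' d' [] = 0" "\<beta>' d' [] = 0"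
    and frame: "\<And>i v. u' i d' [e v] = (\<Sum>j\<in>UNIV. matrix_inv (Gmat r a b (r * s)) $ i $ j * u j d [e v])"
    and onto: "\<And>X. \<exists>v. \<forall>j. u j d [e v] = X j"
    and eq: "\<And>i v w. (conn \<phi>' \<pi>' \<alpha>' \<beta>' u' i + torsion t' u' i) d' [e v, e w] =
      (\<Sum>j\<in>UNIV. matrix_inv (Gmat r a b (r * s)) $ i $ j *
        (conn \<phi> \<pi> \<alpha> \<beta> u j + torsion t u j) d [e v, e w])"
  shows "t' = (\<chi> k. torsion_action r a b s t k)"
proof -
  \<comment> \<open>\<open>E\<close> is the frame dual to the changed coframe.\<close>
  have "\<forall>m. \<exists>v. \<forall>j. u j d [e v] = Gmat r a b (r * s) $ j $ m"
    using onto[of "\<lambda>j. Gmat r a b (r * s) $ j $ m" for m] by blast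
  then obtain E where E: "\<And>m j. u j d [e (E m)] = Gmat r a b (r * s) $ j $ m" by metis
  have inv: "matrix_inv (Gmat r a b (r * s)) = Gmat (1 / r) (- a / r) (- b / r) (- s / r)"
    using r by (simp add: matrix_inv_Gmat power2_eq_square)
  have E': "u' i d' [e (E m)] = (if i = m then 1 else 0)" for i m
    unfolding frame E inv using r
    by (cases i; cases m) (simp_all add: sum_cof Gmat_nth)
  note rules = structure_form_apply[of u d \<phi> \<pi> \<alpha> \<beta>, OF nil(1-5)]
    structure_form_apply[of u' d' \<phi>' \<pi>' \<alpha>' \<beta>', OF nil(6-10)] Let_def E E' inv sum_cof Gmat_nth
  have 1: "t' $ R11 = r * (t$R11 + a * t$R12)"
    using eq[of W1 "E Gm" "E W1", unfolded rules] r by (simp add: algebra_simps)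
  have 2: "t' $ R12 = r\<^sup>2 * t$R12"
    using eq[of W1 "E Gm" "E W2", unfolded rules] r by (simp add: algebra_simps power2_eq_square)
  have 3: "t' $ R33 = r * (t$R33 + b * t$R34)"
    using eq[of W3 "E Gm" "E W3", unfolded rules] r by (simp add: algebra_simps)
  have 4: "t' $ R34 = r\<^sup>2 * t$R34"
    using eq[of W3 "E Gm" "E W4", unfolded rules] r by (simp add: algebra_simps power2_eq_square)
  have 5: "t' $ T10 = r\<^sup>2 * (t$T10 - s * (t$T12 - t$T12b) - s\<^sup>2 * t$R12)"
    using eq[of W1 "E W0" "E W0b", unfolded rules] r by (simp add: algebra_simps power2_eq_square)
  have 6: "t' $ T30 = r\<^sup>2 * (t$T30 - s * (t$T34 - t$T34b) - s\<^sup>2 * t$R34)"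
    using eq[of W3 "E W0b" "E W0", unfolded rules] r by (simp add: algebra_simps power2_eq_square)
  have 7: "t' $ T11 = r * (t$T11 + a * t$T12 + s * (t$R11 + a * t$R12 - t$P2 / 2))"
    using eq[of W1 "E W0" "E W1", unfolded rules] r by (simp add: algebra_simps)
  have 8: "t' $ T12 = r\<^sup>2 * (t$T12 + s * t$R12)"
    using eq[of W1 "E W0" "E W2", unfolded rules] r by (simp add: algebra_simps power2_eq_square)
  have 9: "t' $ T11b = r * (t$T11b + a * t$T12b - s * (t$R11 + a * t$R12 - t$P4 / 2))"
    using eq[of W1 "E W0b" "E W1", unfolded rules] r by (simp add: algebra_simps)
  have 10: "t' $ T12b = r\<^sup>2 * (t$T12b - s * t$R12)"
    using eq[of W1 "E W0b" "E W2", unfolded rules] r by (simp add: algebra_simps power2_eq_square)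
  have 11: "t' $ T33 = r * (t$T33 + b * t$T34 + s * (t$R33 + b * t$R34 - t$P2 / 2))"
    using eq[of W3 "E W0" "E W3", unfolded rules] r by (simp add: algebra_simps)
  have 12: "t' $ T34 = r\<^sup>2 * (t$T34 + s * t$R34)"
    using eq[of W3 "E W0" "E W4", unfolded rules] r by (simp add: algebra_simps power2_eq_square)
  have 13: "t' $ T33b = r * (t$T33b + b * t$T34b - s * (t$R33 + b * t$R34 - t$P4 / 2))"
    using eq[of W3 "E W0b" "E W3", unfolded rules] r by (simp add: algebra_simps)
  have 14: "t' $ T34b = r\<^sup>2 * (t$T34b - s * t$R34)"
    using eq[of W3 "E W0b" "E W4", unfolded rules] r by (simp add: algebra_simps power2_eq_square)
  have 15: "t' $ P2 = r * t$P2"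
    using eq[of W1 "E W3" "E Gm", unfolded rules] r by (simp add: algebra_simps)
  have 16: "t' $ P4 = r * t$P4"
    using eq[of W3 "E W1" "E Gm", unfolded rules] r by (simp add: algebra_simps)
  have "r * t' $ P1 = r * (t$P1 + a * t$P2 - 2 * s)"
    using eq[of W0 "E W1" "E W0", unfolded rules] eq[of Gm "E W1" "E Gm", unfolded rules] r
    by (simp add: field_simps)
  then have 17: "t' $ P1 = t$P1 + a * t$P2 - 2 * s" using r by simp
  have "\<phi>' d' [e (E W3)] = s + \<phi> d [e (E W3)]"
    using eq[of Gm "E W3" "E Gm", unfolded rules] r by (simp add: field_simps)
  then have "r * t' $ P3 = r * (t$P3 + b * t$P4 + 2 * s)"
    using eq[of W0 "E W3" "E W0", unfolded rules] r
    by (simp add: field_simps)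
  then have 18: "t' $ P3 = t$P3 + b * t$P4 + 2 * s" using r by simp
  have "r * (r * s) + (r * (r * t' $ C1) + (r * (r * (s * t $ P1)) + (a * (r * (r * (s * t $ P2)))
      + r * (r * \<pi> d [e (E W1)])))) = r * (r * t $ C1) + (r * (r * (s * s)) + r * (r * \<pi>' d' [e (E W1)]))"
    using eq[of Gm "E W1" "E W0", unfolded rules] r by (simp add: field_simps)
  moreover have "r * (r * t' $ C1) + (r * (r * (s * s)) + r * (r * \<pi>' d' [e (E W1)])) = r * (r * s)
      + (r * (r * t $ C1) + (r * (r * (s * t $ P1)) + (a * (r * (r * (s * t $ P2))) + r * (r * \<pi> d [e (E W1)]))))"
    using eq[of Gm "E W1" "E W0b", unfolded rules] r by (simp add: field_simps)
  ultimately have "r * (r * t' $ C1) = r * (r * t$C1)" by linarith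
  then have 19: "t' $ C1 = t$C1" using r by simp
  \<comment> \<open>In the sum of the components for \<open>\<omega>\<^sup>2\<close>, \<open>\<omega>\<^sup>4\<close> and \<open>\<gamma>\<close> the terms with \<open>\<pi>\<close> and \<open>\<phi>\<close> cancel.\<close>
  define F where "F j = (conn \<phi> \<pi> \<alpha> \<beta> u j + torsion t u j) d [e (E W0), e (E W0b)]" for j
  define F' where "F' j = (conn \<phi>' \<pi>' \<alpha>' \<beta>' u' j + torsion t' u' j) d' [e (E W0), e (E W0b)]" for j
  have FF: "F' i = (\<Sum>j\<in>UNIV. matrix_inv (Gmat r a b (r * s)) $ i $ j * F j)" for i
    unfolding F_def F'_def by (rule eq)
  have sumF: "r * (F' W2 + F' W4 + F' Gm) = F W2 + F W4 + F Gm - a * F W1 - b * F W3"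
    using r by (simp add: FF inv sum_cof Gmat_nth field_simps)
  have F's: "F' W2 + F' W4 + F' Gm = 2 * t' $ T20"
    unfolding F'_def rules by simp
  have F1: "F W1 = r\<^sup>2 * (t$T10 - s * (t$T12 - t$T12b) - s\<^sup>2 * t$R12)"
    unfolding F_def rules by (simp add: algebra_simps power2_eq_square)
  have F3: "F W3 = - (r\<^sup>2 * (t$T30 - s * (t$T34 - t$T34b) - s\<^sup>2 * t$R34))"
    unfolding F_def rules by (simp add: algebra_simps power2_eq_square)
  have Fs: "F W2 + F W4 + F Gm = r\<^sup>2 * (2 * t$T20
      + s * (t$T11 - t$T11b - t$T33 + t$T33b) + s\<^sup>2 * (t$R11 - t$R33))"
    unfolding F_def rules
    by (simp add: algebra_simps power2_eq_square add_divide_distrib diff_divide_distrib)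
  have "r * (2 * t' $ T20) = r * (2 * (r * (t$T20 - a * t$T10 / 2 + b * t$T30 / 2
       + s / 2 * (t$T11 + a * t$T12 - t$T11b - a * t$T12b - t$T33 - b * t$T34 + t$T33b + b * t$T34b)
       + s\<^sup>2 / 2 * (t$R11 + a * t$R12 - t$R33 - b * t$R34))))"
    unfolding F's[symmetric] sumF F1 F3 Fs by (simp add: algebra_simps power2_eq_square)
  then have 20: "t' $ T20 = r * (t$T20 - a * t$T10 / 2 + b * t$T30 / 2
       + s / 2 * (t$T11 + a * t$T12 - t$T11b - a * t$T12b - t$T33 - b * t$T34 + t$T33b + b * t$T34b)
       + s\<^sup>2 / 2 * (t$R11 + a * t$R12 - t$R33 - b * t$R34))" using r by simp
  have "t' $ k = torsion_action r a b s t k" for k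
    using 1 2 3 4 5 6 7 8 9 10 11 12 13 14 15 16 17 18 19 20
    unfolding torsion_action_def by (cases k; simp only: tors.case)
  then show ?thesis by (simp add: vec_eq_iff)
qed


locale G_bundle_with_torsion = G_bundle N GG
  for N :: "('a, 'e::euclidean_space) chart set" and GG +
  fixes \<phi> \<pi> \<alpha> \<beta> :: "(('a, 'e) cofpt, 'e \<times> real \<times> real \<times> real \<times> real) form"
    and \<tau> :: "('a, 'e) cofpt \<Rightarrow> real ^ tors"
  assumes str: "structure_equations N GG \<phi> \<pi> \<alpha> \<beta> \<tau>"
begin

lemma structure_eq:
  "x \<in> GG \<Longrightarrow> ext_d (G_atlas N GG) GG (taut N GG i) x =
     conn (\<phi> x) (\<pi> x) (\<alpha> x) (\<beta> x) (\<lambda>j. taut N GG j x) i + torsion (\<tau> x) (\<lambda>j. taut N GG j x) i"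
  using str unfolding structure_equations_def by blast

lemma connection_degree: "\<phi> x C [] = 0" "\<pi> x C [] = 0" "\<alpha> x C [] = 0" "\<beta> x C [] = 0"
proof -
  have "\<xi> x C [] = 0" if "\<xi> \<in> {\<phi>, \<pi>, \<alpha>, \<beta>}" for \<xi>
  proof -
    have "\<xi> \<in> degree_forms 1 (G_atlas N GG) GG"
      using str that unfolding structure_equations_def by blast
    then have "\<forall>p c ws. length ws \<noteq> 1 \<longrightarrow> \<xi> p c ws = 0"
      unfolding degree_forms_def by blast
    then show ?thesis by (metis list.size(3) zero_neq_one)
  qed
  then show "\<phi> x C [] = 0" "\<pi> x C [] = 0" "\<alpha> x C [] = 0" "\<beta> x C [] = 0" by simp_all
qed

text \<open>A constant element of the group moves a given local section through any point of the fibre.\<close>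

lemma section_through:
  assumes "(p, u) \<in> GG"
  obtains U \<sigma> k where "G_section N GG U \<sigma>" "p \<in> U" "k \<in> N" "p \<in> fst k" "u = (\<lambda>i. \<sigma> i p)"
proof -
  have p: "p \<in> points N" using assms G_str unfolding G_structure_def by force
  then obtain U \<sigma> where "p \<in> U" and cof: "coframing N U \<sigma>"
    and fib: "\<And>q. q \<in> U \<Longrightarrow> {u. (q, u) \<in> GG} = coact (\<lambda>i. \<sigma> i q) ` Ggroup"
    using G_str unfolding G_structure_def by meson
  have "(q, \<lambda>i. \<sigma> i q) \<in> GG" if "q \<in> U" for q
  proof -
    have "Gmat 1 0 0 0 \<in> Ggroup"
      unfolding Ggroup_def mem_Collect_eq by (intro exI conjI, rule refl) simp
    then have "coact (\<lambda>i. \<sigma> i q) (Gmat 1 0 0 0) \<in> coact (\<lambda>i. \<sigma> i q) ` Ggroup"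
      by (rule imageI)
    then show ?thesis using fib[OF that] by (auto simp: coact_one)
  qed
  then have sec: "G_section N GG U \<sigma>" using cof unfolding G_section_def by blast
  obtain r a b c where r: "r \<noteq> 0" and u: "u = coact (\<lambda>i. \<sigma> i p) (Gmat r a b c)"
    using assms unfolding GG_over_section[OF sec \<open>p \<in> U\<close>] by blast
  obtain k where k: "k \<in> N" "p \<in> fst k" using p unfolding points_def by blast
  show thesis
    by (rule that[OF G_section_coact[OF sec r] \<open>p \<in> U\<close> k]) (rule u)
qed

lemma section_structure_eq:
  assumes sec: "G_section N GG U \<sigma>" and k: "k \<in> N" and p: "p \<in> U" "p \<in> fst k"
    and x: "x = (p, \<lambda>i. \<sigma> i p)"
  shows "ext_d N U (\<sigma> i) p k [v, w] =
    (conn (\<phi> x) (\<pi> x) (\<alpha> x) (\<beta> x) (\<lambda>j. taut N GG j x) i + torsion (\<tau> x) (\<lambda>j. taut N GG j x) i)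
      (G_chart GG k U \<sigma>) [(v, 0), (w, 0)]"
  unfolding ext_d_taut_section[OF sec k p, symmetric] x
  using structure_eq[OF section_in_GG[OF sec p(1)]] by simp

lemma taut_section:
  assumes sec: "G_section N GG U \<sigma>" and k: "k \<in> N" and p: "p \<in> U" "p \<in> fst k"
  shows "taut N GG j (p, \<lambda>i. \<sigma> i p) (G_chart GG k U \<sigma>) Vs = \<sigma> j p k (map fst Vs)"
proof -
  have "(p, \<lambda>i. \<sigma> i p) \<in> fst (G_chart GG k U \<sigma>)"
    using section_in_GG[OF sec p(1)] p by (simp add: G_chart_def)
  from taut_apply[OF k sec this] show ?thesis by simp
qed

text \<open>
  Compare a section \<open>\<sigma>\<close> with the section \<open>\<sigma> \<cdot> g\<close> for a constant \<open>g\<close>: the differential of the latter is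
  \<open>g\<^sup>-\<^sup>1 d\<sigma>\<close>, and both differentials are given by the structure equations at the two points of the fibre.
\<close>

lemma torsion_equivariant:
  assumes u: "(p, u) \<in> GG" and r: "r \<noteq> 0"
  shows "\<tau> (p, coact u (Gmat r a b (r * s))) = (\<chi> k. torsion_action r a b s (\<tau> (p, u)) k)"
proof -
  obtain U \<sigma> k where sec: "G_section N GG U \<sigma>" and p: "p \<in> U" "p \<in> fst k" and k: "k \<in> N"
    and ue: "u = (\<lambda>i. \<sigma> i p)"
    using section_through[OF u] .
  let ?g = "Gmat r a b (r * s)"
  let ?\<sigma>' = "\<lambda>i q. coact (\<lambda>j. \<sigma> j q) ?g i"
  note cof = section_coframing[OF sec]
  have sec': "G_section N GG U ?\<sigma>'" by (rule G_section_coact[OF sec r])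
  have nil: "\<sigma> j p k [] = 0" "?\<sigma>' j p k [] = 0" for j
    using coframing_degree[OF cof] coframing_degree[OF section_coframing[OF sec']] by simp_all
  have "(\<lambda>i. ?\<sigma>' i p) = coact u ?g" by (simp add: ue)
  define x where "x = (p, \<lambda>i. \<sigma> i p)"
  define x' where "x' = (p, \<lambda>i. ?\<sigma>' i p)"
  have "\<tau> x' = (\<chi> k. torsion_action r a b s (\<tau> x) k)"
  proof (rule torsion_of_changed_frame[OF r, where e = "\<lambda>v. (v, 0)" and d = "G_chart GG k U \<sigma>"
        and d' = "G_chart GG k U ?\<sigma>'" and u = "\<lambda>j. taut N GG j x" and u' = "\<lambda>j. taut N GG j x'"
        and \<phi> = "\<phi> x" and \<pi> = "\<pi> x" and \<alpha> = "\<alpha> x" and \<beta> = "\<beta> x"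
        and \<phi>' = "\<phi> x'" and \<pi>' = "\<pi> x'" and \<alpha>' = "\<alpha> x'" and \<beta>' = "\<beta> x'"])
    show "taut N GG j x (G_chart GG k U \<sigma>) [] = 0" for j
      unfolding x_def taut_section[OF sec k p] by (simp add: nil)
    show "taut N GG j x' (G_chart GG k U ?\<sigma>') [] = 0" for j
      unfolding x'_def taut_section[OF sec' k p] using nil(2) by simp
    show "taut N GG i x' (G_chart GG k U ?\<sigma>') [(v, 0)] =
        (\<Sum>j\<in>UNIV. matrix_inv ?g $ i $ j * taut N GG j x (G_chart GG k U \<sigma>) [(v, 0)])" for i v
      unfolding x_def x'_def taut_section[OF sec k p] taut_section[OF sec' k p]
      by (simp add: coact_def sum_alt_form_apply scale_def)
    show "\<exists>v. \<forall>j. taut N GG j x (G_chart GG k U \<sigma>) [(v, 0)] = X j" for X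
      unfolding x_def taut_section[OF sec k p]
      using coframing_components_surj[OF cof p(1) k p(2), of X] by auto
    show "(conn (\<phi> x') (\<pi> x') (\<alpha> x') (\<beta> x') (\<lambda>j. taut N GG j x') i + torsion (\<tau> x') (\<lambda>j. taut N GG j x') i)
        (G_chart GG k U ?\<sigma>') [(v, 0), (w, 0)] =
      (\<Sum>j\<in>UNIV. matrix_inv ?g $ i $ j * (conn (\<phi> x) (\<pi> x) (\<alpha> x) (\<beta> x) (\<lambda>j. taut N GG j x) j
        + torsion (\<tau> x) (\<lambda>j. taut N GG j x) j) (G_chart GG k U \<sigma>) [(v, 0), (w, 0)])" for i v w
      unfolding section_structure_eq[OF sec k p x_def, symmetric]
        section_structure_eq[OF sec' k p x'_def, symmetric]
      by (rule ext_d_coact[OF sec k p])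
  qed (rule connection_degree)+
  then show ?thesis unfolding x_def x'_def ue .
qed

lemma orbit_eq:
  assumes "(p, u) \<in> GG"
  shows "orbit GG \<tau> p = {\<chi> k. torsion_action r a b s (\<tau> (p, u)) k | r a b s. r \<noteq> 0}"
proof (rule set_eqI)
  fix t
  have "t \<in> orbit GG \<tau> p \<longleftrightarrow> (\<exists>v. (p, v) \<in> GG \<and> t = \<tau> (p, v))"
    unfolding orbit_def by (auto simp: image_iff)
  also have "\<dots> \<longleftrightarrow> (\<exists>r a b c. r \<noteq> 0 \<and> t = \<tau> (p, coact u (Gmat r a b c)))"
    unfolding fibre_is_orbit[OF assms] by blast
  also have "\<dots> \<longleftrightarrow> (\<exists>r a b s. r \<noteq> 0 \<and> t = \<tau> (p, coact u (Gmat r a b (r * s))))"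
  proof
    assume "\<exists>r a b c. r \<noteq> 0 \<and> t = \<tau> (p, coact u (Gmat r a b c))"
    then obtain r a b c where "r \<noteq> 0" "t = \<tau> (p, coact u (Gmat r a b (r * (c / r))))" by auto
    then show "\<exists>r a b s. r \<noteq> 0 \<and> t = \<tau> (p, coact u (Gmat r a b (r * s)))" by blast
  qed blast
  also have "\<dots> \<longleftrightarrow> (\<exists>r a b s. r \<noteq> 0 \<and> t = (\<chi> k. torsion_action r a b s (\<tau> (p, u)) k))"
    by (intro ex_cong1 conj_cong refl) (simp add: torsion_equivariant[OF assms])
  finally show "t \<in> orbit GG \<tau> p \<longleftrightarrow> t \<in> {\<chi> k. torsion_action r a b s (\<tau> (p, u)) k | r a b s. r \<noteq> 0}"
    by blast
qed

end


section \<open>Immersed submanifolds of small dimension\<close>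

text \<open>
  By second countability an immersed submanifold is a countable union of differentiable images of open
  subsets of \<open>'e\<close>, and such images in a space of larger dimension are null sets.
\<close>

lemma negligible_immersed_image:
  fixes A :: "('b::euclidean_space, 'e::euclidean_space) chart set" and F :: "'b \<Rightarrow> 'd::euclidean_space"
  assumes A: "immersed_submanifold A S" and F: "bounded_linear F" and dim: "DIM('e) < DIM('d)"
  shows "negligible (F ` S)"
proof -
  have man: "smooth_manifold A" and pts: "points A = S"
    using A unfolding immersed_submanifold_def by blast+
  have chart: "negligible (F ` fst c)" if c: "c \<in> A" for c
  proof -
    have inv: "chart_inv c (snd c p) = p" if "p \<in> fst c" for p
      using chart_inv_simp[OF smooth_manifold_inj[OF man c] that] .
    have "(\<lambda>x. F (chart_inv c x)) differentiable (at x)" if "x \<in> snd c ` fst c" for x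
    proof -
      have "chart_inv c differentiable (at x)"
        using A c that smooth_on_imp_differentiable unfolding immersed_submanifold_def by blast
      then obtain D where "(chart_inv c has_derivative D) (at x)" unfolding differentiable_def by blast
      from bounded_linear.has_derivative[OF F this] show ?thesis unfolding differentiable_def by blast
    qed
    then have "(\<lambda>x. F (chart_inv c x)) differentiable_on (snd c ` fst c)"
      unfolding differentiable_on_def using differentiable_at_withinI by blast
    then have "negligible ((\<lambda>x. F (chart_inv c x)) ` snd c ` fst c)"
      by (rule negligible_differentiable_image_lowdim[OF dim])
    moreover have "(\<lambda>x. F (chart_inv c x)) ` snd c ` fst c = F ` fst c"
      unfolding image_image by (rule image_cong) (simp_all add: inv)
    ultimately show ?thesis by simp
  qed
  obtain \<B> where \<B>: "countable \<B>" "\<And>U x. openin (mtop A) U \<Longrightarrow> x \<in> U \<Longrightarrow> \<exists>V\<in>\<B>. x \<in> V \<and> V \<subseteq> U"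
    using man unfolding smooth_manifold_def second_countable_def by auto
  define \<C> where "\<C> = {V \<in> \<B>. \<exists>c\<in>A. V \<subseteq> fst c}"
  have "countable \<C>" unfolding \<C>_def using \<B>(1) by (rule countable_subset[rotated]) blast
  have opn: "openin (mtop A) (fst c)" if "c \<in> A" for c
  proof -
    have "open (snd c' ` (fst c \<inter> fst c'))" if "c' \<in> A" for c'
      using man \<open>c \<in> A\<close> that unfolding smooth_manifold_def by (metis Int_commute)
    then show ?thesis
      using openin_mtop[OF smooth_manifold_inj[OF man]] that unfolding points_def by blast
  qed
  have "S = \<Union>\<C>"
  proof
    show "S \<subseteq> \<Union>\<C>"
    proof
      fix x assume "x \<in> S"
      then obtain c where c: "c \<in> A" "x \<in> fst c" using pts unfolding points_def by blast
      then obtain V where "V \<in> \<B>" "x \<in> V" "V \<subseteq> fst c" using \<B>(2)[OF opn[OF c(1)]] by blast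
      then show "x \<in> \<Union>\<C>" using c(1) unfolding \<C>_def by blast
    qed
    show "\<Union>\<C> \<subseteq> S" using pts unfolding \<C>_def points_def by blast
  qed
  then have "F ` S = \<Union>((`) F ` \<C>)" by blast
  moreover have "negligible (\<Union>((`) F ` \<C>))"
  proof (rule negligible_countable_Union)
    show "countable ((`) F ` \<C>)" using \<open>countable \<C>\<close> by (rule countable_image)
    fix W assume "W \<in> (`) F ` \<C>"
    then obtain V c where "W = F ` V" "c \<in> A" "V \<subseteq> fst c" unfolding \<C>_def by blast
    then show "negligible W" using negligible_subset[OF chart image_mono] by blast
  qed
  ultimately show ?thesis by simp
qed

text \<open>
  The projection of \<open>S\<close> to the three coordinates contains a nonempty open set, while that of an immersed
  submanifold of dimension at most two is a null set.
\<close>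

lemma not_dim_at_most_2:
  fixes S :: "(real ^ 'n) set"
  assumes "m \<noteq> 0"
    and onto: "\<And>y1 y2 y3. y2 * m > 0 \<Longrightarrow> \<exists>t\<in>S. t $ k1 = y1 \<and> t $ k2 = y2 \<and> t $ k3 = y3"
  shows "\<not> dim_at_most_2 S"
proof
  let ?F = "\<lambda>t :: real ^ 'n. (t $ k1, t $ k2, t $ k3)"
  have F: "bounded_linear ?F"
    by (intro bounded_linear_Pair bounded_linear_vec_nth)
  assume "dim_at_most_2 S"
  then have neg: "negligible (?F ` S)"
    unfolding dim_at_most_2_def
  proof (elim disjE exE)
    assume "countable S"
    then have "negligible (\<Union>((\<lambda>t. {?F t}) ` S))"
      by (intro negligible_countable_Union) auto
    moreover have "\<Union>((\<lambda>t. {?F t}) ` S) = ?F ` S" by blast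
    ultimately show ?thesis by simp
  next
    fix A :: "(real ^ 'n, real) chart set" assume "immersed_submanifold A S"
    then show ?thesis by (rule negligible_immersed_image[OF _ F]) simp
  next
    fix A :: "(real ^ 'n, real ^ 2) chart set" assume "immersed_submanifold A S"
    then show ?thesis by (rule negligible_immersed_image[OF _ F]) simp
  qed
  let ?O = "UNIV \<times> {y. y * m > 0} \<times> (UNIV :: real set) :: (real \<times> real \<times> real) set"
  have "?O \<subseteq> ?F ` S"
  proof
    fix y assume "y \<in> ?O"
    then obtain y1 y2 y3 where y: "y = (y1, y2, y3)" "y2 * m > 0" by (cases y) auto
    then show "y \<in> ?F ` S" using onto[OF y(2), of y1 y3] by (auto simp: image_iff)
  qed
  then have "negligible ?O" using neg negligible_subset by blast
  moreover have "open ?O"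
    by (intro open_Times open_UNIV open_Collect_less continuous_intros)
  moreover have "(0, m, 0) \<in> ?O" using \<open>m \<noteq> 0\<close> by (simp add: zero_less_mult_iff) linarith
  ultimately show False using open_not_negligible by blast
qed

text \<open>
  The inverse of \<open>\<psi>\<close> is a global chart. It identifies the topology of the image with that of \<open>D\<close>, which
  gives the Hausdorff property and second countability.
\<close>

lemma immersed_submanifold_image:
  fixes \<psi> :: "'e::euclidean_space \<Rightarrow> 'b::euclidean_space"
  assumes D: "open D" and inj: "inj_on \<psi> D" and smooth: "smooth_on D \<psi>"
    and imm: "\<And>x. x \<in> D \<Longrightarrow> inj (frechet_derivative \<psi> (at x))"
  shows "\<exists>A :: ('b, 'e) chart set. immersed_submanifold A (\<psi> ` D)"
proof -
  define h where "h = inv_into D \<psi>"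
  define c where "c = (\<psi> ` D, h)"
  have h: "h (\<psi> x) = x" if "x \<in> D" for x
    unfolding h_def using inj that by simp
  have fc: "fst c = \<psi> ` D" "snd c = h" unfolding c_def by simp_all
  have img: "snd c ` fst c = D"
    unfolding fc image_image by (rule trans[OF image_cong[OF refl h]]) auto
  have injc: "inj_on (snd c) (fst c)"
    unfolding fc by (rule inj_onI) (use h in auto)
  have inv: "chart_inv c x = \<psi> x" if "x \<in> D" for x
    using chart_inv_simp[OF injc, of "\<psi> x"] that unfolding fc by (simp add: h)
  have openin: "openin (mtop {c}) W \<longleftrightarrow> W \<subseteq> \<psi> ` D \<and> open (h ` W)" for W
  proof -
    have "openin (mtop {c}) W \<longleftrightarrow> W \<subseteq> points {c} \<and> (\<forall>c'\<in>{c}. open (snd c' ` (W \<inter> fst c')))"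
      by (rule openin_mtop) (simp add: injc)
    also have "\<dots> \<longleftrightarrow> W \<subseteq> \<psi> ` D \<and> open (h ` (W \<inter> \<psi> ` D))" by (simp add: points_def fc)
    also have "\<dots> \<longleftrightarrow> W \<subseteq> \<psi> ` D \<and> open (h ` W)" by (metis Int_absorb2)
    finally show ?thesis .
  qed
  have himg: "h ` \<psi> ` (U \<inter> D) = U \<inter> D" for U
    unfolding image_image by (rule trans[OF image_cong[OF refl h]]) auto
  have openin_img: "openin (mtop {c}) (\<psi> ` (U \<inter> D))" if "open U" for U
    unfolding openin himg using D that by auto
  have "Hausdorff_space (mtop {c})"
    unfolding Hausdorff_space_def
  proof (intro allI impI, elim conjE)
    fix x y assume xy: "x \<in> topspace (mtop {c})" "y \<in> topspace (mtop {c})" "x \<noteq> y"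
    have "topspace (mtop {c}) \<subseteq> \<psi> ` D" using openin openin_topspace by blast
    then obtain a b where ab: "a \<in> D" "x = \<psi> a" "b \<in> D" "y = \<psi> b" using xy by blast
    then obtain U V where UV: "open U" "open V" "a \<in> U" "b \<in> V" "U \<inter> V = {}"
      using xy(3) separation_t2[of a b] by auto
    have "disjnt (\<psi> ` (U \<inter> D)) (\<psi> ` (V \<inter> D))"
      unfolding disjnt_def using inj UV(5) by (auto simp: inj_on_def)
    then show "\<exists>U V. openin (mtop {c}) U \<and> openin (mtop {c}) V \<and> x \<in> U \<and> y \<in> V \<and> disjnt U V"
      using openin_img UV ab by blast
  qed
  moreover have "second_countable (mtop {c})"
  proof -
    obtain B :: "'e set set" where B: "countable B" "topological_basis B" using ex_countable_basis by blast
    have "\<exists>V\<in>(\<lambda>b. \<psi> ` (b \<inter> D)) ` B. x \<in> V \<and> V \<subseteq> U" if U: "openin (mtop {c}) U" "x \<in> U" for U x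
    proof -
      have UD: "U \<subseteq> \<psi> ` D" "open (h ` U)" using U(1) unfolding openin by blast+
      have "h x \<in> h ` U" using U(2) by blast
      then obtain b where b: "b \<in> B" "h x \<in> b" "b \<subseteq> h ` U" using topological_basisE[OF B(2) UD(2)] by blast
      obtain a where a: "a \<in> D" "x = \<psi> a" using UD U(2) by blast
      have "x \<in> \<psi> ` (b \<inter> D)" using b(2) a h[OF a(1)] by auto
      moreover have "\<psi> ` (b \<inter> D) \<subseteq> U"
      proof
        fix y assume "y \<in> \<psi> ` (b \<inter> D)"
        then obtain z where z: "z \<in> b" "z \<in> D" "y = \<psi> z" by blast
        then obtain w where w: "w \<in> U" "z = h w" using b(3) by blast
        then obtain v where "v \<in> D" "w = \<psi> v" using UD by blast
        then show "y \<in> U" using w z h by auto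
      qed
      ultimately show ?thesis using b(1) by blast
    qed
    moreover have "\<forall>V\<in>(\<lambda>b. \<psi> ` (b \<inter> D)) ` B. openin (mtop {c}) V"
      using openin_img topological_basis_open[OF B(2)] by blast
    moreover have "countable ((\<lambda>b. \<psi> ` (b \<inter> D)) ` B)" using B(1) by blast
    ultimately show ?thesis unfolding second_countable_def by blast
  qed
  moreover have "smooth_on D (\<lambda>x. snd c (chart_inv c x))"
    by (rule smooth_on_cong[OF D _ smooth_on_ident]) (simp add: inv fc h)
  ultimately have "smooth_manifold {c}"
    unfolding smooth_manifold_def using injc img D by simp
  moreover have "smooth_on (snd c ` fst c) (chart_inv c)"
    unfolding img by (rule smooth_on_cong[OF D _ smooth]) (simp add: inv)
  moreover have "inj (frechet_derivative (chart_inv c) (at x))" if "x \<in> snd c ` fst c" for x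
  proof -
    have x: "x \<in> D" using that unfolding img .
    have "frechet_derivative \<psi> (at x) = frechet_derivative (chart_inv c) (at x)"
      by (rule frechet_derivative_transform_within_open[OF smooth_on_imp_differentiable[OF smooth x] D x])
        (simp add: inv)
    then show ?thesis using imm[OF x] by simp
  qed
  ultimately have "immersed_submanifold {c} (\<psi> ` D)"
    unfolding immersed_submanifold_def by (simp add: points_def fc)
  then show ?thesis by blast
qed


lemma dim_at_most_2_curve:
  fixes base \<beta> :: "real ^ 'n"
  assumes "\<beta> \<noteq> 0"
  shows "dim_at_most_2 (range (\<lambda>s. base + s *\<^sub>R \<beta>))"
proof -
  let ?\<psi> = "\<lambda>s. base + s *\<^sub>R \<beta>"
  have "(?\<psi> has_derivative (\<lambda>h. h *\<^sub>R \<beta>)) (at s)" for s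
    by (auto intro!: derivative_eq_intros)
  then have "frechet_derivative ?\<psi> (at s) = (\<lambda>h. h *\<^sub>R \<beta>)" for s
    using frechet_derivative_at by metis
  then have "inj (frechet_derivative ?\<psi> (at s))" for s
    using assms by (simp add: inj_def)
  moreover have "inj ?\<psi>" using assms by (simp add: inj_def)
  moreover have "smooth_on UNIV ?\<psi>"
    by (intro smooth_on_add smooth_on_const smooth_on_scaleR smooth_on_ident open_UNIV)
  ultimately have "\<exists>A :: (real ^ 'n, real) chart set. immersed_submanifold A (range ?\<psi>)"
    by (intro immersed_submanifold_image open_UNIV)
  then show ?thesis unfolding dim_at_most_2_def by blast
qed

text \<open>
  The coordinate \<open>k\<close> recovers \<open>s\<close>, and since the vector multiplied by \<open>r\<close> is never zero, \<open>r\<close> is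
  recovered as well; the same argument, applied to the differential, shows that the parametrization is
  an immersion. The two signs of \<open>r\<close> give a parameter domain that is not connected.
\<close>

lemma dim_at_most_2_surface:
  fixes base \<beta> v0 v1 v2 :: "real ^ 'n" and k :: 'n
  assumes \<beta>: "\<beta> $ k \<noteq> 0" and v: "v0 $ k = 0" "v1 $ k = 0" "v2 $ k = 0"
    and nz: "\<And>s. v0 + s *\<^sub>R v1 + (s * s) *\<^sub>R v2 \<noteq> 0"
  shows "dim_at_most_2 {base + s *\<^sub>R \<beta> + r *\<^sub>R (v0 + s *\<^sub>R v1 + (s * s) *\<^sub>R v2) | r s. r \<noteq> 0}"
    (is "dim_at_most_2 ?S")
proof -
  let ?f = "\<lambda>s :: real. v0 + s *\<^sub>R v1 + (s * s) *\<^sub>R v2"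
  let ?\<psi> = "\<lambda>y :: real ^ 2. base + y $ 2 *\<^sub>R \<beta> + y $ 1 *\<^sub>R (v0 + y $ 2 *\<^sub>R v1 + (y $ 2 * y $ 2) *\<^sub>R v2)"
  let ?D = "{y :: real ^ 2. y $ 1 \<noteq> 0}"
  have D: "open ?D" by (intro open_Collect_neq continuous_intros)
  have S: "?S = ?\<psi> ` ?D"
  proof
    show "?\<psi> ` ?D \<subseteq> ?S" by blast
    show "?S \<subseteq> ?\<psi> ` ?D"
    proof
      fix t assume "t \<in> ?S"
      then obtain r s where "r \<noteq> 0" "t = base + s *\<^sub>R \<beta> + r *\<^sub>R ?f s" by blast
      then have "t = ?\<psi> (vector [r, s])" "(vector [r, s] :: real ^ 2) \<in> ?D" by simp_all
      then show "t \<in> ?\<psi> ` ?D" by (rule image_eqI)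
    qed
  qed
  have "inj_on ?\<psi> ?D"
  proof (rule inj_onI)
    fix y z assume yz: "y \<in> ?D" "z \<in> ?D" "?\<psi> y = ?\<psi> z"
    have "?\<psi> y $ k = ?\<psi> z $ k" by (rule arg_cong[OF yz(3), of "\<lambda>v. v $ k"])
    then have 2: "y $ 2 = z $ 2" using \<beta> v by simp
    then have "y $ 1 *\<^sub>R ?f (z $ 2) = z $ 1 *\<^sub>R ?f (z $ 2)" using yz(3) by simp
    then have "y $ 1 = z $ 1" using nz by simp
    then show "y = z" using 2 by (simp add: vec_eq_iff forall_2)
  qed
  moreover have "smooth_on ?D ?\<psi>"
    by (intro smooth_on_add[OF D] smooth_on_scaleR[OF D] smooth_on_mult[OF D] smooth_on_const
        smooth_on_linear[OF bounded_linear_vec_nth D])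
  moreover have "inj (frechet_derivative ?\<psi> (at y))" if y: "y \<in> ?D" for y
  proof -
    let ?T = "\<lambda>h :: real ^ 2. h $ 2 *\<^sub>R \<beta> + (y $ 1 *\<^sub>R (h $ 2 *\<^sub>R v1 + (y $ 2 * h $ 2 + h $ 2 * y $ 2) *\<^sub>R v2)
      + h $ 1 *\<^sub>R ?f (y $ 2))"
    have c: "((\<lambda>y :: real ^ 2. y $ i) has_derivative (\<lambda>h. h $ i)) (at y)" for i
      by (rule bounded_linear_imp_has_derivative[OF bounded_linear_vec_nth])
    have T: "(?\<psi> has_derivative ?T) (at y)"
      by (rule derivative_eq_intros c refl | simp)+
    have "h = 0" if h: "?T h = 0" for h
    proof -
      have "?T h $ k = 0" using arg_cong[OF h, of "\<lambda>v. v $ k"] by simp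
      then have 2: "h $ 2 = 0" using \<beta> v by simp
      then have "h $ 1 = 0" using h nz by simp
      then show ?thesis using 2 by (simp add: vec_eq_iff forall_2)
    qed
    then have "inj ?T"
      by (intro linear_injective_0[OF has_derivative_linear[OF T], THEN iffD2]) blast
    then show ?thesis using frechet_derivative_at[OF T] by simp
  qed
  ultimately have "\<exists>A :: (real ^ 'n, real ^ 2) chart set. immersed_submanifold A (?\<psi> ` ?D)"
    by (intro immersed_submanifold_image D)
  then show ?thesis unfolding dim_at_most_2_def S by blast
qed

section \<open>The dimension of the orbits\<close>

text \<open>
  The functions that have to vanish are the coefficients of those terms of \<open>d\<omega>\<^sup>1\<close>, respectively
  \<open>d\<omega>\<^sup>3\<close>, that do not contain \<open>\<omega>\<^sup>1\<close>, respectively \<open>\<omega>\<^sup>3\<close>.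
\<close>

definition integrable_1 :: "real ^ tors \<Rightarrow> bool" where
  "integrable_1 t \<longleftrightarrow> t$P2 = 0 \<and> t$R12 = 0 \<and> t$T10 = 0 \<and> t$T12 = 0 \<and> t$T12b = 0"

definition integrable_3 :: "real ^ tors \<Rightarrow> bool" where
  "integrable_3 t \<longleftrightarrow> t$P4 = 0 \<and> t$R34 = 0 \<and> t$T30 = 0 \<and> t$T34 = 0 \<and> t$T34b = 0"

definition torsion_orbit :: "real ^ tors \<Rightarrow> (real ^ tors) set" where
  "torsion_orbit t = {\<chi> k. torsion_action r a b s t k | r a b s. r \<noteq> 0}"

lemma not_dim_at_most_2_orbit:
  assumes "m \<noteq> 0"
    and "\<And>y1 y2 y3. y2 * m > 0 \<Longrightarrow> \<exists>r a b s. r \<noteq> 0 \<and> torsion_action r a b s t k1 = y1 \<and>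
      torsion_action r a b s t k2 = y2 \<and> torsion_action r a b s t k3 = y3"
  shows "\<not> dim_at_most_2 (torsion_orbit t)"
proof (rule not_dim_at_most_2[OF assms(1)])
  fix y1 y2 y3 :: real assume "y2 * m > 0"
  from assms(2)[OF this, of y1 y3] obtain r a b s where
    r: "r \<noteq> 0" "torsion_action r a b s t k1 = y1" "torsion_action r a b s t k2 = y2" "torsion_action r a b s t k3 = y3"
    by blast
  then show "\<exists>t\<in>torsion_orbit t. t $ k1 = y1 \<and> t $ k2 = y2 \<and> t $ k3 = y3"
    unfolding torsion_orbit_def by (intro bexI[of _ "\<chi> k. torsion_action r a b s t k"]) auto
qed

text \<open>
  The ten functions are eliminated one after the other. Once those before it are known to vanish, a
  nonzero one is scaled by a power of \<open>r\<close>, and up to a factor it is the slope with which \<open>a\<close> or \<open>b\<close> acts on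
  another torsion function. Since \<open>s\<close> moves \<open>P1\<close> and \<open>P3\<close>, three coordinates of the orbit can then be
  varied independently.
\<close>

lemma orbit_dim_imp_integrable:
  assumes dim: "dim_at_most_2 (torsion_orbit t)"
  shows "integrable_1 t \<and> integrable_3 t"
proof -
  note simps = torsion_action_def
  have root: "\<exists>r. r \<noteq> 0 \<and> r\<^sup>2 * m = y" if "y * m > 0" for y m :: real
  proof (intro exI conjI)
    have "y / m > 0" using that by (auto simp: zero_less_mult_iff zero_less_divide_iff)
    then show "sqrt (y / m) \<noteq> 0" "(sqrt (y / m))\<^sup>2 * m = y" using that by auto
  qed
  have P2: "t $ P2 = 0"
  proof (rule ccontr)
    assume nz: "t $ P2 \<noteq> 0"
    have "\<not> dim_at_most_2 (torsion_orbit t)"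
    proof (rule not_dim_at_most_2_orbit[OF nz, of t P1 P2 P3])
      fix y1 y2 y3 assume y: "y2 * t $ P2 > 0"
      let ?s = "(y3 - t $ P3) / 2"
      let ?r = "y2 / t $ P2" and ?a = "(y1 - t $ P1 + 2 * ?s) / t $ P2"
      have "?r \<noteq> 0" "torsion_action ?r ?a 0 ?s t P1 = y1" "torsion_action ?r ?a 0 ?s t P2 = y2"
        "torsion_action ?r ?a 0 ?s t P3 = y3"
        using y nz by (auto simp: simps diff_divide_distrib)
      then show "\<exists>r a b s. r \<noteq> 0 \<and> torsion_action r a b s t P1 = y1 \<and>
          torsion_action r a b s t P2 = y2 \<and> torsion_action r a b s t P3 = y3" by blast
    qed
    then show False using dim by blast
  qed
  have P4: "t $ P4 = 0"
  proof (rule ccontr)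
    assume nz: "t $ P4 \<noteq> 0"
    have "\<not> dim_at_most_2 (torsion_orbit t)"
    proof (rule not_dim_at_most_2_orbit[OF nz, of t P3 P4 P1])
      fix y1 y2 y3 assume y: "y2 * t $ P4 > 0"
      let ?s = "(t $ P1 - y3) / 2"
      let ?r = "y2 / t $ P4" and ?b = "(y1 - t $ P3 - 2 * ?s) / t $ P4"
      have "?r \<noteq> 0" "torsion_action ?r 0 ?b ?s t P3 = y1" "torsion_action ?r 0 ?b ?s t P4 = y2"
        "torsion_action ?r 0 ?b ?s t P1 = y3"
        using y nz P2 by (auto simp: simps field_simps)
      then show "\<exists>r a b s. r \<noteq> 0 \<and> torsion_action r a b s t P3 = y1 \<and>
          torsion_action r a b s t P4 = y2 \<and> torsion_action r a b s t P1 = y3" by blast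
    qed
    then show False using dim by blast
  qed
  \<comment> \<open>Now the value of \<open>P1\<close> determines \<open>s\<close>. If \<open>k2\<close> is multiplied by \<open>r\<^sup>2\<close> and, unless it vanishes, the
    parameters \<open>a\<close> and \<open>b\<close> can be used to give \<open>k1\<close> any value, the orbit is at least three-dimensional.\<close>
  have general: "t $ k2 = 0"
    if quad: "\<And>r a b s. torsion_action r a b s t k2 = r\<^sup>2 * t $ k2"
      and onto: "\<And>r s y. r \<noteq> 0 \<Longrightarrow> t $ k2 \<noteq> 0 \<Longrightarrow> \<exists>a b. torsion_action r a b s t k1 = y" for k1 k2
  proof (rule ccontr)
    assume nz: "t $ k2 \<noteq> 0"
    have "\<not> dim_at_most_2 (torsion_orbit t)"
    proof (rule not_dim_at_most_2_orbit[OF nz, of t k1 k2 P1])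
      fix y1 y2 y3 assume "y2 * t $ k2 > 0"
      then obtain r where r: "r \<noteq> 0" "r\<^sup>2 * t $ k2 = y2" using root by blast
      let ?s = "(t $ P1 - y3) / 2"
      obtain a b where "torsion_action r a b ?s t k1 = y1" using onto[OF r(1) nz] by blast
      moreover have "torsion_action r a b ?s t P1 = y3" using P2 by (simp add: simps field_simps)
      ultimately show "\<exists>r a b s. r \<noteq> 0 \<and> torsion_action r a b s t k1 = y1 \<and>
          torsion_action r a b s t k2 = y2 \<and> torsion_action r a b s t P1 = y3"
        using r quad by metis
    qed
    then show False using dim by blast
  qed
  have R12: "t $ R12 = 0"
  proof (rule general[where ?k1.0 = R11])
    fix r s y :: real assume "r \<noteq> 0" "t $ R12 \<noteq> 0"
    then have "torsion_action r ((y / r - t $ R11) / t $ R12) 0 s t R11 = y" by (simp add: simps)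
    then show "\<exists>a b. torsion_action r a b s t R11 = y" by blast
  qed (simp add: simps)
  have R34: "t $ R34 = 0"
  proof (rule general[where ?k1.0 = R33])
    fix r s y :: real assume "r \<noteq> 0" "t $ R34 \<noteq> 0"
    then have "torsion_action r 0 ((y / r - t $ R33) / t $ R34) s t R33 = y" by (simp add: simps)
    then show "\<exists>a b. torsion_action r a b s t R33 = y" by blast
  qed (simp add: simps)
  have T12: "t $ T12 = 0"
  proof (rule general[where ?k1.0 = T11])
    fix r s y :: real assume "r \<noteq> 0" "t $ T12 \<noteq> 0"
    then have "torsion_action r ((y / r - t $ T11 - s * t $ R11) / t $ T12) 0 s t T11 = y"
      using P2 R12 by (simp add: simps)
    then show "\<exists>a b. torsion_action r a b s t T11 = y" by blast
  qed (simp add: simps R12)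
  have T12b: "t $ T12b = 0"
  proof (rule general[where ?k1.0 = T11b])
    fix r s y :: real assume "r \<noteq> 0" "t $ T12b \<noteq> 0"
    then have "torsion_action r ((y / r - t $ T11b + s * t $ R11) / t $ T12b) 0 s t T11b = y"
      using P4 R12 by (simp add: simps)
    then show "\<exists>a b. torsion_action r a b s t T11b = y" by blast
  qed (simp add: simps R12)
  have T34: "t $ T34 = 0"
  proof (rule general[where ?k1.0 = T33])
    fix r s y :: real assume "r \<noteq> 0" "t $ T34 \<noteq> 0"
    then have "torsion_action r 0 ((y / r - t $ T33 - s * t $ R33) / t $ T34) s t T33 = y"
      using P2 R34 by (simp add: simps)
    then show "\<exists>a b. torsion_action r a b s t T33 = y" by blast
  qed (simp add: simps R34)
  have T34b: "t $ T34b = 0"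
  proof (rule general[where ?k1.0 = T33b])
    fix r s y :: real assume "r \<noteq> 0" "t $ T34b \<noteq> 0"
    then have "torsion_action r 0 ((y / r - t $ T33b + s * t $ R33) / t $ T34b) s t T33b = y"
      using P4 R34 by (simp add: simps)
    then show "\<exists>a b. torsion_action r a b s t T33b = y" by blast
  qed (simp add: simps R34)
  define X where "X s = t$T20 + s / 2 * (t$T11 - t$T11b - t$T33 + t$T33b) + s\<^sup>2 / 2 * (t$R11 - t$R33)" for s
  have T20: "torsion_action r a b s t T20 = r * (X s - a * t $ T10 / 2 + b * t $ T30 / 2)" for r a b s
    by (simp add: simps X_def R12 R34 T12 T12b T34 T34b)
  have T10: "t $ T10 = 0"
  proof (rule general[where ?k1.0 = T20])
    fix r s y :: real assume "r \<noteq> 0" "t $ T10 \<noteq> 0"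
    then have "torsion_action r (2 * (X s - y / r) / t $ T10) 0 s t T20 = y"
      unfolding T20 by (simp add: field_simps)
    then show "\<exists>a b. torsion_action r a b s t T20 = y" by blast
  qed (simp add: simps R12 T12 T12b)
  have T30: "t $ T30 = 0"
  proof (rule general[where ?k1.0 = T20])
    fix r s y :: real assume "r \<noteq> 0" "t $ T30 \<noteq> 0"
    then have "torsion_action r 0 (2 * (y / r - X s) / t $ T30) s t T20 = y"
      unfolding T20 by (simp add: field_simps)
    then show "\<exists>a b. torsion_action r a b s t T20 = y" by blast
  qed (simp add: simps R34 T34 T34b)
  show ?thesis unfolding integrable_1_def integrable_3_def
    using P2 P4 R12 R34 T12 T12b T34 T34b T10 T30 by blast
qed

text \<open>
  If \<open>\<omega>\<^sup>1\<close> and \<open>\<omega>\<^sup>3\<close> are integrable, \<open>a\<close> and \<open>b\<close> act trivially, and the orbit is parametrized by \<open>r\<close> and \<open>s\<close>.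
  It is a curve if all the torsion functions on which \<open>r\<close> acts vanish, and a surface otherwise.
\<close>

lemma integrable_imp_orbit_dim:
  assumes "integrable_1 t" "integrable_3 t"
  shows "dim_at_most_2 (torsion_orbit t)"
proof -
  define base :: "real ^ tors" where
    "base = (\<chi> k. case k of C1 \<Rightarrow> t$C1 | P1 \<Rightarrow> t$P1 | P3 \<Rightarrow> t$P3 | _ \<Rightarrow> 0)"
  define \<beta> :: "real ^ tors" where "\<beta> = (\<chi> k. case k of P1 \<Rightarrow> - 2 | P3 \<Rightarrow> 2 | _ \<Rightarrow> 0)"
  define v0 :: "real ^ tors" where
    "v0 = (\<chi> k. case k of R11 \<Rightarrow> t$R11 | R33 \<Rightarrow> t$R33 | T11 \<Rightarrow> t$T11 | T11b \<Rightarrow> t$T11b | T33 \<Rightarrow> t$T33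
      | T33b \<Rightarrow> t$T33b | T20 \<Rightarrow> t$T20 | _ \<Rightarrow> 0)"
  define v1 :: "real ^ tors" where
    "v1 = (\<chi> k. case k of T11 \<Rightarrow> t$R11 | T11b \<Rightarrow> - t$R11 | T33 \<Rightarrow> t$R33 | T33b \<Rightarrow> - t$R33
      | T20 \<Rightarrow> (t$T11 - t$T11b - t$T33 + t$T33b) / 2 | _ \<Rightarrow> 0)"
  define v2 :: "real ^ tors" where "v2 = (\<chi> k. case k of T20 \<Rightarrow> (t$R11 - t$R33) / 2 | _ \<Rightarrow> 0)"
  have act: "(\<chi> k. torsion_action r a b s t k) =
      base + s *\<^sub>R \<beta> + r *\<^sub>R (v0 + s *\<^sub>R v1 + (s * s) *\<^sub>R v2)" for r a b s
  proof (rule vec_eq_iff[THEN iffD2], rule allI)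
    fix k
    show "(\<chi> k. torsion_action r a b s t k) $ k =
        (base + s *\<^sub>R \<beta> + r *\<^sub>R (v0 + s *\<^sub>R v1 + (s * s) *\<^sub>R v2)) $ k"
      using assms unfolding integrable_1_def integrable_3_def
      by (cases k) (simp_all add: torsion_action_def base_def \<beta>_def v0_def v1_def v2_def power2_eq_square)
  qed
  have orb: "torsion_orbit t = {base + s *\<^sub>R \<beta> + r *\<^sub>R (v0 + s *\<^sub>R v1 + (s * s) *\<^sub>R v2) | r s. r \<noteq> 0}"
    unfolding torsion_orbit_def act by blast
  have \<beta>: "\<beta> $ P1 \<noteq> 0" by (simp add: \<beta>_def)
  show ?thesis
  proof (cases "\<exists>s. v0 + s *\<^sub>R v1 + (s * s) *\<^sub>R v2 = 0")
    case True
    then obtain s where s: "v0 + s *\<^sub>R v1 + (s * s) *\<^sub>R v2 = 0" by blast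
    have e: "v0 $ k + s * v1 $ k + s * s * v2 $ k = 0" for k
      using arg_cong[OF s, of "\<lambda>v. v $ k"] by simp
    have 1: "t $ R11 = 0" "t $ R33 = 0"
      using e[of R11] e[of R33] by (simp_all add: v0_def v1_def v2_def)
    have 2: "t $ T11 = 0" "t $ T11b = 0" "t $ T33 = 0" "t $ T33b = 0"
      using e[of T11] e[of T11b] e[of T33] e[of T33b] 1 by (simp_all add: v0_def v1_def v2_def)
    have 3: "t $ T20 = 0"
      using e[of T20] 1 2 by (simp add: v0_def v1_def v2_def)
    have "v0 $ k = 0 \<and> v1 $ k = 0 \<and> v2 $ k = 0" for k
      using 1 2 3 by (cases k) (simp_all add: v0_def v1_def v2_def)
    then have z: "v0 = 0" "v1 = 0" "v2 = 0" by (simp_all add: vec_eq_iff)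
    have "torsion_orbit t = range (\<lambda>s. base + s *\<^sub>R \<beta>)"
      unfolding orb z using zero_neq_one[where 'a = real] by auto
    moreover have "\<beta> \<noteq> 0" using \<beta> by auto
    ultimately show ?thesis using dim_at_most_2_curve by metis
  next
    case False
    then show ?thesis unfolding orb
      by (intro dim_at_most_2_surface[OF \<beta>]) (auto simp: v0_def v1_def v2_def)
  qed
qed


section \<open>Integrability\<close>

context G_bundle_with_torsion
begin

text \<open>
  The differentiability of the torsion functions is stated through their differential forms of degree
  zero; here it is unwrapped to the coordinate expressions.
\<close>

lemma torsion_smooth:
  assumes "C \<in> G_atlas N GG"
  shows "smooth_on (snd C ` (GG \<inter> fst C)) (\<lambda>y. \<tau> (chart_inv C y) $ k)"
proof -
  have o: "open (snd C ` (GG \<inter> fst C))" by (rule G_atlas_open[OF assms])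
  have "smooth_on (snd C ` (GG \<inter> fst C)) (\<lambda>y. fn_form (G_atlas N GG) (\<lambda>x. \<tau> x $ k) (chart_inv C y) C [])"
    using str assms unfolding structure_equations_def degree_forms_def forms_def by blast
  moreover have "fn_form (G_atlas N GG) (\<lambda>x. \<tau> x $ k) (chart_inv C y) C [] = \<tau> (chart_inv C y) $ k"
    if y: "y \<in> snd C ` (GG \<inter> fst C)" for y
  proof -
    obtain x where x: "x \<in> fst C" "y = snd C x" using y by blast
    obtain K U \<sigma> where K: "K \<in> N" "G_section N GG U \<sigma>" "C = G_chart GG K U \<sigma>"
      using assms by (rule G_atlas_cases)
    have "chart_inv C y = x"
      using chart_inv_simp[OF G_chart_inj[OF K(1,2)], of x] x unfolding K(3) by simp
    then show ?thesis using x assms by (simp add: fn_form_def)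
  qed
  ultimately show ?thesis by (rule smooth_on_cong[OF o, rotated])
qed

lemma scaled_taut_forms:
  assumes "\<And>C. C \<in> G_atlas N GG \<Longrightarrow> smooth_on (snd C ` (GG \<inter> fst C)) (\<lambda>y. f (chart_inv C y))"
  shows "(\<lambda>x. f x *\<^sub>\<Lambda> taut N GG i x) \<in> forms (G_atlas N GG) GG"
  by (rule forms_scale[OF G_atlas_open taut_forms assms])

text \<open>
  A form in the ideal generated by \<open>\<omega>\<^sup>i\<close> vanishes on the vectors annihilated by \<open>\<omega>\<^sup>i\<close>. On a local
  section there are vectors on which the coframe has prescribed components.
\<close>

lemma ideal_imp_components_vanish:
  assumes mem: "ext_d (G_atlas N GG) GG (taut N GG i) \<in> alg_ideal (G_atlas N GG) GG {taut N GG i}"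
    and x: "x \<in> GG"
  shows "\<exists>u C (E :: cof \<Rightarrow> 'e). (\<forall>j. u j C [] = 0) \<and>
    (\<forall>j m. u j C [(E m, 0)] = (if j = m then 1 else 0)) \<and>
    (\<forall>m n. m \<noteq> i \<longrightarrow> n \<noteq> i \<longrightarrow>
      (conn (\<phi> x) (\<pi> x) (\<alpha> x) (\<beta> x) u i + torsion (\<tau> x) u i) C [(E m, 0), (E n, 0)] = 0)"
proof -
  obtain p v where xe: "x = (p, v)" by (cases x)
  obtain U \<sigma> k where sec: "G_section N GG U \<sigma>" and p: "p \<in> U" "p \<in> fst k" and k: "k \<in> N"
    and ve: "v = (\<lambda>i. \<sigma> i p)"
    using section_through[of p v] x unfolding xe by blast
  let ?C = "G_chart GG k U \<sigma>" and ?u = "\<lambda>j. taut N GG j x"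
  note cof = section_coframing[OF sec]
  have "\<forall>m. \<exists>e. \<forall>j. \<sigma> j p k [e] = (if j = m then 1 else 0)"
  proof
    fix m
    obtain e where "\<And>j. \<sigma> j p k [e] = (if j = m then 1 else 0)"
      using coframing_components_surj[OF cof p(1) k p(2), of "\<lambda>j. if j = m then 1 else 0"] by blast
    then show "\<exists>e. \<forall>j. \<sigma> j p k [e] = (if j = m then 1 else 0)" by blast
  qed
  then obtain E where E: "\<And>m j. \<sigma> j p k [E m] = (if j = m then 1 else 0)" by metis
  have u1: "?u j ?C [(E m, 0)] = (if j = m then 1 else 0)" for j m
    unfolding xe ve taut_section[OF sec k p] by (simp add: E)
  have u0: "?u j ?C [] = 0" for j
    unfolding xe ve taut_section[OF sec k p] using coframing_degree[OF cof] by simp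
  let ?J = "{\<eta> \<in> forms (G_atlas N GG) GG. \<forall>x C ws. set ws \<subseteq> {w. taut N GG i x C [w] = 0} \<longrightarrow> \<eta> x C ws = 0}"
  have "taut N GG i x C ws = 0" if ws: "set ws \<subseteq> {w. taut N GG i x C [w] = 0}" for x C ws
  proof (cases "C \<in> G_atlas N GG \<and> x \<in> GG \<and> x \<in> fst C \<and> length ws \<noteq> 1")
    case True
    then have C: "C \<in> G_atlas N GG" by blast
    obtain K V \<rho> where K: "K \<in> N" "G_section N GG V \<rho>" "C = G_chart GG K V \<rho>"
      using C by (rule G_atlas_cases)
    have xK: "x \<in> fst (G_chart GG K V \<rho>)" using True K by blast
    obtain q r a b c where q: "q \<in> fst K" "q \<in> V" "r \<noteq> 0" "x = (q, coact (\<lambda>i. \<rho> i q) (Gmat r a b c))"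
      using xK unfolding mem_G_chart[OF K(1,2)] by blast
    show ?thesis
      unfolding K(3) taut_apply[OF K(1,2) xK] using True
      by (simp add: q(4) coact_def sum_alt_form_apply scale_def coframing_degree[OF section_coframing[OF K(2)]])
  next
    case False
    show ?thesis
    proof (cases "length ws = 1")
      case True
      then obtain w where "ws = [w]" by (auto simp: length_Suc_conv)
      then show ?thesis using ws by simp
    next
      case l: False
      then show ?thesis using False by (auto simp: taut_def pull_at_def)
    qed
  qed
  then have "{taut N GG i} \<subseteq> ?J" using taut_forms by blast
  then have "alg_ideal (G_atlas N GG) GG {taut N GG i} \<subseteq> ?J"
    by (intro alg_ideal_subset is_ideal_vanishing_forms G_atlas_open)
  then have van: "ext_d (G_atlas N GG) GG (taut N GG i) x ?C ws = 0"
    if "set ws \<subseteq> {w. taut N GG i x ?C [w] = 0}" for ws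
    using mem that by blast
  have "(conn (\<phi> x) (\<pi> x) (\<alpha> x) (\<beta> x) ?u i + torsion (\<tau> x) ?u i) ?C [(E m, 0), (E n, 0)] = 0"
    if "m \<noteq> i" "n \<noteq> i" for m n
    unfolding structure_eq[OF x, symmetric] by (rule van) (use that in \<open>simp add: u1\<close>)
  then show ?thesis using u0 u1 by (intro exI[of _ ?u] exI[of _ ?C] exI[of _ E] conjI) simp_all
qed

lemma ideal_1_imp_integrable:
  assumes "ext_d (G_atlas N GG) GG (taut N GG W1) \<in> alg_ideal (G_atlas N GG) GG {taut N GG W1}" and "x \<in> GG"
  shows "integrable_1 (\<tau> x)"
proof -
  obtain u C E where u0: "\<And>j. u j C [] = 0" and u: "\<And>j m. u j C [(E m, 0)] = (if j = m then 1 else 0)"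
    and z: "\<And>m n. m \<noteq> W1 \<Longrightarrow> n \<noteq> W1 \<Longrightarrow>
      (conn (\<phi> x) (\<pi> x) (\<alpha> x) (\<beta> x) u W1 + torsion (\<tau> x) u W1) C [(E m, 0), (E n, 0)] = 0"
    using ideal_imp_components_vanish[OF assms] by blast
  note z = z[unfolded structure_form_apply[of u C "\<phi> x" "\<pi> x" "\<alpha> x" "\<beta> x", OF u0 connection_degree] Let_def u]
  show ?thesis
    unfolding integrable_1_def
    using z[of W3 Gm] z[of Gm W2] z[of W0 W0b] z[of W0 W2] z[of W0b W2] by simp
qed

lemma ideal_3_imp_integrable:
  assumes "ext_d (G_atlas N GG) GG (taut N GG W3) \<in> alg_ideal (G_atlas N GG) GG {taut N GG W3}" and "x \<in> GG"
  shows "integrable_3 (\<tau> x)"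
proof -
  obtain u C E where u0: "\<And>j. u j C [] = 0" and u: "\<And>j m. u j C [(E m, 0)] = (if j = m then 1 else 0)"
    and z: "\<And>m n. m \<noteq> W3 \<Longrightarrow> n \<noteq> W3 \<Longrightarrow>
      (conn (\<phi> x) (\<pi> x) (\<alpha> x) (\<beta> x) u W3 + torsion (\<tau> x) u W3) C [(E m, 0), (E n, 0)] = 0"
    using ideal_imp_components_vanish[OF assms] by blast
  note z = z[unfolded structure_form_apply[of u C "\<phi> x" "\<pi> x" "\<alpha> x" "\<beta> x", OF u0 connection_degree] Let_def u]
  show ?thesis
    unfolding integrable_3_def
    using z[of W1 Gm] z[of Gm W4] z[of W0b W0] z[of W0 W4] z[of W0b W4] by simp
qed

lemma taut_wedge_in_ideal:
  assumes "\<And>C. C \<in> G_atlas N GG \<Longrightarrow> smooth_on (snd C ` (GG \<inter> fst C)) (\<lambda>y. f (chart_inv C y))"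
  shows "(\<lambda>x. f x *\<^sub>\<Lambda> (taut N GG j x \<and>\<^sub>\<Lambda> taut N GG i x)) \<in> alg_ideal (G_atlas N GG) GG {taut N GG i}"
    and "(\<lambda>x. f x *\<^sub>\<Lambda> (taut N GG i x \<and>\<^sub>\<Lambda> taut N GG j x)) \<in> alg_ideal (G_atlas N GG) GG {taut N GG i}"
proof -
  have g: "taut N GG i \<in> alg_ideal (G_atlas N GG) GG {taut N GG i}" by (rule alg_ideal_generator) simp
  show "(\<lambda>x. f x *\<^sub>\<Lambda> (taut N GG j x \<and>\<^sub>\<Lambda> taut N GG i x)) \<in> alg_ideal (G_atlas N GG) GG {taut N GG i}"
    using alg_ideal_wedge_left[OF g scaled_taut_forms[of f j, OF assms]]
    by (simp add: wedge_form_def wedge_scale_left)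
  show "(\<lambda>x. f x *\<^sub>\<Lambda> (taut N GG i x \<and>\<^sub>\<Lambda> taut N GG j x)) \<in> alg_ideal (G_atlas N GG) GG {taut N GG i}"
    using alg_ideal_wedge_right[OF g scaled_taut_forms[of f j, OF assms]]
    by (simp add: wedge_form_def wedge_scale_right)
qed

lemma ext_d_taut_off: "x \<notin> GG \<Longrightarrow> ext_d (G_atlas N GG) GG (taut N GG i) x = 0"
  and taut_off: "x \<notin> GG \<Longrightarrow> taut N GG i x = 0"
  by (auto simp: ext_d_def taut_def fun_eq_iff)

lemma affine_torsion_smooth:
  assumes "C \<in> G_atlas N GG"
  shows "smooth_on (snd C ` (GG \<inter> fst C)) (\<lambda>y. m * (\<tau> (chart_inv C y) $ k + \<tau> (chart_inv C y) $ l + 1))"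
  by (intro smooth_on_add smooth_on_mult smooth_on_const torsion_smooth G_atlas_open assms)

lemma integrable_1_imp_ideal:
  assumes "\<And>x. x \<in> GG \<Longrightarrow> integrable_1 (\<tau> x) \<and> integrable_3 (\<tau> x)"
  shows "ext_d (G_atlas N GG) GG (taut N GG W1) \<in> alg_ideal (G_atlas N GG) GG {taut N GG W1}"
proof -
  let ?w = "taut N GG"
  have "ext_d (G_atlas N GG) GG (?w W1) x =
      (\<tau> x $ T11) *\<^sub>\<Lambda> (?w W0 x \<and>\<^sub>\<Lambda> ?w W1 x) + (\<tau> x $ T11b) *\<^sub>\<Lambda> (?w W0b x \<and>\<^sub>\<Lambda> ?w W1 x)
      + (\<tau> x $ R11) *\<^sub>\<Lambda> (?w Gm x \<and>\<^sub>\<Lambda> ?w W1 x)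
      + (- 1 / 2 * (\<tau> x $ P1 + \<tau> x $ P3 + 1)) *\<^sub>\<Lambda> (?w W1 x \<and>\<^sub>\<Lambda> ?w W3 x)" for x
  proof (cases "x \<in> GG")
    case True
    have z: "\<tau> x $ P2 = 0" "\<tau> x $ R12 = 0" "\<tau> x $ T10 = 0" "\<tau> x $ T12 = 0" "\<tau> x $ T12b = 0" "\<tau> x $ P4 = 0"
      using assms[OF True] unfolding integrable_1_def integrable_3_def by blast+
    show ?thesis
      unfolding structure_eq[OF True] conn_def torsion_def cof.case z
      by (simp add: wedge_scale_right) (simp add: fun_eq_iff scale_def)
  next
    case False
    then show ?thesis by (simp add: ext_d_taut_off taut_off)
  qed
  then have e: "ext_d (G_atlas N GG) GG (?w W1) =
      (\<lambda>x. (\<tau> x $ T11) *\<^sub>\<Lambda> (?w W0 x \<and>\<^sub>\<Lambda> ?w W1 x)) + (\<lambda>x. (\<tau> x $ T11b) *\<^sub>\<Lambda> (?w W0b x \<and>\<^sub>\<Lambda> ?w W1 x))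
      + (\<lambda>x. (\<tau> x $ R11) *\<^sub>\<Lambda> (?w Gm x \<and>\<^sub>\<Lambda> ?w W1 x))
      + (\<lambda>x. (- 1 / 2 * (\<tau> x $ P1 + \<tau> x $ P3 + 1)) *\<^sub>\<Lambda> (?w W1 x \<and>\<^sub>\<Lambda> ?w W3 x))"
    by (intro ext) simp
  show ?thesis
    unfolding e by (intro alg_ideal_add taut_wedge_in_ideal torsion_smooth affine_torsion_smooth)
qed

lemma integrable_3_imp_ideal:
  assumes "\<And>x. x \<in> GG \<Longrightarrow> integrable_1 (\<tau> x) \<and> integrable_3 (\<tau> x)"
  shows "ext_d (G_atlas N GG) GG (taut N GG W3) \<in> alg_ideal (G_atlas N GG) GG {taut N GG W3}"
proof -
  let ?w = "taut N GG"
  have "ext_d (G_atlas N GG) GG (?w W3) x =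
      (\<tau> x $ T33b) *\<^sub>\<Lambda> (?w W0b x \<and>\<^sub>\<Lambda> ?w W3 x) + (\<tau> x $ T33) *\<^sub>\<Lambda> (?w W0 x \<and>\<^sub>\<Lambda> ?w W3 x)
      + (\<tau> x $ R33) *\<^sub>\<Lambda> (?w Gm x \<and>\<^sub>\<Lambda> ?w W3 x)
      + (1 / 2 * (\<tau> x $ P1 + \<tau> x $ P3 + 1)) *\<^sub>\<Lambda> (?w W1 x \<and>\<^sub>\<Lambda> ?w W3 x)" for x
  proof (cases "x \<in> GG")
    case True
    have z: "\<tau> x $ P4 = 0" "\<tau> x $ R34 = 0" "\<tau> x $ T30 = 0" "\<tau> x $ T34 = 0" "\<tau> x $ T34b = 0" "\<tau> x $ P2 = 0"
      using assms[OF True] unfolding integrable_1_def integrable_3_def by blast+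
    show ?thesis
      unfolding structure_eq[OF True] conn_def torsion_def cof.case z
      by (simp add: wedge_scale_right)
  next
    case False
    then show ?thesis by (simp add: ext_d_taut_off taut_off)
  qed
  then have e: "ext_d (G_atlas N GG) GG (?w W3) =
      (\<lambda>x. (\<tau> x $ T33b) *\<^sub>\<Lambda> (?w W0b x \<and>\<^sub>\<Lambda> ?w W3 x)) + (\<lambda>x. (\<tau> x $ T33) *\<^sub>\<Lambda> (?w W0 x \<and>\<^sub>\<Lambda> ?w W3 x))
      + (\<lambda>x. (\<tau> x $ R33) *\<^sub>\<Lambda> (?w Gm x \<and>\<^sub>\<Lambda> ?w W3 x))
      + (\<lambda>x. (1 / 2 * (\<tau> x $ P1 + \<tau> x $ P3 + 1)) *\<^sub>\<Lambda> (?w W1 x \<and>\<^sub>\<Lambda> ?w W3 x))"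
    by (intro ext) simp
  show ?thesis
    unfolding e by (intro alg_ideal_add taut_wedge_in_ideal torsion_smooth affine_torsion_smooth)
qed

text \<open>
  Both conditions say that the ten functions in \<^const>\<open>integrable_1\<close> and \<^const>\<open>integrable_3\<close> vanish on the whole
  bundle.
\<close>

lemma orbit_dimension_iff_integrable:
  "(\<forall>p\<in>points N. dim_at_most_2 (orbit GG \<tau> p)) \<longleftrightarrow>
     ext_d (G_atlas N GG) GG (taut N GG W1) \<in> alg_ideal (G_atlas N GG) GG {taut N GG W1} \<and>
     ext_d (G_atlas N GG) GG (taut N GG W3) \<in> alg_ideal (G_atlas N GG) GG {taut N GG W3}"
proof
  assume dim: "\<forall>p\<in>points N. dim_at_most_2 (orbit GG \<tau> p)"
  have "integrable_1 (\<tau> x) \<and> integrable_3 (\<tau> x)" if x: "x \<in> GG" for x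
  proof -
    have "fst x \<in> points N" using x G_str unfolding G_structure_def by blast
    moreover have "orbit GG \<tau> (fst x) = torsion_orbit (\<tau> x)"
      using orbit_eq[of "fst x" "snd x"] x unfolding torsion_orbit_def by simp
    ultimately show ?thesis using dim orbit_dim_imp_integrable by metis
  qed
  then show "ext_d (G_atlas N GG) GG (taut N GG W1) \<in> alg_ideal (G_atlas N GG) GG {taut N GG W1} \<and>
     ext_d (G_atlas N GG) GG (taut N GG W3) \<in> alg_ideal (G_atlas N GG) GG {taut N GG W3}"
    using integrable_1_imp_ideal integrable_3_imp_ideal by blast
next
  assume int: "ext_d (G_atlas N GG) GG (taut N GG W1) \<in> alg_ideal (G_atlas N GG) GG {taut N GG W1} \<and>
     ext_d (G_atlas N GG) GG (taut N GG W3) \<in> alg_ideal (G_atlas N GG) GG {taut N GG W3}"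
  show "\<forall>p\<in>points N. dim_at_most_2 (orbit GG \<tau> p)"
  proof
    fix p assume "p \<in> points N"
    show "dim_at_most_2 (orbit GG \<tau> p)"
    proof (cases "\<exists>u. (p, u) \<in> GG")
      case True
      then obtain u where u: "(p, u) \<in> GG" by blast
      have "orbit GG \<tau> p = torsion_orbit (\<tau> (p, u))"
        using orbit_eq[OF u] unfolding torsion_orbit_def .
      then show ?thesis
        using ideal_1_imp_integrable ideal_3_imp_integrable integrable_imp_orbit_dim int u by metis
    next
      case False
      then have "orbit GG \<tau> p = {}" unfolding orbit_def by auto
      then show ?thesis by (simp add: dim_at_most_2_def)
    qed
  qed
qed

end

theorem proposition5p2:
  fixes N :: "('n, real ^ 7) chart set" and M :: "('m, real ^ 5) chart set"
    and M' :: "('l, real ^ 5) chart set"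
    and B :: "('n, real ^ 7) form set" and I :: "('m, real ^ 5) form set"
    and I' :: "('l, real ^ 5) form set"
    and pr :: "'n \<Rightarrow> 'm" and pr' :: "'n \<Rightarrow> 'l"
    and X10 X01 :: "'n \<Rightarrow> ('n, real ^ 7) alt_form set"
    and GG :: "('n, real ^ 7) cofpt set"
    and \<phi> \<pi> \<alpha> \<beta> :: "(('n, real ^ 7) cofpt, (real ^ 7) \<times> real \<times> real \<times> real \<times> real) form"
    and \<tau> :: "('n, real ^ 7) cofpt \<Rightarrow> real ^ tors"
  assumes "smooth_manifold N" and "smooth_manifold M" and "smooth_manifold M'"
    and "type_B1 N B M I pr M' I' pr' X10 X01"
    and "Pfaffian N B"
    and "G_structure N GG"
    and "\<And>U \<sigma>. one_adapted N B M I pr M' I' pr' X10 X01 U \<sigma> \<longleftrightarrow> G_section N GG U \<sigma>"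
    and "structure_equations N GG \<phi> \<pi> \<alpha> \<beta> \<tau>"
    and "torsion_variation N GG \<phi> \<pi> \<alpha> \<beta> \<tau>"
  shows "(\<forall>p\<in>points N. dim_at_most_2 (orbit GG \<tau> p)) \<longleftrightarrow>
     ext_d (G_atlas N GG) GG (taut N GG W1) \<in> alg_ideal (G_atlas N GG) GG {taut N GG W1} \<and>
     ext_d (G_atlas N GG) GG (taut N GG W3) \<in> alg_ideal (G_atlas N GG) GG {taut N GG W3}"
proof -
  interpret G_bundle_with_torsion N GG \<phi> \<pi> \<alpha> \<beta> \<tau>
    by unfold_locales (use assms in blast)+
  show ?thesis by (rule orbit_dimension_iff_integrable)
qed

end
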